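(* Let $V$ be a shift-invariant subspace of $L^2(\mathbb{R}^n)$ and let $N\in\mathbb{N}\cup\{\infty\}$. There exists a collection $\Phi=\{\phi_i\}_{i=1}^N\subset L^2(\mathbb{R}^n)$ such that $$\{\phi_i(x+k): i\in\{1,\ldots,N\},\ k\in\mathbb{Z}^n\}$$ is an orthonormal basis for $V$ if and only if $\dim_V(x)=N$ for a.e. $x\in\mathbb{T}^n$.
   Context: When $N=\infty$, the index set $\{1,\dots,N\}$ means $\{1,2,3,\dots\}$. A closed subspace $V\subset L^2(\mathbb{R}^n)$ is shift-invariant if $f(\cdot+k)\in V$ whenever $f\in V$ and $k\in\mathbb{Z}^n$. $\mathbb{T}^n=\mathbb{R}^n/\mathbb{Z}^n$ is identified with $[0,1)^n$. The Fourier transform is normalized to be unitary with $\hat f(\xi)=\int_{\mathbb{R}^n} f(x)e^{-2\pi i\langle \xi,x\rangle}\,dx$, and $\mathcal{T}:L^2(\mathbb{R}^n)\to L^2(\mathbb{T}^n,\ell^2(\mathbb{Z}^n))$ is the isometric isomorphism $\mathcal{T}f(x)=(\hat f(x+k))_{k\in\mathbb{Z}^n}$. A range function is a map $J$ from $\mathbb{T}^n$ to the set of closed linear subspaces of $\ell^2(\mathbb{Z}^n)$; it is measurable if the orthogonal projections $P(x):\ell^2(\mathbb{Z}^n)\to J(x)$ are weakly operator measurable. By a theorem of Helson, for each shift-invariant $V$ there is a measurable range function $J$, unique up to a.e. equality, with $V=\{f\in L^2(\mathbb{R}^n): \mathcal{T}f(x)\in J(x)\text{ for a.e. }x\in\mathbb{T}^n\}$;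 moreover, if $V$ is the closed linear span of $\{\phi(\cdot+k):k\in\mathbb{Z}^n,\phi\in\Phi\}$ for a countable $\Phi$, then $J(x)=\overline{\mathrm{span}}\{\mathcal{T}\phi(x):\phi\in\Phi\}$ for a.e. $x$. The dimension function of $V$ is $\dim_V:\mathbb{T}^n\to\mathbb{N}\cup\{0,\infty\}$, $\dim_V(x)=\dim J(x)$, where $\dim J(x)=\infty$ if $J(x)$ is infinite-dimensional. *)

theory Defs
  imports "HOL-Analysis.Analysis" "HOL-Library.Function_Algebras" "HOL-Library.Extended_Nat"
begin

text \<open>Complex vector space structure on \<^typ>\<open>'a \<Rightarrow> complex\<close>, giving access to the library's
  \<^emph>\<open>subspace\<close>, \<^emph>\<open>span\<close> and \<^emph>\<open>dim\<close> over the complex field.\<close>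

definition cscale :: "complex \<Rightarrow> ('a \<Rightarrow> complex) \<Rightarrow> 'a \<Rightarrow> complex" where
  "cscale c f = (\<lambda>x. c * f x)"

interpretation cfun: vector_space "cscale :: complex \<Rightarrow> ('a \<Rightarrow> complex) \<Rightarrow> 'a \<Rightarrow> complex"
  by unfold_locales (auto simp: cscale_def fun_eq_iff algebra_simps)

text \<open>The library's dimension is a natural number, equal to 0 on infinite-dimensional spaces;
  here these get dimension \<^term>\<open>\<infinity> :: enat\<close>. Meant for subspaces only.\<close>

definition cdim :: "('a \<Rightarrow> complex) set \<Rightarrow> enat" where
  "cdim S = (if \<exists>B. finite B \<and> cfun.span B = S then enat (cfun.dim S) else \<infinity>)"


text \<open>Elements of \<^emph>\<open>L2 M\<close> are functions rather than classes modulo almost everywhere equality.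
  A set of classes corresponds to a set of functions saturated under almost everywhere equality
  within \<^emph>\<open>L2 M\<close>; closed subspaces below are automatically saturated (take constant sequences).
  The sequence space \<open>\<ell>\<^sup>2\<close> is the case of counting measure.\<close>

definition L2 :: "'a measure \<Rightarrow> ('a \<Rightarrow> complex) set" where
  "L2 M = {f \<in> borel_measurable M. integrable M (\<lambda>x. (cmod (f x))\<^sup>2)}"

definition L2_inner :: "'a measure \<Rightarrow> ('a \<Rightarrow> complex) \<Rightarrow> ('a \<Rightarrow> complex) \<Rightarrow> complex" where
  "L2_inner M f g = (\<integral>x. f x * cnj (g x) \<partial>M)"

definition L2_norm :: "'a measure \<Rightarrow> ('a \<Rightarrow> complex) \<Rightarrow> real" where
  "L2_norm M f = sqrt (\<integral>x. (cmod (f x))\<^sup>2 \<partial>M)"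

text \<open>Only meaningful within \<^emph>\<open>L2 M\<close>, as non-integrable functions have integral 0.\<close>

definition L2_converges :: "'a measure \<Rightarrow> (nat \<Rightarrow> 'a \<Rightarrow> complex) \<Rightarrow> ('a \<Rightarrow> complex) \<Rightarrow> bool" where
  "L2_converges M s f \<longleftrightarrow> (\<lambda>m. L2_norm M (s m - f)) \<longlonglongrightarrow> 0"

definition closed_subspace :: "'a measure \<Rightarrow> ('a \<Rightarrow> complex) set \<Rightarrow> bool" where
  "closed_subspace M V \<longleftrightarrow> V \<subseteq> L2 M \<and> cfun.subspace V \<and>
     (\<forall>s f. (\<forall>m. s m \<in> V) \<and> f \<in> L2 M \<and> L2_converges M s f \<longrightarrow> f \<in> V)"

definition closed_span :: "'a measure \<Rightarrow> ('a \<Rightarrow> complex) set \<Rightarrow> ('a \<Rightarrow> complex) set" where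
  "closed_span M S = {f \<in> L2 M. \<exists>s. (\<forall>m. s m \<in> cfun.span S) \<and> L2_converges M s f}"

definition orthonormal_basis ::
    "'a measure \<Rightarrow> 'i set \<Rightarrow> ('i \<Rightarrow> 'a \<Rightarrow> complex) \<Rightarrow> ('a \<Rightarrow> complex) set \<Rightarrow> bool" where
  "orthonormal_basis M I e V \<longleftrightarrow>
     (\<forall>i\<in>I. e i \<in> V) \<and>
     (\<forall>i\<in>I. \<forall>j\<in>I. L2_inner M (e i) (e j) = (if i = j then 1 else 0)) \<and>
     closed_span M (e ` I) = V"

abbreviation ell2 :: "('k \<Rightarrow> complex) set" where
  "ell2 \<equiv> L2 (count_space UNIV)"

definition ell2_proj :: "('k \<Rightarrow> complex) set \<Rightarrow> ('k \<Rightarrow> complex) \<Rightarrow> 'k \<Rightarrow> complex" where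
  "ell2_proj S a = (THE p. p \<in> S \<and> (\<forall>q\<in>S. L2_inner (count_space UNIV) (a - p) q = 0))"


definition lattice_vec :: "int ^ 'n \<Rightarrow> real ^ 'n" where
  "lattice_vec k = (\<chi> i. real_of_int (k $ i))"

definition torus :: "(real ^ 'n) set" where
  "torus = {x. \<forall>i. 0 \<le> x $ i \<and> x $ i < 1}"

definition shift_invariant :: "(real ^ 'n \<Rightarrow> complex) set \<Rightarrow> bool" where
  "shift_invariant V \<longleftrightarrow> closed_subspace lebesgue V \<and>
     (\<forall>f\<in>V. \<forall>k. (\<lambda>x. f (x + lattice_vec k)) \<in> V)"

definition fourier_integral :: "(real ^ 'n \<Rightarrow> complex) \<Rightarrow> real ^ 'n \<Rightarrow> complex" where
  "fourier_integral f \<xi> =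
     (\<integral>x. f x * exp (- (2 * complex_of_real pi * \<i> * complex_of_real (\<xi> \<bullet> x))) \<partial>lebesgue)"

text \<open>The Fourier transform on \<open>L\<^sup>2\<close> is the continuous extension of the Fourier integral from
  \<open>L\<^sup>1 \<inter> L\<^sup>2\<close>; its value is determined up to almost everywhere equality, and
  a representative is chosen.\<close>

definition is_fourier_transform :: "(real ^ 'n \<Rightarrow> complex) \<Rightarrow> (real ^ 'n \<Rightarrow> complex) \<Rightarrow> bool" where
  "is_fourier_transform f g \<longleftrightarrow> g \<in> L2 lebesgue \<and>
     (\<exists>s. (\<forall>m. s m \<in> L2 lebesgue \<and> integrable lebesgue (s m)) \<and>
          L2_converges lebesgue s f \<and>
          L2_converges lebesgue (\<lambda>m. fourier_integral (s m)) g)"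

definition fourier :: "(real ^ 'n \<Rightarrow> complex) \<Rightarrow> real ^ 'n \<Rightarrow> complex" where
  "fourier f = (SOME g. is_fourier_transform f g)"

text \<open>For \<open>f\<close> in \<open>L\<^sup>2\<close> the fiber below lies in \<open>\<ell>\<^sup>2\<close> for almost every \<open>x\<close>.\<close>

definition fiber :: "(real ^ 'n \<Rightarrow> complex) \<Rightarrow> real ^ 'n \<Rightarrow> int ^ 'n \<Rightarrow> complex" where
  "fiber f x = (\<lambda>k. fourier f (x + lattice_vec k))"


definition range_function :: "(real ^ 'n \<Rightarrow> (int ^ 'n \<Rightarrow> complex) set) \<Rightarrow> bool" where
  "range_function J \<longleftrightarrow> (\<forall>x\<in>torus. closed_subspace (count_space UNIV) (J x))"

definition measurable_range_function :: "(real ^ 'n \<Rightarrow> (int ^ 'n \<Rightarrow> complex) set) \<Rightarrow> bool" where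
  "measurable_range_function J \<longleftrightarrow> range_function J \<and>
     (\<forall>a\<in>ell2. \<forall>b\<in>ell2.
        (\<lambda>x. L2_inner (count_space UNIV) (ell2_proj (J x) a) b)
          \<in> borel_measurable (lebesgue_on torus))"

definition is_range_function_of ::
    "(real ^ 'n \<Rightarrow> (int ^ 'n \<Rightarrow> complex) set) \<Rightarrow> (real ^ 'n \<Rightarrow> complex) set \<Rightarrow> bool" where
  "is_range_function_of J V \<longleftrightarrow> measurable_range_function J \<and>
     V = {f \<in> L2 lebesgue. AE x in lebesgue_on torus. fiber f x \<in> J x}"

text \<open>By Helson's theorem every shift-invariant space has such a range function, unique up to
  almost everywhere equality; so the choice affects the dimension function only on a null set.\<close>

definition range_function_of ::
    "(real ^ 'n \<Rightarrow> complex) set \<Rightarrow> real ^ 'n \<Rightarrow> (int ^ 'n \<Rightarrow> complex) set" where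
  "range_function_of V = (SOME J. is_range_function_of J V)"

definition dim_fun :: "(real ^ 'n \<Rightarrow> complex) set \<Rightarrow> real ^ 'n \<Rightarrow> enat" where
  "dim_fun V x = cdim (range_function_of V x)"

definition index_set :: "enat \<Rightarrow> nat set" where
  "index_set N = {i. 1 \<le> i \<and> enat i \<le> N}"

end

theory Submission imports Defs "HOL-Probability.Characteristic_Functions"
begin

text \<open>The Fourier transform turns the translates of \<open>\<phi>\<close> into the products of its transform \<open>\<psi>\<close> with the characters
  of the torus. By uniqueness of Fourier coefficients, these are orthonormal iff the fibers of the
  functions \<open>\<psi>\<^sub>i\<close> are orthonormal at almost every point, and they generate the transform of \<open>V\<close> iff the fibers
  generate \<open>J x\<close> at almost every \<open>x\<close>. A basis of translates thus amounts to a measurable choice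
  of orthonormal bases of the spaces \<open>J x\<close> with index set independent of \<open>x\<close>. Given a constant dimension, such a choice is made
  by the Gram-Schmidt process applied to the fibers of countably many generators, skipping the
  vectors that vanish; surjectivity of the Fourier transform brings it back to \<open>V\<close>.\<close>

section \<open>Square integrable functions\<close>

text \<open>Elements of \<open>L2\<close> are functions, and \<open>fourier\<close> and
  \<open>range_function_of\<close> select arbitrary representatives. The argument therefore runs on
  the relation \<open>is_fourier_transform\<close>, whose image of \<open>V\<close> contains every
  representative of every transform. Helson's theorem enters twice: existence, so that
  \<open>range_function_of V\<close> is a range function at all, and uniqueness almost everywhere,
  so that any convenient description of the spaces may replace it. The obstacle in the converse
  direction is measurability. Bases of the spaces \<open>J x\<close> cannot be chosen point by
  point; the Gram-Schmidt formulas are explicit and hence measurable in \<open>x\<close>, but the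
  positions of the vanishing vectors vary with \<open>x\<close>. Nonzero members are therefore
  counted at each point, and the \<open>i\<close>-th of them becomes the \<open>i\<close>-th basis
  vector. Constancy of the dimension says exactly that the same indices \<open>i\<close> are in use
  at almost every \<open>x\<close>.\<close>

lemma minus_fun_eval [simp]: "(f - g) x = f x - g x" for f g :: "'a \<Rightarrow> complex"
  by (simp add: fun_diff_def)

lemma cscale_apply [simp]: "cscale c f x = c * f x"
  by (simp add: cscale_def)

lemma sum_fun_eval: "(\<Sum>i\<in>I. f i) x = (\<Sum>i\<in>I. f i x)" for f :: "'i \<Rightarrow> 'a \<Rightarrow> complex"
  by (induction I rule: infinite_finite_induct) auto

lemma borel_measurable_cnj [measurable (raw)]:
  "f \<in> borel_measurable M \<Longrightarrow> (\<lambda>x. cnj (f x)) \<in> borel_measurable M"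
  by (rule borel_measurable_continuous_on[OF continuous_on_cnj[OF continuous_on_id]])

lemma L2_measurable [dest]: "f \<in> L2 M \<Longrightarrow> f \<in> borel_measurable M"
  by (simp add: L2_def)

lemma L2_integrable_sq [intro]: "f \<in> L2 M \<Longrightarrow> integrable M (\<lambda>x. (cmod (f x))\<^sup>2)"
  by (simp add: L2_def)

lemma L2I: "f \<in> borel_measurable M \<Longrightarrow> integrable M (\<lambda>x. (cmod (f x))\<^sup>2) \<Longrightarrow> f \<in> L2 M"
  by (simp add: L2_def)

lemma cmod_mult_le_sq: "cmod (a * b) \<le> (cmod a)\<^sup>2 + (cmod b)\<^sup>2"
proof -
  have "2 * (cmod a * cmod b) \<le> (cmod a)\<^sup>2 + (cmod b)\<^sup>2"
    using sum_squares_bound[of "cmod a" "cmod b"] by (simp add: mult.assoc)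
  moreover have "0 \<le> cmod a * cmod b" by simp
  ultimately show ?thesis unfolding norm_mult by linarith
qed

lemma L2_integrable_prod:
  assumes "f \<in> L2 M" "g \<in> L2 M" shows "integrable M (\<lambda>x. f x * g x)"
proof (rule Bochner_Integration.integrable_bound)
  show "integrable M (\<lambda>x. (cmod (f x))\<^sup>2 + (cmod (g x))\<^sup>2)"
    using assms by (auto simp: L2_def)
  show "(\<lambda>x. f x * g x) \<in> borel_measurable M"
    using assms by (auto simp: L2_def)
  show "AE x in M. norm (f x * g x) \<le> norm ((cmod (f x))\<^sup>2 + (cmod (g x))\<^sup>2)"
    by (intro AE_I2) (use cmod_mult_le_sq in \<open>force simp: abs_of_nonneg\<close>)
qed

lemma L2_cnj: "f \<in> L2 M \<Longrightarrow> (\<lambda>x. cnj (f x)) \<in> L2 M"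
  by (auto simp: L2_def)

lemma L2_integrable_inner:
  assumes "f \<in> L2 M" "g \<in> L2 M" shows "integrable M (\<lambda>x. f x * cnj (g x))"
  using L2_integrable_prod[OF assms(1) L2_cnj[OF assms(2)]] .

lemma L2_zero [simp]: "0 \<in> L2 M" "(\<lambda>x. 0) \<in> L2 M"
  by (auto simp: L2_def zero_fun_def)

lemma L2_cscale [intro]: assumes "f \<in> L2 M" shows "cscale c f \<in> L2 M"
  using assms by (auto simp: L2_def norm_mult power_mult_distrib cscale_def)

lemma L2_add [intro]: assumes "f \<in> L2 M" "g \<in> L2 M" shows "f + g \<in> L2 M"
proof (rule L2I)
  show m: "f + g \<in> borel_measurable M"
    using assms by (auto simp: L2_def plus_fun_def)
  show "integrable M (\<lambda>x. (cmod ((f + g) x))\<^sup>2)"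
  proof (rule Bochner_Integration.integrable_bound)
    show "integrable M (\<lambda>x. 2 * (cmod (f x))\<^sup>2 + 2 * (cmod (g x))\<^sup>2)"
      using assms by (auto simp: L2_def)
    show "(\<lambda>x. (cmod ((f + g) x))\<^sup>2) \<in> borel_measurable M" using m by measurable
    have "(cmod (a + b))\<^sup>2 \<le> 2 * (cmod a)\<^sup>2 + 2 * (cmod b)\<^sup>2" for a b
    proof -
      have "(cmod (a + b))\<^sup>2 \<le> (cmod a + cmod b)\<^sup>2" by (simp add: norm_triangle_ineq power_mono)
      also have "\<dots> \<le> 2 * (cmod a)\<^sup>2 + 2 * (cmod b)\<^sup>2"
        using sum_squares_ge_zero[of "cmod a - cmod b" 0] by (simp add: power2_eq_square algebra_simps)
      finally show ?thesis .
    qed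
    then show "AE x in M. norm ((cmod ((f + g) x))\<^sup>2) \<le> norm (2 * (cmod (f x))\<^sup>2 + 2 * (cmod (g x))\<^sup>2)"
      by (intro AE_I2) (simp add: abs_of_nonneg)
  qed
qed

lemma subspace_L2: "cfun.subspace (L2 M)"
  by (auto simp: cfun.subspace_def)

lemma L2_diff [intro]: "f \<in> L2 M \<Longrightarrow> g \<in> L2 M \<Longrightarrow> f - g \<in> L2 M"
  by (rule cfun.subspace_diff[OF subspace_L2])

lemma L2_sum [intro]: "(\<And>i. i \<in> I \<Longrightarrow> f i \<in> L2 M) \<Longrightarrow> (\<Sum>i\<in>I. f i) \<in> L2 M"
  by (rule cfun.subspace_sum[OF subspace_L2])

lemma L2_cong_AE:
  assumes "f \<in> L2 M" "g \<in> borel_measurable M" "AE x in M. f x = g x" shows "g \<in> L2 M"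
proof (rule L2I[OF assms(2)])
  have "integrable M (\<lambda>x. (cmod (f x))\<^sup>2)" using assms by auto
  then show "integrable M (\<lambda>x. (cmod (g x))\<^sup>2)"
    by (rule integrable_cong_AE_imp) (use assms in auto)
qed

lemma L2_norm_cong_AE:
  assumes "f \<in> borel_measurable M" "f' \<in> borel_measurable M" "AE x in M. f x = f' x"
  shows "L2_norm M f = L2_norm M f'"
  unfolding L2_norm_def by (rule arg_cong[where f=sqrt], rule integral_cong_AE) (use assms in auto)

section \<open>Inner product and norm of \<open>L2\<close>\<close>

lemma L2_inner_add_left: "f \<in> L2 M \<Longrightarrow> g \<in> L2 M \<Longrightarrow> h \<in> L2 M \<Longrightarrow> L2_inner M (f + g) h = L2_inner M f h + L2_inner M g h"
  unfolding L2_inner_def by (subst Bochner_Integration.integral_add[symmetric]) (auto intro: L2_integrable_inner simp: algebra_simps)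

lemma L2_inner_diff_left: "f \<in> L2 M \<Longrightarrow> g \<in> L2 M \<Longrightarrow> h \<in> L2 M \<Longrightarrow> L2_inner M (f - g) h = L2_inner M f h - L2_inner M g h"
  unfolding L2_inner_def by (subst Bochner_Integration.integral_diff[symmetric]) (auto intro: L2_integrable_inner simp: algebra_simps)

lemma L2_inner_cscale_left: "L2_inner M (cscale c f) h = c * L2_inner M f h"
  unfolding L2_inner_def by (subst integral_mult_right_zero[symmetric]) (simp add: mult.assoc)

lemma L2_inner_commute: "L2_inner M g f = cnj (L2_inner M f g)"
proof -
  have "(\<integral>x. g x * cnj (f x) \<partial>M) = (\<integral>x. cnj (f x * cnj (g x)) \<partial>M)" by (simp add: mult.commute)
  also have "\<dots> = cnj (\<integral>x. f x * cnj (g x) \<partial>M)" by (rule Bochner_Integration.integral_cnj)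
  finally show ?thesis by (simp add: L2_inner_def)
qed

lemma L2_inner_add_right: "f \<in> L2 M \<Longrightarrow> g \<in> L2 M \<Longrightarrow> h \<in> L2 M \<Longrightarrow> L2_inner M h (f + g) = L2_inner M h f + L2_inner M h g"
  by (subst (1 2 3) L2_inner_commute) (simp add: L2_inner_add_left)

lemma L2_inner_diff_right: "f \<in> L2 M \<Longrightarrow> g \<in> L2 M \<Longrightarrow> h \<in> L2 M \<Longrightarrow> L2_inner M h (f - g) = L2_inner M h f - L2_inner M h g"
  by (subst (1 2 3) L2_inner_commute) (simp add: L2_inner_diff_left)

lemma L2_inner_cscale_right: "L2_inner M h (cscale c f) = cnj c * L2_inner M h f"
  by (subst (1 2) L2_inner_commute) (simp add: L2_inner_cscale_left)

lemma L2_inner_zero [simp]: "L2_inner M 0 h = 0" "L2_inner M h 0 = 0"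
  by (simp_all add: L2_inner_def)

lemma L2_inner_sum_left:
  assumes "\<And>i. i \<in> I \<Longrightarrow> f i \<in> L2 M" "h \<in> L2 M"
  shows "L2_inner M (\<Sum>i\<in>I. f i) h = (\<Sum>i\<in>I. L2_inner M (f i) h)"
  using assms by (induction I rule: infinite_finite_induct) (auto simp: L2_inner_add_left L2_sum)

lemma L2_norm_nonneg [simp]: "0 \<le> L2_norm M f"
  by (simp add: L2_norm_def)

lemma L2_norm_sq: "(L2_norm M f)\<^sup>2 = (\<integral>x. (cmod (f x))\<^sup>2 \<partial>M)"
  by (simp add: L2_norm_def)

lemma L2_inner_self: "L2_inner M f f = complex_of_real ((L2_norm M f)\<^sup>2)"
  unfolding L2_inner_def L2_norm_sq complex_norm_square[symmetric]
  by (simp add: integral_complex_of_real[symmetric] del: integral_complex_of_real)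

lemma L2_norm_zero [simp]: "L2_norm M 0 = 0"
  by (simp add: L2_norm_def)

lemma L2_norm_eq_0_iff: "f \<in> L2 M \<Longrightarrow> L2_norm M f = 0 \<longleftrightarrow> (AE x in M. f x = 0)"
  unfolding L2_norm_def by (simp add: integral_nonneg_eq_0_iff_AE L2_integrable_sq)

lemma L2_norm_cscale: "L2_norm M (cscale c f) = cmod c * L2_norm M f"
  by (simp add: L2_norm_def norm_mult power_mult_distrib real_sqrt_mult)

lemma L2_norm_add_sq:
  assumes "f \<in> L2 M" "g \<in> L2 M"
  shows "(L2_norm M (f + g))\<^sup>2 = (L2_norm M f)\<^sup>2 + 2 * Re (L2_inner M f g) + (L2_norm M g)\<^sup>2"
proof -
  have "L2_inner M (f + g) (f + g) = L2_inner M f f + (L2_inner M f g + cnj (L2_inner M f g)) + L2_inner M g g"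
    using assms by (simp add: L2_inner_add_left L2_inner_add_right L2_add L2_inner_commute[of M g f])
  from arg_cong[OF this, of Re] show ?thesis by (simp add: L2_inner_self del: of_real_power)
qed

lemma L2_norm_diff_sq:
  assumes "f \<in> L2 M" "g \<in> L2 M"
  shows "(L2_norm M (f - g))\<^sup>2 = (L2_norm M f)\<^sup>2 - 2 * Re (L2_inner M f g) + (L2_norm M g)\<^sup>2"
proof -
  have "L2_inner M (f - g) (f - g) = L2_inner M f f - (L2_inner M f g + cnj (L2_inner M f g)) + L2_inner M g g"
    using assms by (simp add: L2_inner_diff_left L2_inner_diff_right L2_diff L2_inner_commute[of M g f])
  from arg_cong[OF this, of Re] show ?thesis by (simp add: L2_inner_self del: of_real_power)
qed

text \<open>The squared norm of \<open>f - t g\<close> is a nonnegative quadratic polynomial in the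
  real variable \<open>t\<close>; its value at the minimum \<open>t = b / a\<close> is the
  inequality for the real part. The modulus reduces to a real part by rotating \<open>f\<close> with
  the unimodular factor \<open>u\<close>.\<close>

lemma L2_Cauchy_Schwarz:
  assumes "f \<in> L2 M" "g \<in> L2 M"
  shows "cmod (L2_inner M f g) \<le> L2_norm M f * L2_norm M g"
proof -
  have key: "\<bar>Re (L2_inner M f g)\<bar> \<le> L2_norm M f * L2_norm M g" if f: "f \<in> L2 M" for f
  proof -
    let ?b = "Re (L2_inner M f g)" and ?a = "(L2_norm M g)\<^sup>2" and ?c = "(L2_norm M f)\<^sup>2"
    have q: "0 \<le> ?c - 2 * t * ?b + t\<^sup>2 * ?a" for t
    proof -
      have "0 \<le> (L2_norm M (f - cscale (of_real t) g))\<^sup>2" by simp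
      also have "\<dots> = ?c - 2 * t * ?b + t\<^sup>2 * ?a"
        using f assms(2) by (subst L2_norm_diff_sq) (auto simp: L2_inner_cscale_right L2_norm_cscale power_mult_distrib)
      finally show ?thesis .
    qed
    have "?b\<^sup>2 \<le> ?c * ?a"
    proof (cases "?a = 0")
      case True
      have "?b = 0"
      proof (rule ccontr)
        assume "?b \<noteq> 0"
        \<comment> \<open>The polynomial is linear here, and at this \<open>t\<close> it equals
          \<open>?c - (?c + 1) = -1\<close>.\<close>
        with q[of "(?c + 1) / (2 * ?b)"] True show False by (simp add: field_simps)
      qed
      then show ?thesis using True by simp
    next
      case False
      then have a: "?a > 0" by (simp add: less_le)
      have "?b\<^sup>2 \<le> c * a" if "a > 0" "0 \<le> c - 2 * (?b / a) * ?b + (?b / a)\<^sup>2 * a" for a c :: real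
        using that by (simp add: field_simps power2_eq_square)
      from this[OF a q[of "?b / ?a"]] show ?thesis .
    qed
    then have "?b\<^sup>2 \<le> (L2_norm M f * L2_norm M g)\<^sup>2" by (simp add: power_mult_distrib)
    then show ?thesis by (simp add: abs_le_square_iff[symmetric])
  qed
  let ?z = "L2_inner M f g"
  obtain u where u: "cmod u = 1" "u * ?z = of_real (cmod ?z)"
  proof (cases "?z = 0")
    case False
    show ?thesis
      by (rule that[of "of_real (cmod ?z) / ?z"]) (use False in \<open>auto simp: norm_divide\<close>)
  qed (use that[of 1] in auto)
  have "cmod ?z = Re (L2_inner M (cscale u f) g)" by (simp add: L2_inner_cscale_left u)
  also have "\<dots> \<le> L2_norm M (cscale u f) * L2_norm M g"
    using key[OF L2_cscale[OF assms(1)], of u] by linarith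
  finally show ?thesis by (simp add: L2_norm_cscale u)
qed

lemma L2_norm_triangle:
  assumes "f \<in> L2 M" "g \<in> L2 M"
  shows "L2_norm M (f + g) \<le> L2_norm M f + L2_norm M g"
proof (rule power2_le_imp_le)
  have "Re (L2_inner M f g) \<le> L2_norm M f * L2_norm M g"
    using L2_Cauchy_Schwarz[OF assms] complex_Re_le_cmod order_trans by blast
  then show "(L2_norm M (f + g))\<^sup>2 \<le> (L2_norm M f + L2_norm M g)\<^sup>2"
    by (simp add: L2_norm_add_sq[OF assms] power2_sum)
qed simp

lemma L2_norm_minus_commute: "L2_norm M (f - g) = L2_norm M (g - f)"
  by (simp add: L2_norm_def norm_minus_commute)

lemma L2_norm_triangle_diff:
  assumes "f \<in> L2 M" "g \<in> L2 M" "h \<in> L2 M"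
  shows "L2_norm M (f - h) \<le> L2_norm M (f - g) + L2_norm M (g - h)"
  using L2_norm_triangle[of "f - g" M "g - h"] assms by auto

section \<open>Convergence in norm\<close>

lemma L2_converges_inner:
  assumes "\<And>m. s m \<in> L2 M" "f \<in> L2 M" "g \<in> L2 M" "L2_converges M s f"
  shows "(\<lambda>m. L2_inner M (s m) g) \<longlonglongrightarrow> L2_inner M f g"
proof -
  have "(\<lambda>m. L2_inner M (s m) g - L2_inner M f g) \<longlonglongrightarrow> 0"
  proof (rule Lim_null_comparison)
    show "\<forall>\<^sub>F m in sequentially. norm (L2_inner M (s m) g - L2_inner M f g) \<le> L2_norm M (s m - f) * L2_norm M g"
      using assms by (auto simp: L2_inner_diff_left[symmetric] intro!: always_eventually L2_Cauchy_Schwarz)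
    show "(\<lambda>m. L2_norm M (s m - f) * L2_norm M g) \<longlonglongrightarrow> 0"
      using assms(4) unfolding L2_converges_def by (intro tendsto_mult_left_zero)
  qed
  then show ?thesis by (simp add: LIM_zero_iff)
qed

lemma L2_converges_norm:
  assumes "\<And>m. s m \<in> L2 M" "f \<in> L2 M" "L2_converges M s f"
  shows "(\<lambda>m. L2_norm M (s m)) \<longlonglongrightarrow> L2_norm M f"
proof -
  have "(\<lambda>m. L2_norm M (s m) - L2_norm M f) \<longlonglongrightarrow> 0"
  proof (rule Lim_null_comparison)
    have "\<bar>L2_norm M (s m) - L2_norm M f\<bar> \<le> L2_norm M (s m - f)" for m
      using L2_norm_triangle[of "s m - f" M f] L2_norm_triangle[of "f - s m" M "s m"] assms(1)[of m] assms(2)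
        L2_diff[of "s m" M f] L2_diff[of f M "s m"]
      by (auto simp: L2_norm_minus_commute[of M f])
    then show "\<forall>\<^sub>F m in sequentially. norm (L2_norm M (s m) - L2_norm M f) \<le> L2_norm M (s m - f)"
      by simp
  qed (use assms(3) in \<open>simp add: L2_converges_def\<close>)
  then show ?thesis by (simp add: LIM_zero_iff)
qed

lemma L2_converges_unique:
  assumes "\<And>m. s m \<in> L2 M" "f \<in> L2 M" "g \<in> L2 M" "L2_converges M s f" "L2_converges M s g"
  shows "AE x in M. f x = g x"
proof -
  have "L2_norm M (f - g) \<le> 0"
  proof (rule LIMSEQ_le_const)
    show "(\<lambda>m. L2_norm M (s m - f) + L2_norm M (s m - g)) \<longlonglongrightarrow> 0"
      using assms(4,5) unfolding L2_converges_def by (intro tendsto_add_zero)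
    show "\<exists>N. \<forall>m\<ge>N. L2_norm M (f - g) \<le> L2_norm M (s m - f) + L2_norm M (s m - g)"
      using L2_norm_triangle_diff[of f M _ g] assms by (metis L2_norm_minus_commute)
  qed
  then have "L2_norm M (f - g) = 0" by (simp add: antisym)
  then show ?thesis using L2_norm_eq_0_iff[of "f - g" M] assms by auto
qed


section \<open>Completeness of \<open>L2\<close>\<close>

lemma L2_nn_integral:
  assumes "f \<in> L2 M" shows "(\<integral>\<^sup>+x. ennreal ((cmod (f x))\<^sup>2) \<partial>M) = ennreal ((L2_norm M f)\<^sup>2)"
  using assms by (simp add: nn_integral_eq_integral L2_integrable_sq L2_norm_sq)

lemma L2_nn_integralI:
  assumes "f \<in> borel_measurable M" "(\<integral>\<^sup>+x. ennreal ((cmod (f x))\<^sup>2) \<partial>M) \<le> ennreal (C\<^sup>2)" "0 \<le> C"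
  shows "f \<in> L2 M" "L2_norm M f \<le> C"
proof -
  show f: "f \<in> L2 M"
  proof (rule L2I[OF assms(1)])
    show "integrable M (\<lambda>x. (cmod (f x))\<^sup>2)"
      by (rule integrableI_bounded) (use assms in \<open>auto simp: le_less_trans\<close>)
  qed
  have "(L2_norm M f)\<^sup>2 \<le> C\<^sup>2"
    using assms(2) unfolding L2_nn_integral[OF f] by simp
  then show "L2_norm M f \<le> C"
    using assms(3) by (simp add: power2_le_iff_abs_le)
qed

text \<open>Fatou's lemma for the squared moduli. It places a pointwise limit in \<open>L2\<close>
  before any norm convergence is known; an eventual bound suffices since the limit inferior ignores
  initial terms.\<close>

lemma L2_Fatou:
  assumes t: "\<And>n. t n \<in> L2 M" and f: "f \<in> borel_measurable M"
    and lim: "AE x in M. (\<lambda>n. t n x) \<longlonglongrightarrow> f x"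
    and C: "eventually (\<lambda>n. L2_norm M (t n) \<le> C) sequentially" "0 \<le> C"
  shows "f \<in> L2 M" "L2_norm M f \<le> C"
proof -
  have [measurable]: "t n \<in> borel_measurable M" for n using t by auto
  have [measurable]: "f \<in> borel_measurable M" by fact
  have "(\<integral>\<^sup>+x. ennreal ((cmod (f x))\<^sup>2) \<partial>M) = (\<integral>\<^sup>+x. liminf (\<lambda>n. ennreal ((cmod (t n x))\<^sup>2)) \<partial>M)"
  proof (rule nn_integral_cong_AE)
    show "AE x in M. ennreal ((cmod (f x))\<^sup>2) = liminf (\<lambda>n. ennreal ((cmod (t n x))\<^sup>2))"
      using lim
    proof eventually_elim
      case (elim x)
      then have "(\<lambda>n. ennreal ((cmod (t n x))\<^sup>2)) \<longlonglongrightarrow> ennreal ((cmod (f x))\<^sup>2)"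
        by (intro tendsto_ennrealI tendsto_intros)
      then show ?case by (intro lim_imp_Liminf[symmetric]) simp_all
    qed
  qed
  also have "\<dots> \<le> liminf (\<lambda>n. \<integral>\<^sup>+x. ennreal ((cmod (t n x))\<^sup>2) \<partial>M)"
    by (rule nn_integral_liminf) measurable
  also have "\<dots> \<le> liminf (\<lambda>n. ennreal (C\<^sup>2))"
  proof (rule Liminf_mono)
    show "\<forall>\<^sub>F n in sequentially. (\<integral>\<^sup>+x. ennreal ((cmod (t n x))\<^sup>2) \<partial>M) \<le> ennreal (C\<^sup>2)"
      using C(1) by eventually_elim (simp add: L2_nn_integral[OF t] ennreal_leI power_mono)
  qed
  also have "\<dots> = ennreal (C\<^sup>2)" by (simp add: Liminf_const)
  finally have *: "(\<integral>\<^sup>+x. ennreal ((cmod (f x))\<^sup>2) \<partial>M) \<le> ennreal (C\<^sup>2)" .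
  show "f \<in> L2 M" "L2_norm M f \<le> C" using L2_nn_integralI[OF f * C(2)] by auto
qed

lemma L2_norm_sum_le:
  assumes "\<And>i. i \<in> I \<Longrightarrow> f i \<in> L2 M"
  shows "L2_norm M (\<Sum>i\<in>I. f i) \<le> (\<Sum>i\<in>I. L2_norm M (f i))"
  using assms
proof (induction I rule: infinite_finite_induct)
  case (insert i I)
  then have "L2_norm M (sum f (insert i I)) = L2_norm M (f i + sum f I)"
    by (subst sum.insert) auto
  also have "\<dots> \<le> L2_norm M (f i) + L2_norm M (sum f I)"
    using insert.prems by (intro L2_norm_triangle L2_sum) auto
  also have "\<dots> \<le> (\<Sum>i\<in>insert i I. L2_norm M (f i))"
    using insert by simp
  finally show ?case .
qed auto

text \<open>Minkowski's inequality for the moduli \<open>u k\<close> bounds the norms of the partial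
  sums \<open>D n\<close> by \<open>C\<close>; by monotone convergence the supremum of their squares
  has finite integral, hence is finite almost everywhere.\<close>

lemma L2_abs_summable_AE:
  assumes d: "\<And>k. d k \<in> L2 M" and C: "\<And>n. (\<Sum>k<n. L2_norm M (d k)) \<le> C"
  shows "AE x in M. summable (\<lambda>k. cmod (d k x))"
proof -
  have [measurable]: "d k \<in> borel_measurable M" for k using d by auto
  define u where "u k = (\<lambda>x. complex_of_real (cmod (d k x)))" for k
  have u: "u k \<in> L2 M" for k using d[of k] by (auto simp: u_def L2_def)
  have nu: "L2_norm M (u k) = L2_norm M (d k)" for k by (simp add: L2_norm_def u_def)
  define D where "D n x = (\<Sum>k<n. cmod (d k x))" for n x
  have D: "cmod ((\<Sum>k<n. u k) x) = D n x" for n x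
    by (simp add: u_def D_def of_real_sum[symmetric] sum_nonneg sum_fun_eval del: of_real_sum)
  have [measurable]: "D n \<in> borel_measurable M" for n unfolding D_def by measurable
  have C0: "0 \<le> C" using C[of 0] by simp
  have "(\<integral>\<^sup>+x. (SUP n. ennreal ((D n x)\<^sup>2)) \<partial>M) = (SUP n. \<integral>\<^sup>+x. ennreal ((D n x)\<^sup>2) \<partial>M)"
  proof (rule nn_integral_monotone_convergence_SUP)
    show "incseq (\<lambda>n x. ennreal ((D n x)\<^sup>2))"
      unfolding incseq_def le_fun_def D_def
      by (auto intro!: ennreal_leI power_mono sum_mono2 sum_nonneg)
  qed measurable
  also have "\<dots> \<le> ennreal (C\<^sup>2)"
  proof (rule SUP_least)
    fix n
    have "L2_norm M (\<Sum>k<n. u k) \<le> C"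
      using L2_norm_sum_le[of "{..<n}" u M] u C[of n] by (simp add: nu)
    then have "(L2_norm M (\<Sum>k<n. u k))\<^sup>2 \<le> C\<^sup>2" by (intro power_mono) auto
    then show "(\<integral>\<^sup>+x. ennreal ((D n x)\<^sup>2) \<partial>M) \<le> ennreal (C\<^sup>2)"
      using L2_nn_integral[of "\<Sum>k<n. u k" M] u by (auto simp add: D L2_sum ennreal_leI)
  qed
  finally have "(\<integral>\<^sup>+x. (SUP n. ennreal ((D n x)\<^sup>2)) \<partial>M) \<noteq> \<infinity>"
    using neq_top_trans by force
  then have "AE x in M. (SUP n. ennreal ((D n x)\<^sup>2)) \<noteq> \<infinity>"
    by (intro nn_integral_noteq_infinite) measurable
  then show ?thesis
  proof eventually_elim
    case (elim x)
    then obtain B where B: "(SUP n. ennreal ((D n x)\<^sup>2)) = ennreal B" "0 \<le> B"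
      by (cases "SUP n. ennreal ((D n x)\<^sup>2)") auto
    have "(D n x)\<^sup>2 \<le> B" for n
      using SUP_upper[of n UNIV "\<lambda>n. ennreal ((D n x)\<^sup>2)"] B by simp
    then have "D n x \<le> sqrt B" for n by (simp add: real_le_rsqrt)
    then show ?case
      by (intro summableI_nonneg_bounded[of _ "sqrt B"]) (auto simp: D_def)
  qed
qed

text \<open>Riesz-Fischer. A subsequence with consecutive distances at most \<open>(1/2)^k\<close>
  converges almost everywhere by absolute summability, and Fatou's lemma turns the tail estimates
  into norm convergence to the pointwise limit.\<close>

lemma L2_complete:
  assumes s: "\<And>m. s m \<in> L2 M"
    and cau: "\<And>e. 0 < e \<Longrightarrow> \<exists>N. \<forall>m\<ge>N. \<forall>n\<ge>N. L2_norm M (s m - s n) < e"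
  shows "\<exists>f\<in>L2 M. L2_converges M s f"
proof -
  have "\<forall>k. \<exists>N. \<forall>m\<ge>N. \<forall>n\<ge>N. L2_norm M (s m - s n) < (1/2)^k" using cau by simp
  then obtain N where N: "\<And>k m n. m \<ge> N k \<Longrightarrow> n \<ge> N k \<Longrightarrow> L2_norm M (s m - s n) < (1/2)^k" by metis
  \<comment> \<open>The thresholds \<open>N k\<close> may fail to increase with \<open>k\<close>;
    their partial sums do increase, and they dominate the thresholds.\<close>
  define r where "r k = (\<Sum>i\<le>k. N i)" for k
  have rN: "N k \<le> r k" for k unfolding r_def by (rule member_le_sum) auto
  have r_mono: "r k \<le> r l" if "k \<le> l" for k l unfolding r_def using that by (intro sum_mono2) auto
  define t where "t k = s (r k)" for k
  have t: "t k \<in> L2 M" for k using s by (simp add: t_def)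
  have [measurable]: "t k \<in> borel_measurable M" for k using t by auto
  have tt: "L2_norm M (t k - t l) \<le> (1/2)^k" if "k \<le> l" for k l
    using N[of k "r k" "r l"] rN[of k] r_mono[OF that] by (simp add: t_def less_imp_le)
  define d where "d k = t (Suc k) - t k" for k
  have "AE x in M. summable (\<lambda>k. cmod (d k x))"
  proof (rule L2_abs_summable_AE)
    show "d k \<in> L2 M" for k using t by (auto simp: d_def)
    show "(\<Sum>k<n. L2_norm M (d k)) \<le> 2" for n
    proof -
      have "(\<Sum>k<n. L2_norm M (d k)) \<le> (\<Sum>k<n. (1/2)^k)"
        by (intro sum_mono) (use tt in \<open>auto simp: d_def L2_norm_minus_commute[of M "t (Suc _)"]\<close>)
      also have "\<dots> \<le> (\<Sum>k. (1/2)^k)" by (intro sum_le_suminf) auto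
      also have "\<dots> = (2::real)" by (simp add: suminf_geometric)
      finally show ?thesis .
    qed
  qed
  then have conv: "AE x in M. convergent (\<lambda>k. t k x)"
  proof eventually_elim
    case (elim x)
    have "summable (\<lambda>k. t (Suc k) x - t k x)"
      using summable_norm_cancel[OF elim] by (simp add: d_def)
    then have "convergent (\<lambda>n. \<Sum>k<n. t (Suc k) x - t k x)" by (simp add: summable_iff_convergent)
    moreover have "(\<Sum>k<n. t (Suc k) x - t k x) = t n x - t 0 x" for n
      by (rule sum_lessThan_telescope)
    ultimately have "convergent (\<lambda>n. t n x - t 0 x)" by simp
    then show ?case by (simp add: convergent_diff_const_right_iff)
  qed
  define f where "f x = lim (\<lambda>k. t k x)" for x
  have f[measurable]: "f \<in> borel_measurable M" unfolding f_def by (rule borel_measurable_lim_metric) measurable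
  have lim: "AE x in M. (\<lambda>k. t k x) \<longlonglongrightarrow> f x"
    using conv by eventually_elim (simp add: f_def convergent_LIMSEQ_iff)
  have tf: "t k - f \<in> L2 M" "L2_norm M (t k - f) \<le> (1/2)^k" for k
  proof -
    have m: "t k - f \<in> borel_measurable M" by (simp add: fun_diff_def)
    have a: "AE x in M. (\<lambda>n. (t k - t n) x) \<longlonglongrightarrow> (t k - f) x"
      using lim by eventually_elim (auto intro!: tendsto_intros)
    have e: "\<forall>\<^sub>F n in sequentially. L2_norm M (t k - t n) \<le> (1/2)^k"
      using eventually_ge_at_top[of k] by eventually_elim (rule tt)
    show "t k - f \<in> L2 M" "L2_norm M (t k - f) \<le> (1/2)^k"
      using L2_Fatou[of "\<lambda>n. t k - t n" M "t k - f", OF _ m a e] t by (simp_all add: L2_diff)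
  qed
  have fL: "f \<in> L2 M" using L2_diff[OF t[of 0] tf(1)[of 0]] by simp
  have "L2_converges M s f"
    unfolding L2_converges_def
  proof (rule LIMSEQ_I)
    fix e :: real assume "0 < e"
    obtain k where k: "(1/2)^k < e/2" using real_arch_pow_inv[of "e/2" "1/2"] \<open>0 < e\<close> by auto
    have "L2_norm M (s m - f) < e" if "m \<ge> N k" for m
      using L2_norm_triangle_diff[OF s t fL, of m k] N[of k m "r k"] rN[of k] that tf(2)[of k] k
      by (simp add: t_def)
    then show "\<exists>no. \<forall>n\<ge>no. norm (L2_norm M (s n - f) - 0) < e" by auto
  qed
  with fL show ?thesis by blast
qed

section \<open>Closed subspaces and orthogonal projection\<close>

lemma closed_subspaceD:
  assumes "closed_subspace M V"
  shows "V \<subseteq> L2 M" "cfun.subspace V" "\<And>s f. (\<And>m. s m \<in> V) \<Longrightarrow> f \<in> L2 M \<Longrightarrow> L2_converges M s f \<Longrightarrow> f \<in> V"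
  using assms unfolding closed_subspace_def by blast+

lemma closed_subspace_AE:
  assumes "closed_subspace M V" "f \<in> V" "g \<in> borel_measurable M" "AE x in M. f x = g x"
  shows "g \<in> V"
proof -
  have f: "f \<in> L2 M" using assms closed_subspaceD by blast
  have g: "g \<in> L2 M" using L2_cong_AE[OF f assms(3,4)] .
  have "L2_norm M (f - g) = 0" using f g assms(4) by (subst L2_norm_eq_0_iff) auto
  then show ?thesis using closed_subspaceD(3)[OF assms(1), of "\<lambda>_. f" g] assms(2) g by (simp add: L2_converges_def)
qed

lemma L2_parallelogram:
  assumes "f \<in> L2 M" "g \<in> L2 M"
  shows "(L2_norm M (f + g))\<^sup>2 + (L2_norm M (f - g))\<^sup>2 = 2 * (L2_norm M f)\<^sup>2 + 2 * (L2_norm M g)\<^sup>2"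
  by (simp add: L2_norm_add_sq[OF assms] L2_norm_diff_sq[OF assms])

text \<open>The parallelogram law makes a minimizing sequence Cauchy: the midpoint of two of its
  members lies in \<open>V\<close>, so its distance from \<open>f\<close> is at least the infimum
  \<open>d\<close>, which leaves little room for their difference.\<close>

lemma closed_subspace_minimizer:
  assumes V: "closed_subspace M V" and f: "f \<in> L2 M"
  shows "\<exists>p\<in>V. \<forall>q\<in>V. L2_norm M (f - p) \<le> L2_norm M (f - q)"
proof -
  note VD = closed_subspaceD[OF V]
  have V0: "0 \<in> V" using VD(2) by (rule cfun.subspace_0)
  let ?S = "(\<lambda>v. L2_norm M (f - v)) ` V"
  define d where "d = Inf ?S"
  have bdd: "bdd_below ?S" by (rule bdd_belowI[of _ 0]) auto
  have dle: "d \<le> L2_norm M (f - v)" if "v \<in> V" for v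
    unfolding d_def using that bdd by (intro cInf_lower) auto
  have d0: "0 \<le> d" unfolding d_def using V0 by (intro cInf_greatest) auto
  have "\<exists>v\<in>V. L2_norm M (f - v) < d + 1 / (real m + 1)" for m
  proof -
    have "Inf ?S < d + 1 / (real m + 1)" by (simp add: d_def)
    then show ?thesis using cInf_lessD[of ?S] V0 by blast
  qed
  then obtain s where sV: "\<And>m. s m \<in> V" and s: "\<And>m. L2_norm M (f - s m) < d + 1 / (real m + 1)" by metis
  have sL: "s m \<in> L2 M" for m using sV VD(1) by auto
  have bound: "(L2_norm M (s m - s n))\<^sup>2 \<le> 2 * ((d + 1 / (real m + 1))\<^sup>2 - d\<^sup>2) + 2 * ((d + 1 / (real n + 1))\<^sup>2 - d\<^sup>2)" for m n
  proof -
    let ?h = "cscale (1/2) (s m + s n)"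
    have h: "?h \<in> V" using sV VD(2) by (simp add: cfun.subspace_add cfun.subspace_scale)
    have "(f - s m) + (f - s n) = cscale 2 (f - ?h)" by (auto simp: fun_eq_iff algebra_simps)
    then have "(L2_norm M ((f - s m) + (f - s n)))\<^sup>2 = 4 * (L2_norm M (f - ?h))\<^sup>2"
      by (simp add: L2_norm_cscale power_mult_distrib)
    moreover have "(f - s m) - (f - s n) = s n - s m" by (auto simp: fun_eq_iff)
    moreover have "d\<^sup>2 \<le> (L2_norm M (f - ?h))\<^sup>2" using dle[OF h] d0 by (intro power_mono)
    moreover have "(L2_norm M (f - s m))\<^sup>2 \<le> (d + 1 / (real m + 1))\<^sup>2" for m
      using s[of m] by (intro power_mono) auto
    ultimately show ?thesis
      using L2_parallelogram[of "f - s m" M "f - s n"] f sL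
      by (simp add: L2_norm_minus_commute[of M "s n"] L2_diff) (smt (verit))
  qed
  have lim: "(\<lambda>m. 2 * ((d + 1 / (real m + 1))\<^sup>2 - d\<^sup>2)) \<longlonglongrightarrow> 0"
  proof -
    have "(\<lambda>m. 1 / (real m + 1)) \<longlonglongrightarrow> 0" using LIMSEQ_inverse_real_of_nat by (simp add: inverse_eq_divide add.commute)
    then have "(\<lambda>m. 2 * ((d + 1 / (real m + 1))\<^sup>2 - d\<^sup>2)) \<longlonglongrightarrow> 2 * ((d + 0)\<^sup>2 - d\<^sup>2)" by (intro tendsto_intros)
    then show ?thesis by simp
  qed
  have "\<exists>p\<in>L2 M. L2_converges M s p"
  proof (rule L2_complete[OF sL])
    fix e :: real assume e: "0 < e"
    then have "0 < e\<^sup>2 / 2" by simp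
    from order_tendstoD(2)[OF lim this] obtain N where
      N: "\<And>m. m \<ge> N \<Longrightarrow> 2 * ((d + 1 / (real m + 1))\<^sup>2 - d\<^sup>2) < e\<^sup>2 / 2" by (auto simp: eventually_sequentially)
    have "L2_norm M (s m - s n) < e" if "m \<ge> N" "n \<ge> N" for m n
    proof (rule power2_less_imp_less)
      show "(L2_norm M (s m - s n))\<^sup>2 < e\<^sup>2" using bound[of m n] N[OF that(1)] N[OF that(2)] by linarith
    qed (use e in simp)
    then show "\<exists>N. \<forall>m\<ge>N. \<forall>n\<ge>N. L2_norm M (s m - s n) < e" by blast
  qed
  then obtain p where p: "p \<in> L2 M" "L2_converges M s p" by blast
  have pV: "p \<in> V" using VD(3)[OF sV p] .
  have "L2_norm M (f - p) \<le> d"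
  proof (rule LIMSEQ_le_const)
    have "(\<lambda>m. (d + 1 / (real m + 1)) + L2_norm M (s m - p)) \<longlonglongrightarrow> (d + 0) + 0"
      using p(2) LIMSEQ_inverse_real_of_nat unfolding L2_converges_def
      by (intro tendsto_intros) (auto simp: inverse_eq_divide add.commute)
    then show "(\<lambda>m. (d + 1 / (real m + 1)) + L2_norm M (s m - p)) \<longlonglongrightarrow> d" by simp
    have "L2_norm M (f - p) \<le> (d + 1 / (real m + 1)) + L2_norm M (s m - p)" for m
      using L2_norm_triangle_diff[OF f sL p(1), of m] s[of m] by linarith
    then show "\<exists>N. \<forall>m\<ge>N. L2_norm M (f - p) \<le> (d + 1 / (real m + 1)) + L2_norm M (s m - p)" by blast
  qed
  then show ?thesis using dle pV by force
qed

text \<open>A nearest point \<open>p\<close> leaves a residual orthogonal to \<open>V\<close>: if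
  the residual had a nonzero inner product \<open>z\<close> with \<open>q\<close>, moving
  \<open>p\<close> slightly in the direction \<open>z q\<close> would bring it closer to
  \<open>f\<close>.\<close>

theorem closed_subspace_projection:
  assumes V: "closed_subspace M V" and f: "f \<in> L2 M"
  shows "\<exists>p\<in>V. \<forall>q\<in>V. L2_inner M (f - p) q = 0"
proof -
  note VD = closed_subspaceD[OF V]
  obtain p where p: "p \<in> V" "\<And>q. q \<in> V \<Longrightarrow> L2_norm M (f - p) \<le> L2_norm M (f - q)"
    using closed_subspace_minimizer[OF assms] by blast
  have "L2_inner M (f - p) q = 0" if q: "q \<in> V" for q
  proof (rule ccontr)
    define z where "z = L2_inner M (f - p) q"
    define c where "c = (L2_norm M q)\<^sup>2"
    \<comment> \<open>For \<open>c > 0\<close> the distance is smallest at \<open>t = 1 / c\<close>;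
      the denominator \<open>1 + c\<close> also covers \<open>c = 0\<close> and still gives
      \<open>t * c \<le> 1 < 2\<close>.\<close>
    define t where "t = 1 / (1 + c)"
    assume "L2_inner M (f - p) q \<noteq> 0"
    then have z: "0 < (cmod z)\<^sup>2" by (simp add: z_def)
    have c: "0 \<le> c" by (simp add: c_def)
    have L: "f - p \<in> L2 M" "q \<in> L2 M" using f p q VD(1) by auto
    let ?w = "p + cscale (of_real t * z) q"
    have w: "?w \<in> V" using p q VD(2) by (simp add: cfun.subspace_add cfun.subspace_scale)
    have "f - ?w = (f - p) - cscale (of_real t * z) q" by (auto simp: fun_eq_iff)
    then have "(L2_norm M (f - ?w))\<^sup>2 = (L2_norm M (f - p))\<^sup>2 - 2 * t * (cmod z)\<^sup>2 + t\<^sup>2 * (cmod z)\<^sup>2 * c"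
      using L by (simp only: L2_norm_diff_sq L2_cscale) (simp add: L2_inner_cscale_right z_def[symmetric] L2_norm_cscale
        norm_mult power_mult_distrib c_def cmod_power2 power2_eq_square[of "Re z"] power2_eq_square[of "Im z"] algebra_simps)
    moreover have "(L2_norm M (f - p))\<^sup>2 \<le> (L2_norm M (f - ?w))\<^sup>2"
      using p(2)[OF w] by (intro power_mono) auto
    ultimately have "2 * t * (cmod z)\<^sup>2 \<le> t\<^sup>2 * (cmod z)\<^sup>2 * c" by linarith
    then have "2 * t \<le> t * (t * c)" 
    proof -
      have "(2 * t) * (cmod z)\<^sup>2 \<le> (t * (t * c)) * (cmod z)\<^sup>2"
        using \<open>2 * t * (cmod z)\<^sup>2 \<le> _\<close> by (simp only: power2_eq_square[of t] mult_ac)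
      then show ?thesis using z by (simp only: mult_le_cancel_right_pos)
    qed
    moreover have "t > 0" "t * c \<le> 1" using c by (auto simp: t_def divide_simps)
    ultimately show False by (simp add: mult.commute)
  qed
  then show ?thesis using p(1) by blast
qed

section \<open>Closed spans and total families\<close>

lemma span_subset_L2: "S \<subseteq> L2 M \<Longrightarrow> cfun.span S \<subseteq> L2 M"
  by (rule cfun.span_minimal[OF _ subspace_L2])

lemma closed_span_superset: assumes "S \<subseteq> L2 M" shows "cfun.span S \<subseteq> closed_span M S"
proof
  fix f assume f: "f \<in> cfun.span S"
  then show "f \<in> closed_span M S" using span_subset_L2[OF assms]
    by (auto simp: closed_span_def L2_converges_def intro!: exI[of _ "\<lambda>_. f"])
qed

lemma closed_span_base: "S \<subseteq> L2 M \<Longrightarrow> S \<subseteq> closed_span M S"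
  using closed_span_superset cfun.span_superset by blast

lemma closed_span_approx:
  assumes "f \<in> closed_span M S" "0 < e"
  shows "\<exists>v\<in>cfun.span S. L2_norm M (v - f) < e"
proof -
  obtain s where s: "\<And>m. s m \<in> cfun.span S" "(\<lambda>m. L2_norm M (s m - f)) \<longlonglongrightarrow> 0"
    using assms(1) by (auto simp: closed_span_def L2_converges_def)
  from order_tendstoD(2)[OF s(2) assms(2)] show ?thesis using s(1) by (auto simp: eventually_sequentially)
qed

lemma closed_spanI:
  assumes "f \<in> L2 M" "\<And>e. 0 < e \<Longrightarrow> \<exists>v\<in>cfun.span S. L2_norm M (v - f) < e"
  shows "f \<in> closed_span M S"
proof -
  have "\<forall>m. \<exists>v\<in>cfun.span S. L2_norm M (v - f) < inverse (real (Suc m))" using assms(2) by simp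
  then obtain s where s: "\<And>m. s m \<in> cfun.span S" "\<And>m. L2_norm M (s m - f) < inverse (real (Suc m))" by metis
  have "(\<lambda>m. L2_norm M (s m - f)) \<longlonglongrightarrow> 0"
    by (rule Lim_null_comparison[OF _ LIMSEQ_inverse_real_of_nat]) (use s(2) in \<open>auto simp: less_imp_le intro!: always_eventually\<close>)
  then show ?thesis using s(1) assms(1) by (auto simp: closed_span_def L2_converges_def)
qed

lemma closed_subspace_closed_span:
  assumes S: "S \<subseteq> L2 M" shows "closed_subspace M (closed_span M S)"
  unfolding closed_subspace_def
proof (intro conjI allI impI)
  show sub: "closed_span M S \<subseteq> L2 M" by (auto simp: closed_span_def)
  have SL: "v \<in> L2 M" if "v \<in> cfun.span S" for v using that span_subset_L2[OF S] by auto
  show "cfun.subspace (closed_span M S)"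
    unfolding cfun.subspace_def
  proof (intro conjI ballI allI)
    show "0 \<in> closed_span M S" using closed_span_superset[OF S] cfun.span_zero by blast
  next
    fix f g assume f: "f \<in> closed_span M S" and g: "g \<in> closed_span M S"
    show "f + g \<in> closed_span M S"
    proof (rule closed_spanI)
      show "f + g \<in> L2 M" using f g sub by auto
      fix e :: real assume "0 < e"
      then obtain v w where v: "v \<in> cfun.span S" "L2_norm M (v - f) < e/2" and w: "w \<in> cfun.span S" "L2_norm M (w - g) < e/2"
        using closed_span_approx[OF f, of "e/2"] closed_span_approx[OF g, of "e/2"] by auto
      have "L2_norm M ((v + w) - (f + g)) \<le> L2_norm M (v - f) + L2_norm M (w - g)"
        using L2_norm_triangle[of "v - f" M "w - g"] SL v w f g sub by (auto simp: algebra_simps subset_iff L2_diff)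
      then show "\<exists>v\<in>cfun.span S. L2_norm M (v - (f + g)) < e"
        using v w by (intro bexI[of _ "v + w"]) (auto intro: cfun.span_add)
    qed
  next
    fix c f assume f: "f \<in> closed_span M S"
    show "cscale c f \<in> closed_span M S"
    proof (rule closed_spanI)
      show "cscale c f \<in> L2 M" using f sub by auto
      fix e :: real assume "0 < e"
      then have e: "0 < e / (cmod c + 1)" by (smt (verit) divide_pos_pos norm_ge_zero)
      then obtain v where v: "v \<in> cfun.span S" "L2_norm M (v - f) < e / (cmod c + 1)"
        using closed_span_approx[OF f e] by auto
      have "cscale c v - cscale c f = cscale c (v - f)" by (auto simp: fun_eq_iff algebra_simps)
      then have "L2_norm M (cscale c v - cscale c f) = cmod c * L2_norm M (v - f)" by (simp add: L2_norm_cscale)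
      also have "\<dots> \<le> cmod c * (e / (cmod c + 1))" using v(2) by (intro mult_left_mono) auto
      also have "\<dots> < e" using \<open>0 < e\<close> by (simp add: divide_simps add_nonneg_pos)
      finally show "\<exists>v\<in>cfun.span S. L2_norm M (v - cscale c f) < e"
        using v by (intro bexI[of _ "cscale c v"]) (auto intro: cfun.span_scale)
    qed
  qed
next
  fix s f assume "(\<forall>m. s m \<in> closed_span M S) \<and> f \<in> L2 M \<and> L2_converges M s f"
  then have s: "\<And>m. s m \<in> closed_span M S" and f: "f \<in> L2 M" and lim: "(\<lambda>m. L2_norm M (s m - f)) \<longlonglongrightarrow> 0"
    by (auto simp: L2_converges_def)
  show "f \<in> closed_span M S"
  proof (rule closed_spanI[OF f])
    fix e :: real assume "0 < e"
    then obtain m where m: "L2_norm M (s m - f) < e/2"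
      using order_tendstoD(2)[OF lim, of "e/2"] by (auto simp: eventually_sequentially)
    obtain v where v: "v \<in> cfun.span S" "L2_norm M (v - s m) < e/2"
      using closed_span_approx[OF s, of "e/2" m] \<open>0 < e\<close> by auto
    have sm: "s m \<in> L2 M" "v \<in> L2 M" using s[of m] v(1) span_subset_L2[OF S] by (auto simp: closed_span_def)
    show "\<exists>v\<in>cfun.span S. L2_norm M (v - f) < e"
      using L2_norm_triangle_diff[OF sm(2,1) f] v m by (intro bexI[of _ v]) auto
  qed
qed

lemma closed_span_minimal:
  assumes "closed_subspace M V" "S \<subseteq> V" shows "closed_span M S \<subseteq> V"
proof -
  have "cfun.span S \<subseteq> V" using assms closed_subspaceD(2) by (intro cfun.span_minimal)
  show ?thesis
  proof
    fix f assume "f \<in> closed_span M S"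
    then obtain s where "f \<in> L2 M" "\<forall>m. s m \<in> cfun.span S" "L2_converges M s f"
      by (auto simp: closed_span_def)
    with \<open>cfun.span S \<subseteq> V\<close> show "f \<in> V"
      by (rule_tac closed_subspaceD(3)[OF assms(1), of s]) auto
  qed
qed

lemma closed_subspace_orthogonal:
  assumes T: "T \<subseteq> L2 M" shows "closed_subspace M {f \<in> L2 M. \<forall>g\<in>T. L2_inner M f g = 0}"
  unfolding closed_subspace_def
proof (intro conjI allI impI)
  show "cfun.subspace {f \<in> L2 M. \<forall>g\<in>T. L2_inner M f g = 0}"
    unfolding cfun.subspace_def using subsetD[OF T] by (simp add: L2_add L2_cscale L2_inner_add_left L2_inner_cscale_left)
next
  fix s f assume "(\<forall>m. s m \<in> {f \<in> L2 M. \<forall>g\<in>T. L2_inner M f g = 0}) \<and> f \<in> L2 M \<and> L2_converges M s f"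
  then have s: "\<And>m. s m \<in> L2 M" "\<And>m g. g \<in> T \<Longrightarrow> L2_inner M (s m) g = 0" and f: "f \<in> L2 M" "L2_converges M s f" by auto
  have "L2_inner M f g = 0" if "g \<in> T" for g
    using L2_converges_inner[OF s(1) f(1) subsetD[OF T that] f(2)] s(2)[OF that] by (simp add: LIMSEQ_const_iff)
  with f show "f \<in> {f \<in> L2 M. \<forall>g\<in>T. L2_inner M f g = 0}" by auto
qed auto

lemma closed_span_orthogonal:
  assumes "S \<subseteq> L2 M" "g \<in> L2 M" "\<And>s. s \<in> S \<Longrightarrow> L2_inner M s g = 0" "f \<in> closed_span M S"
  shows "L2_inner M f g = 0"
  using closed_span_minimal[OF closed_subspace_orthogonal[of "{g}" M], of S] assms by auto

text \<open>From right to left, the residual of \<open>f\<close> after projection to the closed span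
  is orthogonal to \<open>S\<close>, hence null. Totality of a family is proved and used below in
  this form, which involves only inner products and null functions.\<close>

lemma closed_span_eq_iff:
  assumes V: "closed_subspace M V" and S: "S \<subseteq> V"
  shows "closed_span M S = V \<longleftrightarrow> (\<forall>f\<in>V. (\<forall>s\<in>S. L2_inner M f s = 0) \<longrightarrow> (AE x in M. f x = 0))"
proof
  have VL: "V \<subseteq> L2 M" using closed_subspaceD[OF V] by auto
  assume eq: "closed_span M S = V"
  show "\<forall>f\<in>V. (\<forall>s\<in>S. L2_inner M f s = 0) \<longrightarrow> (AE x in M. f x = 0)"
  proof (intro ballI impI)
    fix f assume f: "f \<in> V" "\<forall>s\<in>S. L2_inner M f s = 0"
    have fL: "f \<in> L2 M" using f VL by auto
    have "L2_inner M s f = 0" if "s \<in> S" for s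
    proof -
      have "L2_inner M f s = 0" using f(2) that by blast
      then show ?thesis by (subst L2_inner_commute) simp
    qed
    then have "L2_inner M f f = 0"
      using closed_span_orthogonal[of S M f f] subset_trans[OF S VL] fL f(1) eq by blast
    then have "L2_norm M f = 0" by (simp add: L2_inner_self)
    then show "AE x in M. f x = 0" using L2_norm_eq_0_iff[OF fL] by simp
  qed
next
  have VL: "V \<subseteq> L2 M" using closed_subspaceD[OF V] by auto
  assume *: "\<forall>f\<in>V. (\<forall>s\<in>S. L2_inner M f s = 0) \<longrightarrow> (AE x in M. f x = 0)"
  have c: "closed_subspace M (closed_span M S)" using S VL by (intro closed_subspace_closed_span) auto
  have sub: "closed_span M S \<subseteq> V" by (rule closed_span_minimal[OF V S])
  have "f \<in> closed_span M S" if f: "f \<in> V" for f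
  proof -
    obtain p where p: "p \<in> closed_span M S" "\<And>q. q \<in> closed_span M S \<Longrightarrow> L2_inner M (f - p) q = 0"
      using closed_subspace_projection[OF c] f VL by blast
    have "f - p \<in> V" using f p(1) sub closed_subspaceD(2)[OF V] by (blast intro: cfun.subspace_diff)
    moreover have "\<forall>s\<in>S. L2_inner M (f - p) s = 0" using p(2) closed_span_base[OF subset_trans[OF S VL]] by blast
    ultimately have "AE x in M. (f - p) x = 0" using * by blast
    then have "AE x in M. p x = f x" by auto
    then show ?thesis using closed_subspace_AE[OF c p(1)] f VL by blast
  qed
  with sub show "closed_span M S = V" by auto
qed

section \<open>Orthonormal families of square summable sequences\<close>

abbreviation ell2_inner :: "('k \<Rightarrow> complex) \<Rightarrow> ('k \<Rightarrow> complex) \<Rightarrow> complex" where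
  "ell2_inner \<equiv> L2_inner (count_space UNIV)"

abbreviation ell2_norm :: "('k \<Rightarrow> complex) \<Rightarrow> real" where
  "ell2_norm \<equiv> L2_norm (count_space UNIV)"

abbreviation ell2_span :: "('k \<Rightarrow> complex) set \<Rightarrow> ('k \<Rightarrow> complex) set" where
  "ell2_span \<equiv> closed_span (count_space UNIV)"

abbreviation ell2_closed :: "('k \<Rightarrow> complex) set \<Rightarrow> bool" where
  "ell2_closed \<equiv> closed_subspace (count_space UNIV)"

lemma ell2_norm_eq_0: "a \<in> ell2 \<Longrightarrow> ell2_norm a = 0 \<longleftrightarrow> a = 0"
  by (subst L2_norm_eq_0_iff) (auto simp: AE_count_space)

lemma ell2_inner_self_eq_0: "a \<in> ell2 \<Longrightarrow> ell2_inner a a = 0 \<longleftrightarrow> a = 0"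
  by (simp add: L2_inner_self ell2_norm_eq_0)

text \<open>For counting measure a vector of norm zero is zero, so the projection is unique as a
  function and the \<open>THE\<close> in \<open>ell2_proj\<close> denotes it.\<close>

lemma ell2_proj_eqI:
  assumes S: "ell2_closed S" and a: "a \<in> ell2"
    and p: "p \<in> S" "\<And>q. q \<in> S \<Longrightarrow> ell2_inner (a - p) q = 0"
  shows "ell2_proj S a = p"
  unfolding ell2_proj_def
proof (rule the_equality)
  show "p \<in> S \<and> (\<forall>q\<in>S. ell2_inner (a - p) q = 0)" using p by blast
next
  note SL = closed_subspaceD(1)[OF S]
  fix p' assume p': "p' \<in> S \<and> (\<forall>q\<in>S. ell2_inner (a - p') q = 0)"
  have d: "p' - p \<in> S" using p p' closed_subspaceD(2)[OF S] by (blast intro: cfun.subspace_diff)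
  have L: "a - p \<in> ell2" "a - p' \<in> ell2" "p' - p \<in> ell2" using a p(1) p' d SL by (blast intro: L2_diff)+
  have e: "p' - p = (a - p) - (a - p')" by simp
  have "ell2_inner (p' - p) (p' - p) = ell2_inner (a - p) (p' - p) - ell2_inner (a - p') (p' - p)"
    by (subst e) (rule L2_inner_diff_left[OF L])
  also have "\<dots> = 0" using p(2)[OF d] p' d by simp
  finally show "p' = p" using L(3) by (simp add: ell2_inner_self_eq_0)
qed

lemma ell2_proj:
  assumes S: "ell2_closed S" and a: "a \<in> ell2"
  shows "ell2_proj S a \<in> S" "\<And>q. q \<in> S \<Longrightarrow> ell2_inner (a - ell2_proj S a) q = 0"
proof -
  obtain p where p: "p \<in> S" "\<And>q. q \<in> S \<Longrightarrow> ell2_inner (a - p) q = 0"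
    using closed_subspace_projection[OF assms] by blast
  have "ell2_proj S a = p" using ell2_proj_eqI[OF S a p] .
  then show "ell2_proj S a \<in> S" "\<And>q. q \<in> S \<Longrightarrow> ell2_inner (a - ell2_proj S a) q = 0" using p by auto
qed

lemma ell2_proj_inner:
  assumes S: "ell2_closed S" and a: "a \<in> ell2" and q: "q \<in> S"
  shows "ell2_inner (ell2_proj S a) q = ell2_inner a q"
proof -
  have "ell2_proj S a \<in> ell2" "q \<in> ell2" using ell2_proj(1)[OF S a] q closed_subspaceD(1)[OF S] by blast+
  then show ?thesis using ell2_proj(2)[OF S a q] L2_inner_diff_left[OF a] by simp
qed

lemma ell2_proj_norm_le:
  assumes S: "ell2_closed S" and a: "a \<in> ell2"
  shows "ell2_norm (ell2_proj S a) \<le> ell2_norm a"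
proof -
  let ?p = "ell2_proj S a"
  have p: "?p \<in> S" "?p \<in> ell2" using ell2_proj(1)[OF S a] closed_subspaceD(1)[OF S] by blast+
  have "(ell2_norm ?p)\<^sup>2 = cmod (ell2_inner a ?p)"
    by (simp add: ell2_proj_inner[OF S a p(1), symmetric] L2_inner_self norm_power del: of_real_power)
  also have "\<dots> \<le> ell2_norm a * ell2_norm ?p" by (rule L2_Cauchy_Schwarz[OF a p(2)])
  finally have "ell2_norm ?p * ell2_norm ?p \<le> ell2_norm a * ell2_norm ?p" by (simp add: power2_eq_square)
  then show ?thesis
    by (cases "ell2_norm ?p = 0") (simp_all add: less_le mult_le_cancel_right)
qed

text \<open>Fibers may become linearly dependent at positions that vary with the point of the torus.
  Zero members mark these positions, which keeps \<open>nat\<close> as the index set of the family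
  at every point.\<close>

definition orthonormal_or_zero :: "(nat \<Rightarrow> 'k \<Rightarrow> complex) \<Rightarrow> bool" where
  "orthonormal_or_zero e \<longleftrightarrow> (\<forall>j. e j \<in> ell2) \<and> (\<forall>i j. ell2_inner (e i) (e j) = (if i = j \<and> e j \<noteq> 0 then 1 else 0))"

lemma orthonormal_or_zeroD:
  assumes "orthonormal_or_zero e" shows "e j \<in> ell2" "ell2_inner (e i) (e j) = (if i = j \<and> e j \<noteq> 0 then 1 else 0)"
  using assms by (auto simp: orthonormal_or_zero_def)

text \<open>Since \<open>1 / 0 = 0\<close>, the zero sequence is normalized to itself.\<close>

definition ell2_normalize :: "('k \<Rightarrow> complex) \<Rightarrow> 'k \<Rightarrow> complex" where
  "ell2_normalize r = cscale (of_real (1 / ell2_norm r)) r"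

fun gram_schmidt :: "(nat \<Rightarrow> 'k \<Rightarrow> complex) \<Rightarrow> nat \<Rightarrow> 'k \<Rightarrow> complex" where
  "gram_schmidt v j = ell2_normalize (v j - (\<Sum>i<j. cscale (ell2_inner (v j) (gram_schmidt v i)) (gram_schmidt v i)))"

declare gram_schmidt.simps [simp del]

lemma ell2_normalize: "r \<in> ell2 \<Longrightarrow> ell2_normalize r \<in> ell2"
  by (auto simp: ell2_normalize_def)

lemma ell2_normalize_self:
  assumes r: "r \<in> ell2"
  shows "ell2_inner (ell2_normalize r) (ell2_normalize r) = (if ell2_normalize r \<noteq> 0 then 1 else 0)"
    "r = cscale (of_real (ell2_norm r)) (ell2_normalize r)"
proof -
  show "ell2_inner (ell2_normalize r) (ell2_normalize r) = (if ell2_normalize r \<noteq> 0 then 1 else 0)"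
  proof (cases "ell2_norm r = 0")
    case True
    then have "ell2_normalize r = 0" using ell2_norm_eq_0[OF r] by (auto simp: ell2_normalize_def fun_eq_iff)
    then show ?thesis by simp
  next
    case False
    then have "ell2_norm (ell2_normalize r) = 1"
      unfolding ell2_normalize_def L2_norm_cscale by (simp add: norm_divide)
    then have "ell2_inner (ell2_normalize r) (ell2_normalize r) = 1" by (simp add: L2_inner_self)
    then show ?thesis by auto
  qed
  show "r = cscale (of_real (ell2_norm r)) (ell2_normalize r)"
    by (cases "ell2_norm r = 0") (use ell2_norm_eq_0[OF r] in \<open>auto simp: ell2_normalize_def fun_eq_iff\<close>)
qed

lemma gram_schmidt_orthonormal_or_zero:
  assumes v: "\<And>j. v j \<in> ell2" shows "orthonormal_or_zero (gram_schmidt v)"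
proof -
  let ?g = "gram_schmidt v"
  let ?r = "\<lambda>j. v j - (\<Sum>i<j. cscale (ell2_inner (v j) (?g i)) (?g i))"
  have gr: "?g j = ell2_normalize (?r j)" for j by (rule gram_schmidt.simps)
  have "?g j \<in> ell2" for j
  proof (induction j rule: less_induct)
    case (less j)
    then have "?r j \<in> ell2" using v by (intro L2_diff L2_sum L2_cscale) auto
    then show ?case unfolding gr[of j] by (rule ell2_normalize)
  qed note gL = this
  have rL: "?r j \<in> ell2" for j using v gL by (intro L2_diff L2_sum L2_cscale) auto
  have self: "ell2_inner (?g j) (?g j) = (if ?g j \<noteq> 0 then 1 else 0)" for j
    unfolding gr[of j] by (rule ell2_normalize_self(1)[OF rL])
  have "\<forall>i<j. ell2_inner (?g j) (?g i) = 0" for j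
  proof (induction j rule: less_induct)
    case (less j)
    show ?case
    proof (intro allI impI)
      fix i assume i: "i < j"
      have orth: "ell2_inner (?g l) (?g i) = 0" if "l < j" "l \<noteq> i" for l
      proof (cases "l < i")
        case True
        then have "ell2_inner (?g i) (?g l) = 0" using less i by blast
        then show ?thesis by (subst L2_inner_commute) simp
      next
        case False
        then show ?thesis using less that by (meson linorder_neqE_nat)
      qed
      have "ell2_inner (\<Sum>l<j. cscale (ell2_inner (v j) (?g l)) (?g l)) (?g i)
          = (\<Sum>l<j. ell2_inner (v j) (?g l) * ell2_inner (?g l) (?g i))"
        by (subst L2_inner_sum_left) (auto simp: gL L2_inner_cscale_left)
      also have "\<dots> = (\<Sum>l<j. if l = i then ell2_inner (v j) (?g i) * ell2_inner (?g i) (?g i) else 0)"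
        by (intro sum.cong) (auto simp: orth)
      \<comment> \<open>If \<open>?g i\<close> vanishes, the last factor is 0 instead of 1, but the
        right side is 0 as well.\<close>
      also have "\<dots> = ell2_inner (v j) (?g i)" using i self[of i] by auto
      finally have "ell2_inner (?r j) (?g i) = 0"
        using L2_inner_diff_left[OF v L2_sum gL, of "{..<j}" "\<lambda>i. cscale (ell2_inner (v j) (?g i)) (?g i)" j i] gL by (simp add: L2_cscale)
      then show "ell2_inner (?g j) (?g i) = 0"
        unfolding gr[of j] ell2_normalize_def by (simp add: L2_inner_cscale_left)
    qed
  qed note lt = this
  have "ell2_inner (?g i) (?g j) = 0" if "i \<noteq> j" for i j
  proof (cases "j < i")
    case False
    then have "ell2_inner (?g j) (?g i) = 0" using lt that by auto
    then show ?thesis by (subst L2_inner_commute) simp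
  qed (use lt in auto)
  then show ?thesis using gL self unfolding orthonormal_or_zero_def by auto
qed

lemma closed_span_eqI:
  assumes "A \<subseteq> L2 M" "B \<subseteq> L2 M" "A \<subseteq> cfun.span B" "B \<subseteq> cfun.span A"
  shows "closed_span M A = closed_span M B"
proof -
  have "cfun.span A = cfun.span B"
    using assms(3,4) by (metis cfun.span_minimal cfun.subspace_span subset_antisym)
  then show ?thesis by (simp add: closed_span_def)
qed

text \<open>Already the algebraic spans agree: \<open>v j\<close> is its residual plus a combination
  of earlier members, and the residual is a multiple of the \<open>j\<close>-th output also when it
  vanishes.\<close>

lemma closed_span_gram_schmidt:
  assumes v: "\<And>j. v j \<in> ell2"
  shows "ell2_span (range (gram_schmidt v)) = ell2_span (range v)"
proof (rule closed_span_eqI)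
  let ?g = "gram_schmidt v"
  let ?r = "\<lambda>j. v j - (\<Sum>i<j. cscale (ell2_inner (v j) (?g i)) (?g i))"
  have gL: "?g j \<in> ell2" for j using orthonormal_or_zeroD(1)[OF gram_schmidt_orthonormal_or_zero[OF v]] .
  then show "range ?g \<subseteq> ell2" by auto
  show "range v \<subseteq> ell2" using v by auto
  have "?g j \<in> cfun.span (range v)" for j
  proof (induction j rule: less_induct)
    case (less j)
    then have "?r j \<in> cfun.span (range v)"
      by (intro cfun.span_diff cfun.span_sum cfun.span_scale less.IH cfun.span_base) auto
    then show ?case unfolding gram_schmidt.simps[of v j] ell2_normalize_def by (rule cfun.span_scale)
  qed
  then show "range ?g \<subseteq> cfun.span (range v)" by auto
  have "v j \<in> cfun.span (range ?g)" for j
  proof -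
    have rL: "?r j \<in> ell2" using v gL by (intro L2_diff L2_sum L2_cscale) auto
    have "?r j = cscale (of_real (ell2_norm (?r j))) (?g j)"
      using ell2_normalize_self(2)[OF rL] by (simp only: gram_schmidt.simps[of v j, symmetric])
    moreover have "cscale (of_real (ell2_norm (?r j))) (?g j) \<in> cfun.span (range ?g)"
      by (intro cfun.span_scale cfun.span_base) auto
    ultimately have "?r j \<in> cfun.span (range ?g)" by simp
    moreover have "(\<Sum>i<j. cscale (ell2_inner (v j) (?g i)) (?g i)) \<in> cfun.span (range ?g)"
      by (intro cfun.span_sum cfun.span_scale cfun.span_base) auto
    ultimately have "?r j + (\<Sum>i<j. cscale (ell2_inner (v j) (?g i)) (?g i)) \<in> cfun.span (range ?g)"
      by (rule cfun.span_add)
    then show ?thesis by simp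
  qed
  then show "range v \<subseteq> cfun.span (range ?g)" by auto
qed

lemma span_range_initial:
  fixes e :: "nat \<Rightarrow> 'k \<Rightarrow> complex"
  assumes "q \<in> cfun.span (range e)" shows "\<exists>M. \<forall>m\<ge>M. q \<in> cfun.span (e ` {..<m})"
  using assms
proof (induction rule: cfun.span_induct)
  show "cfun.subspace {q. \<exists>M. \<forall>m\<ge>M. q \<in> cfun.span (e ` {..<m})}"
    unfolding cfun.subspace_def
  proof (intro conjI ballI allI)
    fix x y assume "x \<in> {q. \<exists>M. \<forall>m\<ge>M. q \<in> cfun.span (e ` {..<m})}" "y \<in> {q. \<exists>M. \<forall>m\<ge>M. q \<in> cfun.span (e ` {..<m})}"
    then obtain M N where "\<forall>m\<ge>M. x \<in> cfun.span (e ` {..<m})" "\<forall>m\<ge>N. y \<in> cfun.span (e ` {..<m})" by blast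
    then have "\<forall>m\<ge>max M N. x + y \<in> cfun.span (e ` {..<m})" by (simp add: cfun.span_add)
    then show "x + y \<in> {q. \<exists>M. \<forall>m\<ge>M. q \<in> cfun.span (e ` {..<m})}" by blast
  qed (auto intro: cfun.span_zero cfun.span_scale)
  fix x assume "x \<in> range e"
  then obtain j where "x = e j" by auto
  then have "\<forall>m\<ge>Suc j. x \<in> cfun.span (e ` {..<m})" by (auto intro!: cfun.span_base)
  then show "\<exists>M. \<forall>m\<ge>M. x \<in> cfun.span (e ` {..<m})" by blast
qed

text \<open>The partial sums are the best approximations to the projection from the spans of initial
  segments, and every element of the algebraic span lies in these from some index on. Being
  explicit, the partial sums make the projection measurable in a parameter.\<close>

lemma orthonormal_or_zero_proj_converges:
  assumes e: "orthonormal_or_zero e" and a: "a \<in> ell2"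
  shows "L2_converges (count_space UNIV) (\<lambda>m. \<Sum>j<m. cscale (ell2_inner a (e j)) (e j))
           (ell2_proj (ell2_span (range e)) a)"
proof -
  let ?S = "ell2_span (range e)"
  let ?p = "ell2_proj ?S a"
  define P where "P m = (\<Sum>j<m. cscale (ell2_inner a (e j)) (e j))" for m
  have eL: "e j \<in> ell2" for j using orthonormal_or_zeroD(1)[OF e] .
  have S: "ell2_closed ?S" using eL by (intro closed_subspace_closed_span) auto
  have eS: "e j \<in> ?S" for j using closed_span_base[of "range e" "count_space UNIV"] eL by auto
  have p: "?p \<in> ?S" using ell2_proj(1)[OF S a] .
  then have pL: "?p \<in> ell2" using closed_subspaceD(1)[OF S] by blast
  have PL: "P m \<in> ell2" for m unfolding P_def using eL by (intro L2_sum L2_cscale)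
  have orth: "ell2_inner (e i) (?p - P m) = 0" if "i < m" for i m
  proof -
    have "ell2_inner (P m) (e i) = (\<Sum>j<m. ell2_inner a (e j) * ell2_inner (e j) (e i))"
      unfolding P_def by (subst L2_inner_sum_left) (auto simp: eL L2_inner_cscale_left)
    also have "\<dots> = (\<Sum>j<m. if j = i then ell2_inner a (e i) * ell2_inner (e i) (e i) else 0)"
      by (intro sum.cong) (auto simp: orthonormal_or_zeroD(2)[OF e])
    also have "\<dots> = ell2_inner a (e i)" using that orthonormal_or_zeroD(2)[OF e, of i i] by auto
    finally have "ell2_inner (?p - P m) (e i) = 0"
      using ell2_proj_inner[OF S a eS, of i] by (simp add: L2_inner_diff_left pL PL eL)
    then show ?thesis by (subst L2_inner_commute) simp
  qed
  have best: "ell2_norm (P m - ?p) \<le> ell2_norm (q - ?p)" if q: "q \<in> cfun.span (e ` {..<m})" for q m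
  proof -
    have dL: "?p - P m \<in> ell2" using pL PL by auto
    have qL: "q \<in> ell2" using q span_subset_L2[of "e ` {..<m}"] eL by blast
    have Pm: "P m \<in> cfun.span (e ` {..<m})"
      unfolding P_def by (intro cfun.span_sum cfun.span_scale cfun.span_base) auto
    have "P m - q \<in> cfun.span (e ` {..<m})" using Pm q by (rule cfun.span_diff)
    then have "P m - q \<in> ell2_span (e ` {..<m})"
      using closed_span_superset[of "e ` {..<m}" "count_space UNIV"] eL by blast
    then have "ell2_inner (P m - q) (?p - P m) = 0"
      by (rule closed_span_orthogonal[OF _ dL, rotated 2]) (use eL orth in auto)
    then have "Re (ell2_inner (?p - P m) (P m - q)) = 0"
      by (subst L2_inner_commute) simp
    moreover have "?p - q = (?p - P m) + (P m - q)" by simp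
    ultimately have "(ell2_norm (?p - q))\<^sup>2 = (ell2_norm (?p - P m))\<^sup>2 + (ell2_norm (P m - q))\<^sup>2"
      using L2_norm_add_sq[OF dL L2_diff[OF PL qL], of m] by simp
    then have "(ell2_norm (?p - P m))\<^sup>2 \<le> (ell2_norm (?p - q))\<^sup>2" by simp
    then have "ell2_norm (?p - P m) \<le> ell2_norm (?p - q)" by (rule power2_le_imp_le) simp
    then show ?thesis by (simp only: L2_norm_minus_commute)
  qed
  have "(\<lambda>m. ell2_norm (P m - ?p)) \<longlonglongrightarrow> 0"
  proof (rule LIMSEQ_I)
    fix r :: real assume "0 < r"
    then obtain q where q: "q \<in> cfun.span (range e)" "ell2_norm (q - ?p) < r"
      using closed_span_approx[OF p] by blast
    obtain M where M: "\<And>m. m \<ge> M \<Longrightarrow> q \<in> cfun.span (e ` {..<m})" using span_range_initial[OF q(1)] by blast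
    have "norm (ell2_norm (P m - ?p) - 0) < r" if "m \<ge> M" for m
      using best[OF M[OF that]] q(2) by simp
    then show "\<exists>no. \<forall>m\<ge>no. norm (ell2_norm (P m - ?p) - 0) < r" by blast
  qed
  then show ?thesis by (simp add: L2_converges_def P_def)
qed

text \<open>With a countable discrete factor, joint measurability reduces to that of the sections.
  Inner products and norms of fibers are integrals of this kind.\<close>

lemma borel_measurable_count_integral:
  fixes f :: "'x \<Rightarrow> 'k::countable \<Rightarrow> 'b::{banach, second_countable_topology}"
  assumes "\<And>k. (\<lambda>x. f x k) \<in> borel_measurable M"
  shows "(\<lambda>x. \<integral>k. f x k \<partial>count_space UNIV) \<in> borel_measurable M"
proof -
  interpret sigma_finite_measure "count_space (UNIV :: 'k set)"
    by (rule sigma_finite_measure_count_space)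
  have "(\<lambda>(k, x). f x k) \<in> borel_measurable (count_space UNIV \<Otimes>\<^sub>M M)"
    by (rule measurable_pair_measure_countable1) (use assms in auto)
  then have "(\<lambda>(x, k). f x k) \<in> borel_measurable (M \<Otimes>\<^sub>M count_space UNIV)"
    by (subst measurable_pair_swap_iff) (simp add: case_prod_beta')
  then show ?thesis by (rule borel_measurable_lebesgue_integral)
qed

lemma borel_measurable_ell2_inner:
  fixes f g :: "'x \<Rightarrow> 'k::countable \<Rightarrow> complex"
  assumes "\<And>k. (\<lambda>x. f x k) \<in> borel_measurable M" "\<And>k. (\<lambda>x. g x k) \<in> borel_measurable M"
  shows "(\<lambda>x. ell2_inner (f x) (g x)) \<in> borel_measurable M"
  unfolding L2_inner_def using assms
  by (intro borel_measurable_count_integral borel_measurable_times borel_measurable_cnj)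

lemma borel_measurable_ell2_norm:
  fixes f :: "'x \<Rightarrow> 'k::countable \<Rightarrow> complex"
  assumes "\<And>k. (\<lambda>x. f x k) \<in> borel_measurable M"
  shows "(\<lambda>x. ell2_norm (f x)) \<in> borel_measurable M"
proof -
  have "(\<lambda>x. \<integral>k. (cmod (f x k))\<^sup>2 \<partial>count_space UNIV) \<in> borel_measurable M"
    using assms by (intro borel_measurable_count_integral borel_measurable_power
      measurable_compose[OF _ borel_measurable_norm])
  then show ?thesis unfolding L2_norm_def by measurable
qed

lemma borel_measurable_gram_schmidt:
  fixes v :: "'x \<Rightarrow> nat \<Rightarrow> 'k::countable \<Rightarrow> complex"
  assumes v: "\<And>j k. (\<lambda>x. v x j k) \<in> borel_measurable M"
  shows "(\<lambda>x. gram_schmidt (v x) j k) \<in> borel_measurable M"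
proof (induction j arbitrary: k rule: less_induct)
  case (less j)
  define r where "r x = v x j - (\<Sum>i<j. cscale (ell2_inner (v x j) (gram_schmidt (v x) i)) (gram_schmidt (v x) i))" for x
  have [measurable]: "(\<lambda>x. r x k) \<in> borel_measurable M" for k
    unfolding r_def minus_fun_eval sum_fun_eval cscale_apply
    using v less by (intro borel_measurable_diff borel_measurable_sum borel_measurable_times borel_measurable_ell2_inner) auto
  then have [measurable]: "(\<lambda>x. ell2_norm (r x)) \<in> borel_measurable M" by (intro borel_measurable_ell2_norm) auto
  have "(\<lambda>x. of_real (1 / ell2_norm (r x)) * r x k) \<in> borel_measurable M" by measurable
  then show ?case
    by (subst gram_schmidt.simps) (simp add: ell2_normalize_def r_def)
qed

lemma borel_measurable_orthonormal_or_zero_proj: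
  fixes e :: "'x \<Rightarrow> nat \<Rightarrow> 'k::countable \<Rightarrow> complex"
  assumes m: "\<And>j k. (\<lambda>x. e x j k) \<in> borel_measurable M"
    and e: "\<And>x. x \<in> space M \<Longrightarrow> orthonormal_or_zero (e x)" and a: "a \<in> ell2" and b: "b \<in> ell2"
  shows "(\<lambda>x. ell2_inner (ell2_proj (ell2_span (range (e x))) a) b) \<in> borel_measurable M"
proof (rule borel_measurable_LIMSEQ_metric)
  show "(\<lambda>x. \<Sum>j<i. ell2_inner a (e x j) * ell2_inner (e x j) b) \<in> borel_measurable M" for i
    using m by (intro borel_measurable_sum borel_measurable_times borel_measurable_ell2_inner) auto
  fix x assume x: "x \<in> space M"
  have eL: "e x j \<in> ell2" for j using orthonormal_or_zeroD(1)[OF e[OF x]] .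
  have S: "ell2_closed (ell2_span (range (e x)))"
    using eL by (intro closed_subspace_closed_span) auto
  have "(\<lambda>m. ell2_inner (\<Sum>j<m. cscale (ell2_inner a (e x j)) (e x j)) b)
    \<longlonglongrightarrow> ell2_inner (ell2_proj (ell2_span (range (e x))) a) b"
    using ell2_proj(1)[OF S a] closed_subspaceD(1)[OF S] eL
    by (intro L2_converges_inner orthonormal_or_zero_proj_converges[OF e[OF x] a] b L2_sum L2_cscale) auto
  then show "(\<lambda>m. \<Sum>j<m. ell2_inner a (e x j) * ell2_inner (e x j) b)
    \<longlonglongrightarrow> ell2_inner (ell2_proj (ell2_span (range (e x))) a) b"
    by (simp add: L2_inner_sum_left L2_cscale eL b L2_inner_cscale_left)
qed

lemma orthonormal_independent:
  assumes eL: "\<And>i. i \<in> I \<Longrightarrow> e i \<in> ell2"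
    and on: "\<And>i j. i \<in> I \<Longrightarrow> j \<in> I \<Longrightarrow> ell2_inner (e i) (e j) = (if i = j then 1 else 0)"
  shows "cfun.independent (e ` I)" "inj_on e I"
proof -
  show inj: "inj_on e I"
  proof (rule inj_onI)
    fix i j assume "i \<in> I" "j \<in> I" "e i = e j"
    then show "i = j" using on[of i j] on[of i i] by (auto split: if_splits)
  qed
  show "cfun.independent (e ` I)"
    unfolding cfun.independent_explicit_module
  proof (intro allI impI)
    fix t u v assume t: "finite t" "t \<subseteq> e ` I" "(\<Sum>v\<in>t. cscale (u v) v) = 0" "v \<in> t"
    have tL: "w \<in> ell2" if "w \<in> t" for w using that t(2) eL by auto
    have on': "ell2_inner w v = (if w = v then 1 else 0)" if w: "w \<in> t" for w
    proof -
      obtain i j where "i \<in> I" "w = e i" "j \<in> I" "v = e j" using w t(2,4) by blast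
      then show ?thesis using on[of i j] by (cases "i = j") (auto dest: inj_onD[OF inj])
    qed
    have "0 = ell2_inner (\<Sum>w\<in>t. cscale (u w) w) v" using t(3) by simp
    also have "\<dots> = (\<Sum>w\<in>t. u w * ell2_inner w v)"
      using tL t(4) by (subst L2_inner_sum_left) (auto simp: L2_inner_cscale_left)
    also have "\<dots> = (\<Sum>w\<in>t. if w = v then u v else 0)"
      by (intro sum.cong) (auto simp: on')
    also have "\<dots> = u v" using t(1,4) by simp
    finally show "u v = 0" by simp
  qed
qed

text \<open>For finite \<open>I\<close> the span is already closed: the residual of the Fourier
  expansion lies in the closed span and is orthogonal to its generators, hence zero. For infinite
  \<open>I\<close> a finite spanning set would bound the size of an independent set.\<close>

lemma cdim_orthonormal:
  assumes eL: "\<And>i. i \<in> I \<Longrightarrow> e i \<in> ell2"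
    and on: "\<And>i j. i \<in> I \<Longrightarrow> j \<in> I \<Longrightarrow> ell2_inner (e i) (e j) = (if i = j then 1 else 0)"
  shows "cdim (ell2_span (e ` I)) = (if finite I then enat (card I) else \<infinity>)"
proof (cases "finite I")
  case True
  let ?S = "ell2_span (e ` I)"
  have sub: "e ` I \<subseteq> ell2" using eL by auto
  have "?S = cfun.span (e ` I)"
  proof
    show "cfun.span (e ` I) \<subseteq> ?S" by (rule closed_span_superset[OF sub])
    show "?S \<subseteq> cfun.span (e ` I)"
    proof
      fix f assume f: "f \<in> ?S"
      then have fL: "f \<in> ell2" by (simp add: closed_span_def)
      let ?p = "\<Sum>i\<in>I. cscale (ell2_inner f (e i)) (e i)"
      have p: "?p \<in> cfun.span (e ` I)" by (intro cfun.span_sum cfun.span_scale cfun.span_base) auto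
      have pL: "?p \<in> ell2" using eL by (intro L2_sum L2_cscale)
      have S: "ell2_closed ?S" using closed_subspace_closed_span[OF sub] .
      have d: "f - ?p \<in> ?S" using f p closed_span_superset[OF sub] closed_subspaceD(2)[OF S]
        by (blast intro: cfun.subspace_diff)
      have dL: "f - ?p \<in> ell2" using fL pL by auto
      have "ell2_inner (e i) (f - ?p) = 0" if i: "i \<in> I" for i
      proof -
        have "ell2_inner ?p (e i) = (\<Sum>j\<in>I. ell2_inner f (e j) * ell2_inner (e j) (e i))"
          using eL i by (subst L2_inner_sum_left) (auto simp: L2_inner_cscale_left)
        also have "\<dots> = (\<Sum>j\<in>I. if j = i then ell2_inner f (e i) else 0)"
          by (intro sum.cong) (auto simp: on i)
        also have "\<dots> = ell2_inner f (e i)" using i True by simp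
        finally have "ell2_inner (f - ?p) (e i) = 0" using L2_inner_diff_left[OF fL pL eL[OF i]] by simp
        then show ?thesis by (subst L2_inner_commute) simp
      qed
      then have "ell2_inner (f - ?p) (f - ?p) = 0"
        by (intro closed_span_orthogonal[OF sub dL _ d]) auto
      then have "f = ?p" using ell2_inner_self_eq_0[OF dL] by simp
      with p show "f \<in> cfun.span (e ` I)" by simp
    qed
  qed
  then have "cdim ?S = enat (cfun.dim ?S)"
    unfolding cdim_def using True by (metis finite_imageI)
  also have "cfun.dim ?S = card (e ` I)"
    using cfun.dim_span_eq_card_independent[OF orthonormal_independent(1)[OF eL on]] \<open>?S = _\<close> by simp
  also have "\<dots> = card I" by (rule card_image[OF orthonormal_independent(2)[OF eL on]])
  finally show ?thesis using True by simp
next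
  case False
  have "\<not> (finite B \<and> cfun.span B = ell2_span (e ` I))" for B
  proof
    assume B: "finite B \<and> cfun.span B = ell2_span (e ` I)"
    have "e ` I \<subseteq> cfun.span B" using B closed_span_base[of "e ` I" "count_space UNIV"] eL by auto
    then have "finite (e ` I)"
      using cfun.independent_span_bound[of B "e ` I"] B orthonormal_independent(1)[OF eL on] by auto
    then show False using False finite_imageD orthonormal_independent(2)[OF eL on] by blast
  qed
  then show ?thesis using False by (auto simp: cdim_def)
qed

section \<open>Boxes and the torus\<close>

definition rat_points :: "'a::euclidean_space set" where
  "rat_points = {a. \<forall>i\<in>Basis. a \<bullet> i \<in> \<rat>}"

text \<open>A countable generator of the Borel sets that is closed under intersection: maxima and
  minima of rational coordinates are rational, and an empty intersection is again of the form
  \<open>box a b\<close>.\<close>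

definition rat_boxes :: "'a::euclidean_space set set" where
  "rat_boxes = (\<lambda>(a, b). box a b) ` (rat_points \<times> rat_points)"

lemma countable_rat_boxes: "countable (rat_boxes :: 'a::euclidean_space set set)"
proof -
  have "rat_points \<subseteq> (\<lambda>f. \<Sum>i\<in>Basis. f i *\<^sub>R i) ` ((Basis :: 'a set) \<rightarrow>\<^sub>E \<rat>)"
  proof
    fix a :: 'a assume a: "a \<in> rat_points"
    show "a \<in> (\<lambda>f. \<Sum>i\<in>Basis. f i *\<^sub>R i) ` (Basis \<rightarrow>\<^sub>E \<rat>)"
    proof (rule image_eqI)
      show "a = (\<Sum>i\<in>Basis. restrict (\<lambda>i. a \<bullet> i) Basis i *\<^sub>R i)" by (simp add: euclidean_representation)
    qed (use a in \<open>auto simp: rat_points_def\<close>)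
  qed
  moreover have "countable ((Basis :: 'a set) \<rightarrow>\<^sub>E (\<rat> :: real set))"
    by (rule countable_PiE) (simp_all add: countable_rat)
  ultimately have "countable (rat_points :: 'a set)" by (rule countable_subset[OF _ countable_image])
  then show ?thesis unfolding rat_boxes_def by (intro countable_image countable_SIGMA)
qed

lemma rat_boxes_Int: "A \<in> rat_boxes \<Longrightarrow> B \<in> rat_boxes \<Longrightarrow> A \<inter> B \<in> rat_boxes"
proof -
  assume "A \<in> rat_boxes" "B \<in> rat_boxes"
  then obtain a b c d where ab: "A = box a b" "a \<in> rat_points" "b \<in> rat_points"
    and cd: "B = box c d" "c \<in> rat_points" "d \<in> rat_points" by (auto simp: rat_boxes_def)
  have "A \<inter> B = box (\<Sum>i\<in>Basis. max (a \<bullet> i) (c \<bullet> i) *\<^sub>R i) (\<Sum>i\<in>Basis. min (b \<bullet> i) (d \<bullet> i) *\<^sub>R i)"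
    unfolding ab cd by (rule box_Int_box)
  moreover have "(\<Sum>i\<in>Basis. max (a \<bullet> i) (c \<bullet> i) *\<^sub>R i) \<in> rat_points" "(\<Sum>i\<in>Basis. min (b \<bullet> i) (d \<bullet> i) *\<^sub>R i) \<in> rat_points"
    using ab cd by (auto simp: rat_points_def max_def min_def)
  ultimately show ?thesis by (auto simp: rat_boxes_def)
qed

lemma box_nat_rat: "box (- real n *\<^sub>R One) (real n *\<^sub>R One) \<in> (rat_boxes :: 'a::euclidean_space set set)"
  by (auto simp: rat_boxes_def rat_points_def intro!: image_eqI[of _ _ "(_, _)"])

lemma topological_basis_rat_boxes: "topological_basis (rat_boxes :: 'a::euclidean_space set set)"
  unfolding topological_basis_def
proof (intro conjI ballI allI impI)
  show "open b" if "b \<in> rat_boxes" for b :: "'a set" using that by (auto simp: rat_boxes_def)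
  fix X :: "'a set" assume "open X"
  note U = open_UNION_box[OF this]
  let ?I = "{f \<in> Basis \<rightarrow>\<^sub>E \<rat> \<times> \<rat>. box (\<Sum>i\<in>Basis. fst (f i) *\<^sub>R i) (\<Sum>i\<in>Basis. snd (f i) *\<^sub>R i) \<subseteq> X}"
  let ?B = "(\<lambda>f. box (\<Sum>i\<in>Basis. fst (f i) *\<^sub>R i) (\<Sum>i\<in>Basis. snd (f i) *\<^sub>R i)) ` ?I"
  have "?B \<subseteq> rat_boxes"
    by (force simp: rat_boxes_def rat_points_def PiE_iff mem_Times_iff intro!: image_eqI[of _ _ "(_, _)"])
  moreover have "\<Union>?B = X" using U by simp
  ultimately show "\<exists>B'\<subseteq>rat_boxes. \<Union>B' = X" by blast
qed

lemma sets_borel_rat_boxes: "sets (borel :: 'a::euclidean_space measure) = sigma_sets UNIV rat_boxes"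
  by (subst borel_eq_countable_basis[OF countable_rat_boxes topological_basis_rat_boxes]) simp

lemma UN_box_nat: "(\<Union>n. box (- real n *\<^sub>R One) (real n *\<^sub>R One)) = (UNIV :: 'a::euclidean_space set)"
proof -
  have "x \<in> (\<Union>n. box (- real n *\<^sub>R One) (real n *\<^sub>R One))" for x :: 'a
  proof -
    obtain n where n: "norm x < real n" using reals_Archimedean2 by blast
    have "\<bar>x \<bullet> i\<bar> < real n" if "i \<in> Basis" for i using Basis_le_norm[OF that, of x] n by linarith
    then have "x \<in> box (- real n *\<^sub>R One) (real n *\<^sub>R One)"
      by (fastforce simp: mem_box inner_diff_left abs_less_iff)
    then show ?thesis by blast
  qed
  then show ?thesis by blast
qed

lemma indicator_box_tendsto:
  fixes x :: "'a::euclidean_space"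
  shows "(\<lambda>n. indicator (box (- real n *\<^sub>R One) (real n *\<^sub>R One)) x :: real) \<longlonglongrightarrow> 1"
proof -
  have "incseq (\<lambda>n. box (- real n *\<^sub>R One) (real n *\<^sub>R One) :: 'a set)"
    by (auto simp: incseq_def mem_box) (meson le_minus_iff minus_le_iff of_nat_le_iff order.strict_trans1 order.strict_trans2 neg_le_iff_le)+
  from LIMSEQ_indicator_incseq[OF this, of x] show ?thesis by (simp only: UN_box_nat) simp
qed

text \<open>The sets over which \<open>h\<close> integrates to 0 form a Dynkin class containing an
  intersection-stable generator, hence all Borel sets; Lebesgue sets differ from these by null sets.
  Uniqueness of densities then applies to the real and the imaginary part.\<close>

lemma integrable_zero_on_rat_boxes:
  fixes h :: "'a::euclidean_space \<Rightarrow> complex"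
  assumes h: "integrable lebesgue h"
    and 0: "\<And>B. B \<in> rat_boxes \<Longrightarrow> (\<integral>x. indicator B x *\<^sub>R h x \<partial>lebesgue) = 0"
  shows "AE x in lebesgue. h x = 0"
proof -
  have box0: "(\<integral>x. indicator A x *\<^sub>R h x \<partial>lebesgue) = 0" if A: "A \<in> sigma_sets UNIV rat_boxes" for A
  proof -
    have ss: "B \<in> sets lebesgue" if "B \<in> sigma_sets UNIV rat_boxes" for B :: "'a set"
    proof -
      have "B \<in> sets lborel" using that by (simp add: sets_borel_rat_boxes)
      then show ?thesis by (rule sets_completionI_sets)
    qed
    have int: "integrable lebesgue (\<lambda>x. indicator B x *\<^sub>R h x)" if "B \<in> sigma_sets UNIV rat_boxes" for B
      by (rule integrable_mult_indicator[OF ss[OF that] h])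
    \<comment> \<open>The complement step of the induction needs the integral over the whole space,
      which is not a box but the limit of an increasing sequence of boxes.\<close>
    have all: "(\<integral>x. h x \<partial>lebesgue) = 0"
    proof -
      have "(\<lambda>n. \<integral>x. indicator (box (- real n *\<^sub>R One) (real n *\<^sub>R One)) x *\<^sub>R h x \<partial>lebesgue) \<longlonglongrightarrow> (\<integral>x. h x \<partial>lebesgue)"
      proof (rule integral_dominated_convergence)
        show "integrable lebesgue (\<lambda>x. norm (h x))" using h by simp
        show "AE x in lebesgue. (\<lambda>n. indicator (box (- real n *\<^sub>R One) (real n *\<^sub>R One)) x *\<^sub>R h x) \<longlonglongrightarrow> h x"
          using tendsto_scaleR[OF indicator_box_tendsto tendsto_const] by (intro AE_I2) fastforce
        show "(\<lambda>x. indicator (box (- real n *\<^sub>R One) (real n *\<^sub>R One)) x *\<^sub>R h x) \<in> borel_measurable lebesgue" for n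
          using int[OF sigma_sets.Basic[OF box_nat_rat]] by auto
        show "AE x in lebesgue. norm (indicator (box (- real n *\<^sub>R One) (real n *\<^sub>R One)) x *\<^sub>R h x) \<le> norm (h x)" for n
          by (intro AE_I2) (simp add: indicator_def)
      qed (use h in auto)
      then show ?thesis using 0[OF box_nat_rat] by (simp add: LIMSEQ_const_iff)
    qed
    have "Int_stable (rat_boxes :: 'a set set)" by (auto simp: Int_stable_def rat_boxes_Int)
    moreover have "(rat_boxes :: 'a set set) \<subseteq> Pow UNIV" by simp
    ultimately show ?thesis using A
    proof (induction rule: sigma_sets_induct_disjoint)
      case (basic A) then show ?case by (rule 0)
    next
      case (compl A)
      have "(\<lambda>x. indicator (UNIV - A) x *\<^sub>R h x) = (\<lambda>x. h x - indicator A x *\<^sub>R h x)"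
        by (auto simp: fun_eq_iff indicator_def)
      then show ?case using compl int[OF compl(1)] h all by simp
    next
      case (union A)
      have sA: "A i \<in> sets lebesgue" for i using union ss by auto
      have "(LINT x:(\<Union>i. A i)|lebesgue. h x) = (\<Sum>i. LINT x:A i|lebesgue. h x)"
      proof (rule lebesgue_integral_countable_add)
        show "A i \<inter> A j = {}" if "i \<noteq> j" for i j using union(1) that by (auto simp: disjoint_family_on_def)
        show "set_integrable lebesgue (\<Union>i. A i) h"
          unfolding set_integrable_def using sA h by (intro integrable_mult_indicator) auto
      qed (rule sA)
      then show ?case using union by (simp add: set_lebesgue_integral_def)
    qed simp
  qed
  have leb0: "(LINT x:A|lebesgue. h x) = 0" if A: "A \<in> sets lebesgue" for A
  proof -
    obtain C N where C: "C \<in> sets borel" "negligible N" "C \<union> N = A"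
      using sets_lebesgue_almost_borel[OF A] by blast
    have "AE x in lebesgue. x \<notin> N" using C(2) by (simp add: AE_not_in negligible_iff_null_sets)
    then have ae: "AE x in lebesgue. indicator A x *\<^sub>R h x = indicator C x *\<^sub>R h x"
      by eventually_elim (use C(3) in \<open>auto simp: indicator_def\<close>)
    have "(\<integral>x. indicator A x *\<^sub>R h x \<partial>lebesgue) = (\<integral>x. indicator C x *\<^sub>R h x \<partial>lebesgue)"
      by (rule integral_cong_AE[OF _ _ ae])
        (rule borel_measurable_integrable[OF integrable_mult_indicator[OF _ h]], use A C(1) in simp)+
    moreover have "C \<in> sigma_sets UNIV rat_boxes" using C(1) by (simp add: sets_borel_rat_boxes)
    ultimately show ?thesis using box0[of C] by (simp add: set_lebesgue_integral_def)
  qed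
  have "AE x in lebesgue. Re (h x) = 0"
  proof (rule density_unique_real)
    fix A :: "'a set" assume A: "A \<in> sets lebesgue"
    have "(LINT x:A|lebesgue. Re (h x)) = Re (LINT x:A|lebesgue. h x)"
      unfolding set_lebesgue_integral_def
      by (subst integral_Re[symmetric]) (use integrable_mult_indicator[OF A h] in auto)
    then show "(LINT x:A|lebesgue. Re (h x)) = (LINT x:A|lebesgue. 0)" using leb0[OF A] by (simp add: set_lebesgue_integral_def)
  qed (use h in auto)
  moreover have "AE x in lebesgue. Im (h x) = 0"
  proof (rule density_unique_real)
    fix A :: "'a set" assume A: "A \<in> sets lebesgue"
    have "(LINT x:A|lebesgue. Im (h x)) = Im (LINT x:A|lebesgue. h x)"
      unfolding set_lebesgue_integral_def
      by (subst integral_Im[symmetric]) (use integrable_mult_indicator[OF A h] in auto)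
    then show "(LINT x:A|lebesgue. Im (h x)) = (LINT x:A|lebesgue. 0)" using leb0[OF A] by (simp add: set_lebesgue_integral_def)
  qed (use h in auto)
  ultimately show ?thesis by eventually_elim (simp add: complex_eq_iff)
qed

definition cind :: "'a set \<Rightarrow> 'a \<Rightarrow> complex" where
  "cind B x = of_real (indicator B x)"

lemma cind_box_L2: "cind (box a b) \<in> L2 lebesgue"
proof (rule L2I)
  show "cind (box a b) \<in> borel_measurable lebesgue" unfolding cind_def[abs_def]
    by (rule measurable_compose[OF borel_measurable_indicator]) auto
  have "integrable lebesgue (indicator (box a b) :: _ \<Rightarrow> real)"
    by (intro integrable_real_indicator) (auto simp: emeasure_lborel_box_eq)
  moreover have "(cmod (cind (box a b) x))\<^sup>2 = indicator (box a b) x" for x by (simp add: cind_def indicator_def)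
  ultimately show "integrable lebesgue (\<lambda>x. (cmod (cind (box a b) x))\<^sup>2)" by simp
qed

lemma cind_rat_box_L2: "B \<in> rat_boxes \<Longrightarrow> cind B \<in> L2 lebesgue"
  using cind_box_L2 by (auto simp: rat_boxes_def)

text \<open>Cutting \<open>f\<close> off to a bounded box makes it integrable, and testing the
  cut-off function on another box amounts to testing \<open>f\<close> on the intersection, again a
  rational box.\<close>

lemma L2_zero_on_rat_boxes:
  fixes f :: "'a::euclidean_space \<Rightarrow> complex"
  assumes f: "f \<in> L2 lebesgue" and 0: "\<And>B. B \<in> rat_boxes \<Longrightarrow> L2_inner lebesgue f (cind B) = 0"
  shows "AE x in lebesgue. f x = 0"
proof -
  let ?R = "\<lambda>n::nat. box (- real n *\<^sub>R One) (real n *\<^sub>R One) :: 'a set"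
  have "AE x in lebesgue. cind (?R n) x * f x = 0" for n
  proof (rule integrable_zero_on_rat_boxes)
    show "integrable lebesgue (\<lambda>x. cind (?R n) x * f x)"
      by (rule L2_integrable_prod[OF cind_rat_box_L2[OF box_nat_rat] f])
    fix B :: "'a set" assume B: "B \<in> rat_boxes"
    have "(\<lambda>x. indicator B x *\<^sub>R (cind (?R n) x * f x)) = (\<lambda>x. f x * cnj (cind (?R n \<inter> B) x))"
      by (auto simp: fun_eq_iff cind_def indicator_def)
    then show "(\<integral>x. indicator B x *\<^sub>R (cind (?R n) x * f x) \<partial>lebesgue) = 0"
      using 0[OF rat_boxes_Int[OF box_nat_rat[of n] B]] by (simp add: L2_inner_def)
  qed
  then have "AE x in lebesgue. \<forall>n. cind (?R n) x * f x = 0" unfolding AE_all_countable by blast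
  then show ?thesis
  proof eventually_elim
    case (elim x)
    obtain n where "x \<in> ?R n" using UN_box_nat by blast
    then show ?case using elim[rule_format, of n] by (simp add: cind_def)
  qed
qed

section \<open>Translations, the integer lattice and the unit cell\<close>

lemma distr_lebesgue_plus: "distr lebesgue lebesgue (\<lambda>x. c + x) = (lebesgue :: 'a::euclidean_space measure)"
  using lebesgue_affine_euclidean[of "\<lambda>_. 1" c] by (simp add: euclidean_representation density_1)

lemma measurable_lebesgue_plus [measurable]: "(\<lambda>x. c + x) \<in> lebesgue \<rightarrow>\<^sub>M (lebesgue :: 'a::euclidean_space measure)"
  using lebesgue_affine_measurable[of "\<lambda>_. 1" c] by (simp add: euclidean_representation)

lemma distr_lebesgue_plus': "distr lebesgue lebesgue (\<lambda>x. x + c) = (lebesgue :: 'a::euclidean_space measure)"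
  using distr_lebesgue_plus[of c] by (simp add: add.commute)

lemma measurable_lebesgue_plus' [measurable]: "(\<lambda>x. x + c) \<in> lebesgue \<rightarrow>\<^sub>M (lebesgue :: 'a::euclidean_space measure)"
  using measurable_lebesgue_plus[of c] by (simp add: add.commute)

lemma AE_lebesgue_plus:
  assumes "AE x in lebesgue. P x" shows "AE x in lebesgue. P (x + c :: 'a::euclidean_space)"
proof -
  have "AE x in distr lebesgue lebesgue (\<lambda>x. x + c). P x" unfolding distr_lebesgue_plus' by fact
  then show ?thesis by (rule AE_distrD[rotated]) measurable
qed

lemma lattice_vec_add: "lattice_vec (k + l) = lattice_vec k + lattice_vec l"
  by (simp add: lattice_vec_def vec_eq_iff)

lemma lattice_vec_minus: "lattice_vec (- k) = - lattice_vec k"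
  by (simp add: lattice_vec_def vec_eq_iff)

lemma lattice_vec_0 [simp]: "lattice_vec 0 = 0"
  by (simp add: lattice_vec_def vec_eq_iff)

lemma lattice_vec_nth [simp]: "lattice_vec k $ i = of_int (k $ i)"
  by (simp add: lattice_vec_def)

definition floor_vec :: "real ^ 'n \<Rightarrow> int ^ 'n" where
  "floor_vec x = (\<chi> i. \<lfloor>x $ i\<rfloor>)"

lemma floor_vec_unique: "x - lattice_vec k \<in> torus \<longleftrightarrow> k = floor_vec x"
proof
  assume "x - lattice_vec k \<in> torus"
  then have "0 \<le> x $ i - of_int (k $ i)" "x $ i - of_int (k $ i) < 1" for i by (auto simp: torus_def)
  then have "\<lfloor>x $ i\<rfloor> = k $ i" for i by (intro floor_unique) (auto simp: algebra_simps)
  then show "k = floor_vec x" by (simp add: floor_vec_def vec_eq_iff)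
next
  assume "k = floor_vec x"
  then show "x - lattice_vec k \<in> torus" by (auto simp: torus_def floor_vec_def) linarith
qed

lemma floor_vec_torus [simp]: "x - lattice_vec (floor_vec x) \<in> torus"
  by (simp add: floor_vec_unique)

lemma floor_vec_add: "x \<in> torus \<Longrightarrow> floor_vec (x + lattice_vec k) = k"
  using floor_vec_unique[of "x + lattice_vec k" k] by simp

lemma torus_borel [measurable]: "(torus :: (real ^ 'n) set) \<in> sets borel"
proof -
  have "(torus :: (real ^ 'n) set) = (\<Inter>i. {x. 0 \<le> x $ i} \<inter> {x. x $ i < 1})" by (auto simp: torus_def)
  also have "\<dots> \<in> sets borel"
    by (intro sets.countable_INT'' sets.Int borel_closed borel_open closed_halfspace_component_ge_cart open_halfspace_component_lt_cart)
      (auto simp: closed_halfspace_component_ge_cart[unfolded Collect_conv_if])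
  finally show ?thesis .
qed

lemma torus_lebesgue [measurable]: "(torus :: (real ^ 'n) set) \<in> sets lebesgue"
  using torus_borel by auto

lemma box_torus: "box 0 1 \<subseteq> (torus :: (real ^ 'n) set)" "torus \<subseteq> cbox 0 (1 :: real ^ 'n)"
  by (auto simp: torus_def mem_box_cart less_imp_le)

lemma emeasure_torus: "emeasure lebesgue (torus :: (real ^ 'n) set) = 1"
proof (rule antisym)
  have "(1 :: real ^ 'n) \<bullet> b = 1" if "b \<in> Basis" for b
    using that by (auto simp: Basis_vec_def inner_axis)
  then have 1: "emeasure lborel (cbox 0 (1 :: real ^ 'n)) = 1" "emeasure lborel (box 0 (1 :: real ^ 'n)) = 1"
    using emeasure_lborel_cbox[of 0 "1 :: real ^ 'n"] emeasure_lborel_box[of 0 "1 :: real ^ 'n"] by simp_all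
  have "emeasure lebesgue (torus :: (real ^ 'n) set) \<le> emeasure lebesgue (cbox 0 (1 :: real ^ 'n))"
    by (rule emeasure_mono[OF box_torus(2)]) auto
  then show "emeasure lebesgue (torus :: (real ^ 'n) set) \<le> 1" using 1 by simp
  have "emeasure lebesgue (box 0 (1 :: real ^ 'n)) \<le> emeasure lebesgue (torus :: (real ^ 'n) set)"
    by (rule emeasure_mono[OF box_torus(1)]) auto
  then show "1 \<le> emeasure lebesgue (torus :: (real ^ 'n) set)" using 1 by simp
qed

lemma prob_space_torus: "prob_space (lebesgue_on (torus :: (real ^ 'n) set))"
  by (rule prob_spaceI) (simp add: emeasure_restrict_space emeasure_torus)

lemma AE_torus_iff: "(AE x in lebesgue_on (torus :: (real ^ 'n) set). P x) \<longleftrightarrow> (AE x in lebesgue. x \<in> torus \<longrightarrow> P x)"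
  by (rule AE_restrict_space_iff) simp

text \<open>The lattice translates of the cell cover space and are countable in number, so null sets
  can be collected in both directions. It converts statements at almost every point of space into
  statements about all entries of almost every fiber.\<close>

lemma AE_lebesgue_iff_torus:
  fixes P :: "real ^ 'n \<Rightarrow> bool"
  shows "(AE x in lebesgue. P x) \<longleftrightarrow> (AE x in lebesgue_on torus. \<forall>k. P (x + lattice_vec k))"
proof
  assume "AE x in lebesgue. P x"
  then have "AE x in lebesgue. P (x + lattice_vec k)" for k by (rule AE_lebesgue_plus)
  then have "AE x in lebesgue. \<forall>k. P (x + lattice_vec k)" unfolding AE_all_countable by blast
  then show "AE x in lebesgue_on torus. \<forall>k. P (x + lattice_vec k)" by (auto simp: AE_torus_iff)
next
  assume "AE x in lebesgue_on torus. \<forall>k. P (x + lattice_vec k)"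
  then have *: "AE x in lebesgue. x \<in> torus \<longrightarrow> (\<forall>k. P (x + lattice_vec k))" by (simp add: AE_torus_iff)
  have "AE x in lebesgue. x - lattice_vec k \<in> torus \<longrightarrow> P x" for k
    using AE_lebesgue_plus[OF *, of "- lattice_vec k"]
    by eventually_elim (metis add.commute add_uminus_conv_diff diff_add_cancel)
  then have "AE x in lebesgue. \<forall>k. x - lattice_vec k \<in> torus \<longrightarrow> P x" unfolding AE_all_countable by blast
  then show "AE x in lebesgue. P x" by eventually_elim (meson floor_vec_torus)
qed

section \<open>Integration over space as summation over the lattice and integration over the
  torus\<close>

abbreviation lattice_torus :: "((int ^ 'n) \<times> (real ^ 'n)) measure" where
  "lattice_torus \<equiv> count_space UNIV \<Otimes>\<^sub>M lebesgue_on torus"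

lemma measurable_torus_plus: "(\<lambda>x. x + lattice_vec k) \<in> lebesgue_on torus \<rightarrow>\<^sub>M lebesgue"
  by (rule measurable_restrict_space1) measurable

lemma measurable_lattice_torus: "(\<lambda>(k, x). x + lattice_vec k) \<in> lattice_torus \<rightarrow>\<^sub>M (lebesgue :: (real ^ 'n) measure)"
  by (rule measurable_pair_measure_countable1) (auto intro: measurable_torus_plus)

text \<open>The lattice translates of the half-open cell partition space, and translation preserves
  Lebesgue measure. As an identity of measures it serves nonnegative integrals, integrability and
  Fubini alike.\<close>

lemma distr_lattice_torus: "distr lattice_torus lebesgue (\<lambda>(k, x). x + lattice_vec k) = (lebesgue :: (real ^ 'n) measure)"
proof (rule measure_eqI)
  fix A assume "A \<in> sets (distr lattice_torus lebesgue (\<lambda>(k, x). x + lattice_vec k :: real ^ 'n))"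
  then have A: "A \<in> sets (lebesgue :: (real ^ 'n) measure)" by simp
  interpret T: prob_space "lebesgue_on (torus :: (real ^ 'n) set)" by (rule prob_space_torus)
  let ?X = "(\<lambda>(k, x). x + lattice_vec k) -` A \<inter> space (lattice_torus :: ((int ^ 'n) \<times> (real ^ 'n)) measure)"
  have X: "?X \<in> sets lattice_torus" by (rule measurable_sets[OF measurable_lattice_torus A])
  have "emeasure (distr lattice_torus lebesgue (\<lambda>(k, x). x + lattice_vec k)) A = emeasure lattice_torus ?X"
    by (rule emeasure_distr[OF measurable_lattice_torus A])
  also have "\<dots> = (\<integral>\<^sup>+k. emeasure (lebesgue_on torus) (Pair k -` ?X) \<partial>count_space UNIV)"
    by (rule T.emeasure_pair_measure_alt[OF X])
  also have "\<dots> = (\<integral>\<^sup>+k. emeasure lebesgue (A \<inter> (\<lambda>x. x + - lattice_vec k) -` torus) \<partial>count_space UNIV)"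
  proof (rule nn_integral_cong)
    fix k :: "int ^ 'n"
    have e: "Pair k -` ?X = (\<lambda>x. x + lattice_vec k) -` (A \<inter> (\<lambda>x. x + - lattice_vec k) -` torus) \<inter> space lebesgue"
      by (auto simp: space_pair_measure space_restrict_space)
    have s: "A \<inter> (\<lambda>x. x + - lattice_vec k) -` torus \<in> sets lebesgue"
      using A measurable_sets[OF measurable_lebesgue_plus' torus_lebesgue, of "- lattice_vec k"] by auto
    have "emeasure (lebesgue_on torus) (Pair k -` ?X) = emeasure lebesgue (Pair k -` ?X)"
      by (rule emeasure_restrict_space) (auto simp: space_pair_measure space_restrict_space)
    also have "\<dots> = emeasure (distr lebesgue lebesgue (\<lambda>x. x + lattice_vec k)) (A \<inter> (\<lambda>x. x + - lattice_vec k) -` torus)"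
      unfolding e by (rule emeasure_distr[symmetric, OF measurable_lebesgue_plus' s])
    finally show "emeasure (lebesgue_on torus) (Pair k -` ?X) = emeasure lebesgue (A \<inter> (\<lambda>x. x + - lattice_vec k) -` torus)"
      by (simp add: distr_lebesgue_plus')
  qed
  also have "\<dots> = emeasure lebesgue (\<Union>k. A \<inter> (\<lambda>x. x + - lattice_vec k) -` torus)"
  proof (rule emeasure_UN_countable[symmetric])
    show "A \<inter> (\<lambda>x. x + - lattice_vec k) -` torus \<in> sets lebesgue" for k
      using A measurable_sets[OF measurable_lebesgue_plus' torus_lebesgue, of "- lattice_vec k"] by auto
    show "disjoint_family_on (\<lambda>k. A \<inter> (\<lambda>x. x + - lattice_vec k) -` torus) UNIV"
      by (auto simp: disjoint_family_on_def floor_vec_unique)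
  qed auto
  also have "(\<Union>k. A \<inter> (\<lambda>x. x + - lattice_vec k) -` torus) = A"
    by (auto simp: floor_vec_unique)
  finally show "emeasure (distr lattice_torus lebesgue (\<lambda>(k, x). x + lattice_vec k)) A = emeasure lebesgue A" .
qed simp

lemma pair_sigma_finite_lattice_torus:
  "pair_sigma_finite (count_space (UNIV :: (int ^ 'n) set)) (lebesgue_on (torus :: (real ^ 'n) set))"
proof -
  interpret T: prob_space "lebesgue_on (torus :: (real ^ 'n) set)" by (rule prob_space_torus)
  interpret K: sigma_finite_measure "count_space (UNIV :: (int ^ 'n) set)" by (rule sigma_finite_measure_count_space)
  show ?thesis by unfold_locales
qed

lemma nn_integral_lebesgue_torus:
  assumes f[measurable]: "f \<in> borel_measurable (lebesgue :: (real ^ 'n) measure)"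
  shows "(\<integral>\<^sup>+x. f x \<partial>lebesgue) = (\<integral>\<^sup>+x. \<integral>\<^sup>+k. f (x + lattice_vec k) \<partial>count_space UNIV \<partial>lebesgue_on torus)"
proof -
  interpret P: pair_sigma_finite "count_space (UNIV :: (int ^ 'n) set)" "lebesgue_on (torus :: (real ^ 'n) set)"
    by (rule pair_sigma_finite_lattice_torus)
  have m: "(\<lambda>(k, x). f (x + lattice_vec k)) \<in> borel_measurable lattice_torus"
    using measurable_compose[OF measurable_lattice_torus f] by (simp add: case_prod_beta')
  have "(\<integral>\<^sup>+x. f x \<partial>lebesgue) = (\<integral>\<^sup>+x. f x \<partial>distr lattice_torus lebesgue (\<lambda>(k, x). x + lattice_vec k))"
    by (simp add: distr_lattice_torus)
  also have "\<dots> = (\<integral>\<^sup>+z. f (case z of (k, x) \<Rightarrow> x + lattice_vec k) \<partial>lattice_torus)"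
    by (rule nn_integral_distr[OF measurable_lattice_torus]) (simp add: distr_lattice_torus)
  also have "\<dots> = (\<integral>\<^sup>+z. (case z of (k, x) \<Rightarrow> f (x + lattice_vec k)) \<partial>lattice_torus)"
    by (simp add: case_prod_beta')
  also have "\<dots> = (\<integral>\<^sup>+x. \<integral>\<^sup>+k. f (x + lattice_vec k) \<partial>count_space UNIV \<partial>lebesgue_on torus)"
    using P.nn_integral_snd[OF m] by simp
  finally show ?thesis .
qed

lemma integral_lebesgue_torus:
  fixes f :: "real ^ 'n \<Rightarrow> complex"
  assumes f: "integrable lebesgue f"
  shows "AE x in lebesgue_on torus. integrable (count_space UNIV) (\<lambda>k. f (x + lattice_vec k))"
    "integrable (lebesgue_on torus) (\<lambda>x. \<integral>k. f (x + lattice_vec k) \<partial>count_space UNIV)"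
    "(\<integral>x. f x \<partial>lebesgue) = (\<integral>x. \<integral>k. f (x + lattice_vec k) \<partial>count_space UNIV \<partial>lebesgue_on torus)"
proof -
  interpret P: pair_sigma_finite "count_space (UNIV :: (int ^ 'n) set)" "lebesgue_on (torus :: (real ^ 'n) set)"
    by (rule pair_sigma_finite_lattice_torus)
  have fm: "f \<in> borel_measurable lebesgue" using f by auto
  have e: "(\<lambda>z. f (case z of (k, x) \<Rightarrow> x + lattice_vec k)) = (\<lambda>(k, x). f (x + lattice_vec k))"
    by (simp add: case_prod_beta')
  have i: "integrable lattice_torus (\<lambda>(k, x). f (x + lattice_vec k))"
    using integrable_distr_eq[OF measurable_lattice_torus fm] f by (simp add: distr_lattice_torus e)
  show "AE x in lebesgue_on torus. integrable (count_space UNIV) (\<lambda>k. f (x + lattice_vec k))"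
    by (rule P.AE_integrable_snd[OF i])
  show "integrable (lebesgue_on torus) (\<lambda>x. \<integral>k. f (x + lattice_vec k) \<partial>count_space UNIV)"
    by (rule P.integrable_snd[OF i])
  show "(\<integral>x. f x \<partial>lebesgue) = (\<integral>x. \<integral>k. f (x + lattice_vec k) \<partial>count_space UNIV \<partial>lebesgue_on torus)"
    unfolding P.integral_snd[OF i]
    using integral_distr[OF measurable_lattice_torus fm] by (simp add: distr_lattice_torus e)
qed

section \<open>Fibers and Fourier coefficients\<close>

text \<open>With it, \<open>fiber f\<close> is \<open>lattice_fiber (fourier f)\<close>. Separating
  the sampling along the lattice from the transform lets the arguments on fibers run for arbitrary
  functions, independently of the representative chosen by \<open>fourier\<close>.\<close>

definition lattice_fiber :: "(real ^ 'n \<Rightarrow> complex) \<Rightarrow> real ^ 'n \<Rightarrow> int ^ 'n \<Rightarrow> complex" where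
  "lattice_fiber f x = (\<lambda>k. f (x + lattice_vec k))"

lemma lattice_fiber_diff: "lattice_fiber (f - g) x = lattice_fiber f x - lattice_fiber g x"
  by (simp add: lattice_fiber_def fun_eq_iff)

lemma lattice_fiber_add: "lattice_fiber (f + g) x = lattice_fiber f x + lattice_fiber g x"
  by (simp add: lattice_fiber_def fun_eq_iff)

lemma lattice_fiber_cscale: "lattice_fiber (cscale c f) x = cscale c (lattice_fiber f x)"
  by (simp add: lattice_fiber_def fun_eq_iff)

lemma AE_lattice_fiber_eq:
  "(AE x in lebesgue. f x = g x) \<longleftrightarrow> (AE x in lebesgue_on torus. lattice_fiber f x = lattice_fiber g x)"
  by (subst AE_lebesgue_iff_torus) (simp add: lattice_fiber_def fun_eq_iff)

lemma borel_measurable_lattice_fiber: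
  "f \<in> borel_measurable lebesgue \<Longrightarrow> (\<lambda>x. lattice_fiber f x k) \<in> borel_measurable (lebesgue_on torus)"
  unfolding lattice_fiber_def by (rule measurable_compose[OF measurable_torus_plus])

lemma AE_lattice_fiber_ell2:
  assumes f: "f \<in> L2 lebesgue" shows "AE x in lebesgue_on torus. lattice_fiber f x \<in> ell2"
  using integral_lebesgue_torus(1)[OF L2_integrable_inner[OF f f]]
proof eventually_elim
  case (elim x)
  have "cmod (f (x + lattice_vec k) * cnj (f (x + lattice_vec k))) = (cmod (f (x + lattice_vec k)))\<^sup>2" for k
    by (simp add: norm_mult power2_eq_square)
  then show ?case using integrable_norm[OF elim] by (simp add: L2_def lattice_fiber_def)
qed

lemma L2_inner_lattice_fiber:
  assumes f: "f \<in> L2 lebesgue" and g: "g \<in> L2 lebesgue"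
  shows "integrable (lebesgue_on torus) (\<lambda>x. ell2_inner (lattice_fiber f x) (lattice_fiber g x))"
    "L2_inner lebesgue f g = (\<integral>x. ell2_inner (lattice_fiber f x) (lattice_fiber g x) \<partial>lebesgue_on torus)"
  using integral_lebesgue_torus(2,3)[OF L2_integrable_inner[OF f g]] by (simp_all add: L2_inner_def lattice_fiber_def)

lemma L2_norm_lattice_fiber:
  assumes f: "f \<in> L2 lebesgue"
  shows "integrable (lebesgue_on torus) (\<lambda>x. (ell2_norm (lattice_fiber f x))\<^sup>2)"
    "(L2_norm lebesgue f)\<^sup>2 = (\<integral>x. (ell2_norm (lattice_fiber f x))\<^sup>2 \<partial>lebesgue_on torus)"
proof -
  note 1 = L2_inner_lattice_fiber[OF f f, unfolded L2_inner_self]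
  show "integrable (lebesgue_on torus) (\<lambda>x. (ell2_norm (lattice_fiber f x))\<^sup>2)"
    using integrable_Re[OF 1(1)] by simp
  show "(L2_norm lebesgue f)\<^sup>2 = (\<integral>x. (ell2_norm (lattice_fiber f x))\<^sup>2 \<partial>lebesgue_on torus)"
    using arg_cong[OF 1(2), of Re] by (simp add: integral_complex_of_real del: of_real_power)
qed

text \<open>The inverse of \<open>lattice_fiber\<close>: every point of space is in exactly one way
  a point of the cell plus a lattice vector. Measurable fields of sequences over the torus become
  functions on space.\<close>

definition glue_fibers :: "(real ^ 'n \<Rightarrow> int ^ 'n \<Rightarrow> complex) \<Rightarrow> real ^ 'n \<Rightarrow> complex" where
  "glue_fibers E x = E (x - lattice_vec (floor_vec x)) (floor_vec x)"

lemma lattice_fiber_glue: "x \<in> torus \<Longrightarrow> lattice_fiber (glue_fibers E) x = E x"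
  by (simp add: lattice_fiber_def glue_fibers_def floor_vec_add)

lemma borel_measurable_glue:
  fixes E :: "real ^ 'n \<Rightarrow> int ^ 'n \<Rightarrow> complex"
  assumes E: "\<And>k. (\<lambda>x. E x k) \<in> borel_measurable (lebesgue_on torus)"
  shows "glue_fibers E \<in> borel_measurable lebesgue"
proof -
  let ?P = "\<lambda>k :: int ^ 'n. {x :: real ^ 'n. x - lattice_vec k \<in> torus}"
  have eq: "?P k = (\<lambda>x. x + - lattice_vec k) -` torus \<inter> space lebesgue" for k by auto
  have P: "?P k \<in> sets lebesgue" for k
    unfolding eq by (rule measurable_sets[OF measurable_lebesgue_plus' torus_lebesgue])
  show ?thesis
  proof (rule measurable_piecewise_restrict[of "range ?P"])
    show "space lebesgue \<subseteq> \<Union>(range ?P)" by auto (meson floor_vec_torus)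
    fix \<Omega> assume "\<Omega> \<in> range ?P"
    then obtain k where k: "\<Omega> = ?P k" by auto
    show "\<Omega> \<inter> space lebesgue \<in> sets lebesgue" using P k by simp
    have "(\<lambda>x. x + - lattice_vec k) \<in> lebesgue_on (?P k) \<rightarrow>\<^sub>M lebesgue_on torus"
      by (intro measurable_restrict_space2 measurable_restrict_space1 measurable_lebesgue_plus')
        (auto simp: space_restrict_space)
    then have "(\<lambda>x. E (x + - lattice_vec k) k) \<in> borel_measurable (lebesgue_on (?P k))"
      by (rule measurable_compose[OF _ E])
    then show "glue_fibers E \<in> borel_measurable (lebesgue_on \<Omega>)"
      unfolding k by (rule measurable_cong[THEN iffD1, rotated])
        (auto simp: space_restrict_space glue_fibers_def floor_vec_unique)
  qed auto
qed

text \<open>The torus has measure 1, so a uniform bound on the norms of the fibers also bounds the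
  norm of the glued function.\<close>

lemma glue_fibers_L2:
  fixes E :: "real ^ 'n \<Rightarrow> int ^ 'n \<Rightarrow> complex"
  assumes E: "\<And>k. (\<lambda>x. E x k) \<in> borel_measurable (lebesgue_on torus)"
    and EL: "\<And>x. x \<in> torus \<Longrightarrow> E x \<in> ell2" and C: "\<And>x. x \<in> torus \<Longrightarrow> ell2_norm (E x) \<le> C" "0 \<le> C"
  shows "glue_fibers E \<in> L2 lebesgue"
proof (rule L2_nn_integralI(1)[OF borel_measurable_glue[OF E] _ C(2)])
  interpret T: prob_space "lebesgue_on (torus :: (real ^ 'n) set)" by (rule prob_space_torus)
  have m: "(\<lambda>x. ennreal ((cmod (glue_fibers E x))\<^sup>2)) \<in> borel_measurable lebesgue"
    using borel_measurable_glue[OF E] by measurable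
  have "(\<integral>\<^sup>+x. ennreal ((cmod (glue_fibers E x))\<^sup>2) \<partial>lebesgue)
      = (\<integral>\<^sup>+x. \<integral>\<^sup>+k. ennreal ((cmod (lattice_fiber (glue_fibers E) x k))\<^sup>2) \<partial>count_space UNIV \<partial>lebesgue_on torus)"
    unfolding nn_integral_lebesgue_torus[OF m] lattice_fiber_def ..
  also have "\<dots> = (\<integral>\<^sup>+x. ennreal ((ell2_norm (E x))\<^sup>2) \<partial>lebesgue_on torus)"
    by (rule nn_integral_cong) (simp add: space_restrict_space lattice_fiber_glue L2_nn_integral EL)
  also have "\<dots> \<le> (\<integral>\<^sup>+(x :: real ^ 'n). ennreal (C\<^sup>2) \<partial>lebesgue_on torus)"
    by (intro nn_integral_mono) (simp add: space_restrict_space C power_mono ennreal_leI)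
  also have "\<dots> = ennreal (C\<^sup>2)" by (simp add: emeasure_restrict_space emeasure_torus)
  finally show "(\<integral>\<^sup>+x. ennreal ((cmod (glue_fibers E x))\<^sup>2) \<partial>lebesgue) \<le> ennreal (C\<^sup>2)" .
qed

section \<open>Characters of the torus and modulations\<close>

definition character :: "int ^ 'n \<Rightarrow> real ^ 'n \<Rightarrow> complex" where
  "character k x = exp (2 * of_real pi * \<i> * of_real (lattice_vec k \<bullet> x))"

lemma character_0 [simp]: "character 0 x = 1"
  by (simp add: character_def)

lemma character_add: "character (k + l) x = character k x * character l x"
  by (simp add: character_def lattice_vec_add inner_add_left algebra_simps exp_add)

lemma character_plus: "character k (x + y) = character k x * character k y"
  by (simp add: character_def inner_add_right algebra_simps exp_add)

lemma cmod_character [simp]: "cmod (character k x) = 1"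
  by (simp add: character_def)

lemma character_minus: "character (- k) x = cnj (character k x)"
  by (simp add: character_def lattice_vec_minus exp_cnj)

lemma character_lattice [simp]: "character k (lattice_vec l) = 1"
proof -
  have "lattice_vec k \<bullet> lattice_vec l = of_int (\<Sum>i\<in>UNIV. k $ i * l $ i)"
    by (simp add: inner_vec_def)
  then have "character k (lattice_vec l) = exp ((2 * of_int (\<Sum>i\<in>UNIV. k $ i * l $ i) * pi) * \<i>)"
    by (simp only: character_def of_real_of_int_eq mult_ac of_real_mult of_real_numeral)
  then show ?thesis
    using exp_integer_2pi[OF Ints_of_int, of "\<Sum>i\<in>UNIV. k $ i * l $ i"] by (simp add: mult_ac)
qed

lemma character_periodic: "character k (x + lattice_vec l) = character k x"
  by (simp add: character_plus)

lemma continuous_character: "continuous_on S (character k)"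
  unfolding character_def by (intro continuous_intros)

lemma borel_measurable_character [measurable]: "character k \<in> borel_measurable borel"
  by (rule borel_measurable_continuous_onI[OF continuous_character])

lemma borel_measurable_character_lebesgue [measurable]: "character k \<in> borel_measurable lebesgue"
  using measurable_completion[of "character k" lborel borel] by simp

lemma borel_measurable_character_torus [measurable]: "character k \<in> borel_measurable (lebesgue_on torus)"
  by (rule measurable_restrict_space1) measurable

text \<open>The counterpart of translation on the transform side: since translation is written as
  \<open>f (x + k)\<close>, the exponent of \<open>character\<close> carries a positive
  sign.\<close>

definition modulate :: "int ^ 'n \<Rightarrow> (real ^ 'n \<Rightarrow> complex) \<Rightarrow> real ^ 'n \<Rightarrow> complex" where
  "modulate k f = (\<lambda>x. character k x * f x)"

lemma modulate_L2 [intro]: "f \<in> L2 lebesgue \<Longrightarrow> modulate k f \<in> L2 lebesgue"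
  by (auto simp: L2_def modulate_def norm_mult)

text \<open>Characters are periodic, so a modulation multiplies a whole fiber by one scalar. This is
  why a modulation-invariant space can be described by one subspace at each point of the
  torus.\<close>

lemma lattice_fiber_modulate: "lattice_fiber (modulate k f) x = cscale (character k x) (lattice_fiber f x)"
  by (simp add: lattice_fiber_def modulate_def fun_eq_iff character_periodic)

lemma L2_inner_modulate: "L2_inner lebesgue (modulate l f) (modulate k g) = L2_inner lebesgue f (modulate (k - l) g)"
proof -
  have "character l x * f x * cnj (character k x * g x) = f x * cnj (character (k - l) x * g x)" for x
    using character_add[of k "- l" x] by (simp add: character_minus mult_ac)
  then show ?thesis by (simp only: L2_inner_def modulate_def)
qed

text \<open>A translate of the cell is again a fundamental domain: for each \<open>x\<close> exactly
  one lattice vector, \<open>- floor_vec (x - c)\<close>, moves \<open>x\<close> into it, and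
  periodicity makes the value there equal to \<open>g x\<close>.\<close>

lemma integral_torus_shift:
  fixes g :: "real ^ 'n \<Rightarrow> complex"
  assumes g: "g \<in> borel_measurable lebesgue" and bd: "\<And>x. cmod (g x) \<le> C" and per: "\<And>x k. g (x + lattice_vec k) = g x"
  shows "(\<integral>x. g (x + c) \<partial>lebesgue_on torus) = (\<integral>x. g x \<partial>lebesgue_on torus)"
proof -
  let ?f = "\<lambda>x. indicator torus (x + - c) *\<^sub>R g x"
  have i: "integrable lebesgue ?f"
  proof -
    have "(\<lambda>x. indicator torus x *\<^sub>R g (x + c)) \<in> borel_measurable lebesgue"
      by (intro borel_measurable_scaleR borel_measurable_indicator torus_lebesgue measurable_compose[OF measurable_lebesgue_plus' g])
    moreover have "integrable lebesgue (\<lambda>x. C *\<^sub>R (indicator torus x :: real))"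
      by (intro integrable_scaleR_right integrable_real_indicator) (simp_all add: emeasure_torus)
    moreover have "0 \<le> C" using bd[of 0] norm_ge_zero order_trans by blast
    ultimately have *: "integrable lebesgue (\<lambda>x. indicator torus x *\<^sub>R g (x + c))"
      by (rule_tac Bochner_Integration.integrable_bound[where f="\<lambda>x. C *\<^sub>R (indicator torus x :: real)"])
        (auto simp: indicator_def bd)
    have fm: "?f \<in> borel_measurable lebesgue"
      by (intro borel_measurable_scaleR g measurable_compose[OF measurable_lebesgue_plus' borel_measurable_indicator] torus_lebesgue)
    show ?thesis
      using integrable_distr_eq[OF measurable_lebesgue_plus'[of c] fm] * by (simp add: distr_lebesgue_plus')
  qed
  have "(\<integral>x. g (x + c) \<partial>lebesgue_on torus) = (\<integral>x. indicator torus x *\<^sub>R g (x + c) \<partial>lebesgue)"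
    by (simp add: integral_restrict_space)
  also have "\<dots> = (\<integral>x. ?f x \<partial>distr lebesgue lebesgue (\<lambda>x. x + c))"
    using i by (subst integral_distr) auto
  also have "\<dots> = (\<integral>x. ?f x \<partial>lebesgue)" by (simp add: distr_lebesgue_plus')
  also have "\<dots> = (\<integral>x. \<integral>k. ?f (x + lattice_vec k) \<partial>count_space UNIV \<partial>lebesgue_on torus)"
    by (rule integral_lebesgue_torus(3)[OF i])
  also have "\<dots> = (\<integral>x. g x \<partial>lebesgue_on torus)"
  proof (rule Bochner_Integration.integral_cong[OF refl])
    fix x :: "real ^ 'n"
    let ?k = "- floor_vec (x - c)"
    have "x + lattice_vec k + - c \<in> torus \<longleftrightarrow> k = ?k" for k
    proof -
      have "x + lattice_vec k + - c = (x - c) - lattice_vec (- k)" by (simp add: lattice_vec_minus)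
      then have "x + lattice_vec k + - c \<in> torus \<longleftrightarrow> - k = floor_vec (x - c)" by (simp only: floor_vec_unique)
      then show ?thesis by (simp only: minus_equation_iff[of k] eq_commute[of _ k])
    qed
    then have "(\<lambda>k. ?f (x + lattice_vec k)) = (\<lambda>k. indicator {?k} k *\<^sub>R g x)"
      by (simp only: indicator_def per singleton_iff)
    then show "(\<integral>k. ?f (x + lattice_vec k) \<partial>count_space UNIV) = g x" by simp
  qed
  finally show ?thesis .
qed

lemma integral_character:
  "(\<integral>x. character k x \<partial>lebesgue_on (torus :: (real ^ 'n) set)) = (if k = 0 then 1 else 0)"
proof (cases "k = 0")
  case True
  interpret T: prob_space "lebesgue_on (torus :: (real ^ 'n) set)" by (rule prob_space_torus)
  show ?thesis using True T.prob_space by simp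
next
  case False
  then obtain i where i: "k $ i \<noteq> 0" by (auto simp: vec_eq_iff)
  \<comment> \<open>Half a period in a coordinate where \<open>k\<close> is nonzero: the character
    takes the value -1 at \<open>c\<close>, so translation by \<open>c\<close> shows that the
    integral is its own negative.\<close>
  define c :: "real ^ 'n" where "c = axis i (1 / (2 * of_int (k $ i)))"
  have "lattice_vec k \<bullet> c = 1 / 2" using i by (simp add: c_def inner_axis)
  then have "complex_of_real (lattice_vec k \<bullet> c) = 1 / 2" by (simp only:) simp
  then have c: "character k c = -1" unfolding character_def by (simp only:) (simp add: exp_pi_i')
  have "(\<integral>x. character k x \<partial>lebesgue_on torus) = (\<integral>x. character k (x + c) \<partial>lebesgue_on torus)"
    by (rule integral_torus_shift[symmetric, where C=1]) (auto simp: character_periodic)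
  also have "\<dots> = - (\<integral>x. character k x \<partial>lebesgue_on torus)"
    by (simp add: character_plus c)
  finally have "(\<integral>x. character k x \<partial>lebesgue_on torus) = 0"
    by (simp add: eq_neg_iff_add_eq_0)
  then show ?thesis using False by simp
qed

section \<open>Trigonometric polynomials\<close>

lemma subspace_mult_preimage:
  assumes A: "cfun.subspace A" shows "cfun.subspace {f. (\<lambda>x. f x * g x) \<in> A}"
  unfolding cfun.subspace_def
proof (intro conjI ballI allI)
  show "0 \<in> {f. (\<lambda>x. f x * g x) \<in> A}"
    using cfun.subspace_0[OF A] by (simp add: zero_fun_def)
  fix u v assume "u \<in> {f. (\<lambda>x. f x * g x) \<in> A}" "v \<in> {f. (\<lambda>x. f x * g x) \<in> A}"
  then have "(\<lambda>x. u x * g x) + (\<lambda>x. v x * g x) \<in> A" by (intro cfun.subspace_add[OF A]) auto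
  moreover have "(\<lambda>x. u x * g x) + (\<lambda>x. v x * g x) = (\<lambda>x. (u + v) x * g x)"
    by (simp add: fun_eq_iff distrib_right)
  ultimately show "u + v \<in> {f. (\<lambda>x. f x * g x) \<in> A}" by simp
next
  fix c u assume "u \<in> {f. (\<lambda>x. f x * g x) \<in> A}"
  then have "cscale c (\<lambda>x. u x * g x) \<in> A" by (intro cfun.subspace_scale[OF A]) auto
  moreover have "cscale c (\<lambda>x. u x * g x) = (\<lambda>x. cscale c u x * g x)" by (simp add: fun_eq_iff)
  ultimately show "cscale c u \<in> {f. (\<lambda>x. f x * g x) \<in> A}" by simp
qed

lemma span_characters_mult:
  assumes f: "f \<in> cfun.span (range character)" and g: "g \<in> cfun.span (range (character :: int ^ 'n \<Rightarrow> _))"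
  shows "(\<lambda>x. f x * g x) \<in> cfun.span (range character)"
  using f
proof (induction rule: cfun.span_induct)
  show "cfun.subspace {f. (\<lambda>x. f x * g x) \<in> cfun.span (range character)}"
    by (rule subspace_mult_preimage[OF cfun.subspace_span])
  fix f assume "f \<in> range (character :: int ^ 'n \<Rightarrow> _)"
  then obtain k where k: "f = character k" by auto
  have "(\<lambda>x. g x * character k x) \<in> cfun.span (range character)"
    using g
  proof (induction rule: cfun.span_induct)
    show "cfun.subspace {g. (\<lambda>x. g x * character k x) \<in> cfun.span (range character)}"
      by (rule subspace_mult_preimage[OF cfun.subspace_span])
    fix g assume "g \<in> range (character :: int ^ 'n \<Rightarrow> _)"
    then obtain l where "g = character l" by auto
    then have "(\<lambda>x. g x * character k x) = character (l + k)" by (simp add: fun_eq_iff character_add)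
    then show "(\<lambda>x. g x * character k x) \<in> cfun.span (range character)" by (simp add: cfun.span_base)
  qed
  then show "(\<lambda>x. f x * g x) \<in> cfun.span (range character)" by (simp only: k mult.commute)
qed

text \<open>Opposite faces of the cube are identified, and the image of the closed cube is a compact
  set in a Euclidean space, on which real polynomials are trigonometric polynomials. This puts the
  approximation of periodic functions within reach of Stone-Weierstrass.\<close>

definition torus_embed :: "real ^ 'n \<Rightarrow> complex ^ 'n" where
  "torus_embed x = (\<chi> i. cis (2 * pi * x $ i))"

lemma character_axis: "character (axis i 1) x = cis (2 * pi * x $ i)"
proof -
  have "lattice_vec (axis i 1) = axis i (1 :: real)" by (simp add: vec_eq_iff axis_def)
  then show ?thesis by (simp add: character_def inner_axis' cis_conv_exp mult_ac)
qed

text \<open>The coordinates of the embedded point are cosines and sines, which are combinations of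
  the two characters to \<open>axis i 1\<close> and its negative; products stay in the span because
  characters multiply to characters.\<close>

lemma polynomial_torus_span:
  assumes "real_polynomial_function p"
  shows "(\<lambda>x :: real ^ 'n. complex_of_real (p (torus_embed x))) \<in> cfun.span (range character)"
  using assms
proof (induction rule: real_polynomial_function.induct)
  case (linear p)
  interpret bounded_linear p by fact
  \<comment> \<open>Euler's formulas in one expression: the test \<open>b $ i = 1\<close> singles
    out the real direction with its cosine, weights 1/2 and 1/2, while the imaginary direction has
    the sine, with weights of opposite sign.\<close>
  have e: "complex_of_real (torus_embed x \<bullet> b) = (\<Sum>z\<in>{1, -1 :: int}. (if b $ i = 1 then 1/2 else of_int z / (2 * \<i>)) * character (axis i z) x)"
    if b: "b = axis i u" "u \<in> Basis" for b i u and x :: "real ^ 'n"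
  proof -
    let ?t = "2 * pi * x $ i"
    have "axis i (-1 :: int) = - axis i 1" by (simp add: vec_eq_iff axis_def)
    then have m: "character (axis i (-1)) x = cnj (cis ?t)"
      by (simp only: character_minus character_axis)
    have bi: "b $ i = u" by (simp add: b(1))
    have "torus_embed x \<bullet> b = cis ?t \<bullet> u" unfolding b(1) inner_axis by (simp add: torus_embed_def)
    moreover have "u = 1 \<or> u = \<i>" using b(2) by (auto simp: Basis_complex_def)
    ultimately show ?thesis
      by (elim disjE) (simp_all add: m character_axis bi complex_eq_iff)
  qed
  have "(\<lambda>x. complex_of_real (torus_embed x \<bullet> b)) \<in> cfun.span (range character)" if bB: "b \<in> Basis" for b :: "complex ^ 'n"
  proof -
    obtain i u where b: "b = axis i u" "u \<in> Basis" using bB unfolding Basis_vec_def by blast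
    have "(\<lambda>x. complex_of_real (torus_embed x \<bullet> b))
      = (\<Sum>z\<in>{1, -1 :: int}. cscale (if b $ i = 1 then 1/2 else of_int z / (2 * \<i>)) (character (axis i z)))"
      by (rule ext) (simp only: e[OF b] sum_fun_eval cscale_apply)
    also have "\<dots> \<in> cfun.span (range character)"
      by (intro cfun.span_sum cfun.span_scale cfun.span_base) auto
    finally show ?thesis .
  qed
  then have "(\<Sum>b\<in>Basis. cscale (of_real (p b)) (\<lambda>x. complex_of_real (torus_embed x \<bullet> b))) \<in> cfun.span (range character)"
    by (intro cfun.span_sum cfun.span_scale)
  moreover have "p (torus_embed x) = (\<Sum>b\<in>Basis. (torus_embed x \<bullet> b) * p b)" for x :: "real ^ 'n"
    by (subst euclidean_representation[symmetric]) (simp add: sum scaleR)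
  then have "(\<Sum>b\<in>Basis. cscale (of_real (p b)) (\<lambda>x :: real ^ 'n. complex_of_real (torus_embed x \<bullet> b))) = (\<lambda>x. complex_of_real (p (torus_embed x)))"
    by (intro ext) (simp add: sum_fun_eval mult.commute)
  ultimately show ?case by (simp only:)
next
  case (const c)
  have "cscale (of_real c) (character 0) \<in> cfun.span (range (character :: int ^ 'n \<Rightarrow> _))" by (intro cfun.span_scale cfun.span_base) auto
  moreover have "cscale (of_real c) (character 0) = (\<lambda>x :: real ^ 'n. complex_of_real c)" by (simp add: fun_eq_iff)
  ultimately show ?case by (simp only:)
next
  case (add f g)
  from cfun.span_add[OF add.IH] show ?case by (simp only: plus_fun_def of_real_add)
next
  case (mult f g)
  from span_characters_mult[OF mult.IH] show ?case by (simp only: of_real_mult)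
qed


lemma span_characters_bounded:
  fixes g :: "real ^ 'n \<Rightarrow> complex"
  assumes "g \<in> cfun.span (range character)"
  shows "\<exists>C. \<forall>x. cmod (g x) \<le> C" "g \<in> borel_measurable borel"
proof -
  let ?S = "{g :: real ^ 'n \<Rightarrow> complex. (\<exists>C. \<forall>x. cmod (g x) \<le> C) \<and> g \<in> borel_measurable borel}"
  have "(\<exists>C. \<forall>x. cmod (g x) \<le> C) \<and> g \<in> borel_measurable borel"
    using assms
  proof (induction rule: cfun.span_induct)
    show "cfun.subspace ?S"
      unfolding cfun.subspace_def
    proof (intro conjI ballI allI)
      show "0 \<in> ?S" by (auto simp: zero_fun_def)
      fix u v assume u: "u \<in> ?S"
        and v: "v \<in> ?S"
      from u v obtain C D where "\<forall>x. cmod (u x) \<le> C" "\<forall>x. cmod (v x) \<le> D" by blast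
      then have "\<forall>x. cmod ((u + v) x) \<le> C + D" by (auto intro: order_trans[OF norm_triangle_ineq] add_mono)
      then show "u + v \<in> ?S"
        using u v by (auto simp: plus_fun_def)
    next
      fix c u assume u: "u \<in> ?S"
      then obtain C where "\<forall>x. cmod (u x) \<le> C" by blast
      then have "\<forall>x. cmod (cscale c u x) \<le> cmod c * C" by (simp add: norm_mult mult_left_mono)
      then show "cscale c u \<in> ?S"
        using u by (auto simp: cscale_def)
    qed
    fix g assume "g \<in> range (character :: int ^ 'n \<Rightarrow> real ^ 'n \<Rightarrow> complex)"
    then show "(\<exists>C. \<forall>x. cmod (g x) \<le> C) \<and> g \<in> borel_measurable borel" by (auto intro: exI[of _ 1])
  qed
  then show "\<exists>C. \<forall>x. cmod (g x) \<le> C" "g \<in> borel_measurable borel" by auto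
qed

section \<open>Uniqueness of Fourier coefficients\<close>

lemma integrable_bounded_mult:
  fixes f g :: "'a \<Rightarrow> complex"
  assumes f: "integrable M f" and g: "g \<in> borel_measurable M" and b: "\<And>x. x \<in> space M \<Longrightarrow> cmod (g x) \<le> C"
  shows "integrable M (\<lambda>x. f x * g x)"
proof (rule Bochner_Integration.integrable_bound)
  show "integrable M (\<lambda>x. C *\<^sub>R f x)" using f by simp
  show "(\<lambda>x. f x * g x) \<in> borel_measurable M" using f g by auto
  have "norm (f x * g x) \<le> norm (C *\<^sub>R f x)" if "x \<in> space M" for x
  proof -
    have "cmod (f x) * cmod (g x) \<le> cmod (f x) * \<bar>C\<bar>" using b[OF that] by (intro mult_left_mono) auto
    then show ?thesis by (simp add: norm_mult mult.commute)
  qed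
  then show "AE x in M. norm (f x * g x) \<le> norm (C *\<^sub>R f x)" by (intro AE_I2)
qed

lemma integrable_torus_bounded_mult:
  fixes h :: "real ^ 'n \<Rightarrow> complex"
  assumes h: "integrable (lebesgue_on torus) h" and g: "g \<in> borel_measurable borel" and b: "\<And>x. x \<in> torus \<Longrightarrow> cmod (g x) \<le> C"
  shows "integrable (lebesgue_on torus) (\<lambda>x. h x * g x)"
proof (rule integrable_bounded_mult[OF h])
  have "g \<in> borel_measurable lebesgue" using measurable_completion[of g lborel borel] g by simp
  then show "g \<in> borel_measurable (lebesgue_on torus)" by (rule measurable_restrict_space1)
  show "cmod (g x) \<le> C" if "x \<in> space (lebesgue_on torus)" for x
    using b that by (simp add: space_restrict_space)
qed

lemma orthogonal_span_characters:
  fixes h :: "real ^ 'n \<Rightarrow> complex"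
  assumes h: "integrable (lebesgue_on torus) h" and 0: "\<And>k. (\<integral>x. h x * character k x \<partial>lebesgue_on torus) = 0"
    and g: "g \<in> cfun.span (range character)"
  shows "(\<integral>x. h x * g x \<partial>lebesgue_on torus) = 0"
proof -
  \<comment> \<open>Membership in the span is carried along in the induction because it yields the
    boundedness, and thereby the integrability, on which additivity of the integral rests.\<close>
  let ?S = "{g. g \<in> cfun.span (range character) \<and> (\<integral>x. h x * g x \<partial>lebesgue_on torus) = 0}"
  have i: "integrable (lebesgue_on torus) (\<lambda>x. h x * u x)" if u: "u \<in> cfun.span (range character)" for u
    using integrable_torus_bounded_mult[OF h span_characters_bounded(2)[OF u]] span_characters_bounded(1)[OF u] by blast
  from g have "g \<in> cfun.span (range character) \<and> (\<integral>x. h x * g x \<partial>lebesgue_on torus) = 0"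
  proof (induction rule: cfun.span_induct)
    show "cfun.subspace ?S"
      unfolding cfun.subspace_def
    proof (intro conjI ballI allI)
      fix u v assume u: "u \<in> ?S"
        and v: "v \<in> ?S"
      then have uv: "u \<in> cfun.span (range character)" "v \<in> cfun.span (range character)" by auto
      have "(\<integral>x. h x * (u + v) x \<partial>lebesgue_on torus) = (\<integral>x. h x * u x \<partial>lebesgue_on torus) + (\<integral>x. h x * v x \<partial>lebesgue_on torus)"
        unfolding plus_fun_apply distrib_left by (rule Bochner_Integration.integral_add[OF i[OF uv(1)] i[OF uv(2)]])
      then show "u + v \<in> ?S"
        using u v by (simp only: mem_Collect_eq cfun.span_add) simp
    next
      fix c u assume u: "u \<in> ?S"
      have "(\<integral>x. h x * cscale c u x \<partial>lebesgue_on torus) = c * (\<integral>x. h x * u x \<partial>lebesgue_on torus)"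
        by (simp add: mult.left_commute)
      then show "cscale c u \<in> ?S"
        using u by (simp only: mem_Collect_eq cfun.span_scale) simp
    qed (simp add: cfun.span_zero)
    fix g assume "g \<in> range (character :: int ^ 'n \<Rightarrow> real ^ 'n \<Rightarrow> complex)"
    then show "g \<in> cfun.span (range character) \<and> (\<integral>x. h x * g x \<partial>lebesgue_on torus) = 0"
      using 0 cfun.span_base by blast
  qed
  then show ?thesis by blast
qed

lemma continuous_torus_embed: "continuous_on S (torus_embed :: real ^ 'n \<Rightarrow> _)"
  unfolding torus_embed_def by (intro continuous_intros)

text \<open>The coordinates differ by integers, and by less than 1 because \<open>x\<close> keeps
  away from the faces of the cube.\<close>

lemma torus_embed_eq_interior:
  fixes x y :: "real ^ 'n"
  assumes "torus_embed x = torus_embed y" "x \<in> box 0 1" "y \<in> cbox 0 1" shows "x = y"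
proof -
  have "x $ i = y $ i" for i
  proof -
    have b: "0 < x $ i" "x $ i < 1" "0 \<le> y $ i" "y $ i \<le> 1" using assms(2,3) by (auto simp: mem_box_cart)
    have "cis (2 * pi * x $ i) = cis (2 * pi * y $ i)" using assms(1) by (simp add: torus_embed_def vec_eq_iff)
    then have "cis (2 * pi * (x $ i - y $ i)) = 1"
      by (simp add: right_diff_distrib cis_divide[symmetric])
    then have "cos (2 * pi * (x $ i - y $ i)) = 1" by (metis cis.sel(1) one_complex.sel(1))
    then obtain n :: int where "2 * pi * (x $ i - y $ i) = of_int n * 2 * pi"
      using cos_one_2pi_int by blast
    then have "x $ i - y $ i = of_int n" by simp
    moreover have "\<bar>x $ i - y $ i\<bar> < 1" using b by linarith
    ultimately have "n = 0" by linarith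
    then show ?thesis using \<open>x $ i - y $ i = of_int n\<close> by simp
  qed
  then show ?thesis by (simp add: vec_eq_iff)
qed

text \<open>By Stone-Weierstrass on the embedded cube, \<open>f\<close> is uniformly close to a
  polynomial. Pulled back to the torus, this is a trigonometric polynomial, whose integral against
  \<open>h\<close> vanishes, and the error is at most the tolerance times the \<open>L1\<close> norm
  of \<open>h\<close>.\<close>

lemma integral_continuous_torus_zero:
  fixes h :: "real ^ 'n \<Rightarrow> complex"
  assumes h: "integrable (lebesgue_on torus) h" and 0: "\<And>k. (\<integral>x. h x * character k x \<partial>lebesgue_on torus) = 0"
    and f: "continuous_on UNIV (f :: complex ^ 'n \<Rightarrow> real)"
  shows "(\<integral>x. h x * of_real (f (torus_embed x)) \<partial>lebesgue_on torus) = 0"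
proof -
  let ?S = "torus_embed ` cbox 0 (1 :: real ^ 'n)"
  let ?I = "\<integral>x. h x * of_real (f (torus_embed x)) \<partial>lebesgue_on torus"
  have S: "compact ?S" by (intro compact_continuous_image continuous_torus_embed compact_cbox)
  have inS: "torus_embed x \<in> ?S" if "x \<in> torus" for x using that box_torus(2) by blast
  have contf: "continuous_on UNIV (\<lambda>x. complex_of_real (f (torus_embed x)))"
    by (intro continuous_intros continuous_on_compose2[OF f continuous_torus_embed]) auto
  have "compact (f ` ?S)" by (intro compact_continuous_image S continuous_on_subset[OF f]) auto
  then obtain B where B: "\<And>z. z \<in> ?S \<Longrightarrow> \<bar>f z\<bar> \<le> B" by (meson bounded_real compact_imp_bounded imageI)
  have i1: "integrable (lebesgue_on torus) (\<lambda>x. h x * of_real (f (torus_embed x)))"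
    by (rule integrable_torus_bounded_mult[OF h borel_measurable_continuous_onI[OF contf], of B]) (use B inS in auto)
  let ?H = "\<integral>x. cmod (h x) \<partial>lebesgue_on torus"
  have "cmod ?I \<le> e * ?H" if e: "0 < e" for e
  proof -
    obtain p where p: "real_polynomial_function p" "\<And>z. z \<in> ?S \<Longrightarrow> \<bar>f z - p z\<bar> < e"
      by (rule Stone_Weierstrass_real_polynomial_function[OF S continuous_on_subset[OF f] e]) auto
    let ?p = "\<lambda>x. complex_of_real (p (torus_embed x))"
    have ps: "?p \<in> cfun.span (range character)" by (rule polynomial_torus_span[OF p(1)])
    obtain C where C: "\<And>x. cmod (?p x) \<le> C" using span_characters_bounded(1)[OF ps] by blast
    have i2: "integrable (lebesgue_on torus) (\<lambda>x. h x * ?p x)"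
      by (rule integrable_torus_bounded_mult[OF h span_characters_bounded(2)[OF ps] C])
    have "?I = ?I - (\<integral>x. h x * ?p x \<partial>lebesgue_on torus)" using orthogonal_span_characters[OF h 0 ps] by simp
    also have "\<dots> = (\<integral>x. h x * of_real (f (torus_embed x)) - h x * ?p x \<partial>lebesgue_on torus)"
      by (rule Bochner_Integration.integral_diff[OF i1 i2, symmetric])
    finally have "cmod ?I = cmod (\<integral>x. h x * of_real (f (torus_embed x)) - h x * ?p x \<partial>lebesgue_on torus)" by simp
    also have "\<dots> \<le> (\<integral>x. cmod (h x * of_real (f (torus_embed x)) - h x * ?p x) \<partial>lebesgue_on torus)"
      by (rule integral_norm_bound)
    also have "\<dots> \<le> (\<integral>x. e * cmod (h x) \<partial>lebesgue_on torus)"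
    proof (rule integral_mono)
      show "integrable (lebesgue_on torus) (\<lambda>x. cmod (h x * of_real (f (torus_embed x)) - h x * ?p x))"
        by (intro integrable_norm Bochner_Integration.integrable_diff i1 i2)
      show "integrable (lebesgue_on torus) (\<lambda>x. e * cmod (h x))" using h by simp
      fix x :: "real ^ 'n" assume "x \<in> space (lebesgue_on torus)"
      then have x: "x \<in> torus" by (simp add: space_restrict_space)
      have "h x * of_real (f (torus_embed x)) - h x * ?p x = h x * of_real (f (torus_embed x) - p (torus_embed x))"
        by (simp add: right_diff_distrib)
      then have "cmod (h x * of_real (f (torus_embed x)) - h x * ?p x) = cmod (h x) * \<bar>f (torus_embed x) - p (torus_embed x)\<bar>"
        by (simp only: norm_mult norm_of_real)
      also have "\<dots> \<le> cmod (h x) * e" using p(2)[OF inS[OF x]] by (intro mult_left_mono) auto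
      finally show "cmod (h x * of_real (f (torus_embed x)) - h x * ?p x) \<le> e * cmod (h x)" by (simp add: mult.commute)
    qed
    also have "\<dots> = e * ?H" by simp
    finally show ?thesis .
  qed note bound = this
  have "cmod ?I \<le> 0"
  proof (rule field_le_epsilon)
    fix e :: real assume e: "0 < e"
    have H: "0 \<le> ?H" by simp
    \<comment> \<open>The norm \<open>?H\<close> may be 0; adding 1 keeps the denominator
      positive.\<close>
    have "cmod ?I \<le> e / (?H + 1) * ?H" by (rule bound) (use e H in \<open>simp add: add_nonneg_pos\<close>)
    also have "e / (H + 1) * H \<le> e" if "0 \<le> H" for H :: real
      using that e by (simp add: field_simps)
    note this[OF H]
    finally show "cmod ?I \<le> 0 + e" by simp
  qed
  then show ?thesis by simp
qed

text \<open>For \<open>B\<close> open in the open unit cube, the indicator of \<open>B\<close> is the limit of functions of the distance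
  from the image of the point \<open>x\<close> to the compact image of the complement of \<open>B\<close>. This image does not meet
  that of \<open>B\<close>, as only boundary points of the cube are identified.\<close>

lemma fourier_coefficients_zero:
  fixes h :: "real ^ 'n \<Rightarrow> complex"
  assumes h: "integrable (lebesgue_on torus) h" and 0: "\<And>k. (\<integral>x. h x * character k x \<partial>lebesgue_on torus) = 0"
  shows "AE x in lebesgue_on torus. h x = 0"
proof -
  have box0: "(\<integral>x. h x * cind B x \<partial>lebesgue_on torus) = 0" if B: "open B" "B \<subseteq> box 0 1" for B :: "(real ^ 'n) set"
  proof -
    let ?C = "torus_embed ` (cbox 0 1 - B)"
    have C: "compact ?C" using B(1)
      by (intro compact_continuous_image continuous_torus_embed) (simp add: compact_diff)
    \<comment> \<open>The distance to the empty set is 0 by convention, so \<open>?C\<close> has to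
      be nonempty for a positive \<open>infdist\<close>; the corner 0 lies outside the open cube and
      hence outside \<open>B\<close>.\<close>
    have "0 \<in> cbox 0 1 - B" using B(2) by (auto simp: mem_box_cart)
    then have ne: "?C \<noteq> {}" by blast
    define f where "f n z = min 1 (real n * infdist z ?C)" for n z
    have fz: "f n (torus_embed x) = 0" if "x \<in> torus" "x \<notin> B" for n x
    proof -
      have "torus_embed x \<in> ?C" using that box_torus(2) by blast
      then show ?thesis by (simp add: f_def infdist_zero)
    qed
    have f1: "(\<lambda>n. f n (torus_embed x)) \<longlonglongrightarrow> 1" if "x \<in> B" for x
    proof -
      have "torus_embed x \<notin> ?C" using that B(2) torus_embed_eq_interior[of x] by auto
      then have d: "0 < infdist (torus_embed x) ?C"
        using infdist_pos_not_in_closed[OF compact_imp_closed[OF C] ne] by blast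
      then obtain N where N: "1 < real N * infdist (torus_embed x) ?C" using ex_less_of_nat_mult by blast
      have "f n (torus_embed x) = 1" if "n \<ge> N" for n
      proof -
        have "real N * infdist (torus_embed x) ?C \<le> real n * infdist (torus_embed x) ?C"
          using that d by (intro mult_right_mono) auto
        then show ?thesis using N by (simp add: f_def)
      qed
      then have "\<forall>\<^sub>F n in sequentially. f n (torus_embed x) = 1" by (auto simp: eventually_sequentially)
      then show ?thesis by (rule tendsto_eventually)
    qed
    have cf: "continuous_on UNIV (f n)" for n unfolding f_def by (intro continuous_intros)
    have f0: "(\<integral>x. h x * of_real (f n (torus_embed x)) \<partial>lebesgue_on torus) = 0" for n
      by (rule integral_continuous_torus_zero[OF h 0 cf])
    have fb: "\<bar>f n z\<bar> \<le> 1" for n z by (simp add: f_def infdist_nonneg)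
    have "(\<lambda>n. \<integral>x. h x * of_real (f n (torus_embed x)) \<partial>lebesgue_on torus) \<longlonglongrightarrow> (\<integral>x. h x * cind B x \<partial>lebesgue_on torus)"
    proof (rule integral_dominated_convergence)
      show "integrable (lebesgue_on torus) (\<lambda>x. cmod (h x))" using h by simp
      have "cind B \<in> borel_measurable borel" unfolding cind_def[abs_def]
        by (rule measurable_compose[OF borel_measurable_indicator]) (use B(1) in auto)
      then show "(\<lambda>x. h x * cind B x) \<in> borel_measurable (lebesgue_on torus)"
        by (rule borel_measurable_integrable[OF integrable_torus_bounded_mult[OF h, of _ 1]]) (simp add: cind_def indicator_def)
      show "(\<lambda>x. h x * of_real (f n (torus_embed x))) \<in> borel_measurable (lebesgue_on torus)" for n
        by (intro borel_measurable_integrable integrable_torus_bounded_mult[OF h, of _ 1] borel_measurable_continuous_onI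
            continuous_intros continuous_on_compose2[OF cf continuous_torus_embed]) (auto simp: fb)
      show "AE x in lebesgue_on torus. (\<lambda>n. h x * of_real (f n (torus_embed x))) \<longlonglongrightarrow> h x * cind B x"
      proof (rule AE_I2)
        fix x :: "real ^ 'n" assume "x \<in> space (lebesgue_on torus)"
        then have x: "x \<in> torus" by (simp add: space_restrict_space)
        show "(\<lambda>n. h x * of_real (f n (torus_embed x))) \<longlonglongrightarrow> h x * cind B x"
        proof (cases "x \<in> B")
          case True
          have "(\<lambda>n. h x * of_real (f n (torus_embed x))) \<longlonglongrightarrow> h x * of_real 1"
            by (intro tendsto_intros f1[OF True])
          then show ?thesis using True by (simp add: cind_def)
        qed (simp add: fz[OF x] cind_def)
      qed
      show "AE x in lebesgue_on torus. norm (h x * of_real (f n (torus_embed x))) \<le> cmod (h x)" for n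
        by (intro AE_I2) (simp add: norm_mult fb mult_left_le)
    qed
    then show ?thesis using f0 by (simp add: LIMSEQ_const_iff)
  qed
  have hb: "integrable lebesgue (\<lambda>x. indicator torus x *\<^sub>R h x)"
    using h by (simp add: integrable_restrict_space)
  have "AE x in lebesgue. indicator (box 0 1) x *\<^sub>R h x = 0"
  proof (rule integrable_zero_on_rat_boxes)
    have e: "indicator (box 0 1) x *\<^sub>R h x = indicator (box 0 1) x *\<^sub>R (indicator torus x *\<^sub>R h x)" for x
      using box_torus(1) by (auto simp: indicator_def)
    show "integrable lebesgue (\<lambda>x. indicator (box 0 1) x *\<^sub>R h x)"
      unfolding e by (rule integrable_mult_indicator[OF _ hb]) simp
    fix B :: "(real ^ 'n) set" assume "B \<in> rat_boxes"
    then have B: "open (B \<inter> box 0 1)" by (auto simp: rat_boxes_def)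
    have "(\<integral>x. indicator B x *\<^sub>R (indicator (box 0 1) x *\<^sub>R h x) \<partial>lebesgue)
      = (\<integral>x. indicator torus x *\<^sub>R (h x * cind (B \<inter> box 0 1) x) \<partial>lebesgue)"
      using box_torus(1) by (intro Bochner_Integration.integral_cong) (auto simp: indicator_def cind_def)
    also have "\<dots> = (\<integral>x. h x * cind (B \<inter> box 0 1) x \<partial>lebesgue_on torus)"
      by (simp add: integral_restrict_space)
    finally show "(\<integral>x. indicator B x *\<^sub>R (indicator (box 0 1) x *\<^sub>R h x) \<partial>lebesgue) = 0"
      using box0[OF B] by simp
  qed
  \<comment> \<open>Testing on boxes has dealt with the open cube; the faces, which the half-open
    cell contains in part, form a null set.\<close>
  moreover have "AE x in lebesgue. x \<notin> cbox 0 1 - box (0 :: real ^ 'n) 1"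
    using negligible_frontier_interval[of 0 "1 :: real ^ 'n"] unfolding negligible_iff_null_sets by (rule AE_not_in)
  ultimately have "AE x in lebesgue. x \<in> torus \<longrightarrow> h x = 0"
  proof eventually_elim
    case (elim x)
    then show ?case using box_torus(2) by (auto simp: indicator_def split: if_splits)
  qed
  then show ?thesis by (simp add: AE_torus_iff)
qed

text \<open>The constant function \<open>c\<close> has coefficient \<open>c\<close> at
  \<open>k = 0\<close> and 0 elsewhere, so subtracting it from \<open>h\<close> leaves a function
  all of whose coefficients vanish.\<close>

lemma fourier_coefficients_const:
  fixes h :: "real ^ 'n \<Rightarrow> complex"
  assumes h: "integrable (lebesgue_on torus) h"
  shows "(\<forall>k. (\<integral>x. h x * character k x \<partial>lebesgue_on torus) = (if k = 0 then c else 0))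
    \<longleftrightarrow> (AE x in lebesgue_on torus. h x = c)"
proof -
  interpret T: prob_space "lebesgue_on (torus :: (real ^ 'n) set)" by (rule prob_space_torus)
  have ic: "integrable (lebesgue_on torus) (\<lambda>x. c * character k x)" for k :: "int ^ 'n"
    by (intro integrable_torus_bounded_mult[of "\<lambda>_. c" _ 1] T.integrable_const) auto
  have ih: "integrable (lebesgue_on torus) (\<lambda>x. h x * character k x)" for k
    by (intro integrable_torus_bounded_mult[OF h, of _ 1]) auto
  have cc: "(\<integral>x. c * character k x \<partial>lebesgue_on torus) = (if k = 0 then c else 0)" for k
    by (simp add: integral_character)
  show ?thesis
  proof
    assume *: "\<forall>k. (\<integral>x. h x * character k x \<partial>lebesgue_on torus) = (if k = 0 then c else 0)"
    have "AE x in lebesgue_on torus. h x - c = 0"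
    proof (rule fourier_coefficients_zero)
      show "(\<integral>x. (h x - c) * character k x \<partial>lebesgue_on torus) = 0" for k
        unfolding left_diff_distrib Bochner_Integration.integral_diff[OF ih ic] cc using * by simp
    qed (use h in simp)
    then show "AE x in lebesgue_on torus. h x = c" by simp
  next
    assume *: "AE x in lebesgue_on torus. h x = c"
    show "\<forall>k. (\<integral>x. h x * character k x \<partial>lebesgue_on torus) = (if k = 0 then c else 0)"
    proof
      fix k
      have "(\<integral>x. h x * character k x \<partial>lebesgue_on torus) = (\<integral>x. c * character k x \<partial>lebesgue_on torus)"
        by (rule integral_cong_AE[OF borel_measurable_integrable[OF ih] borel_measurable_integrable[OF ic]])
          (use * in auto)
      then show "(\<integral>x. h x * character k x \<partial>lebesgue_on torus) = (if k = 0 then c else 0)" unfolding cc .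
    qed
  qed
qed

text \<open>Up to the sign of \<open>k\<close>, the inner products with the modulates of
  \<open>g\<close> are the Fourier coefficients of the pointwise inner product of the fibers. The
  case \<open>c = 1\<close> expresses normalization and \<open>c = 0\<close> orthogonality, at every
  translate on one side and at almost every fiber on the other.\<close>

lemma lattice_fiber_inner_const_iff:
  assumes f: "f \<in> L2 lebesgue" and g: "g \<in> L2 lebesgue"
  shows "(\<forall>k. L2_inner lebesgue f (modulate k g) = (if k = 0 then c else 0))
    \<longleftrightarrow> (AE x in lebesgue_on torus. ell2_inner (lattice_fiber f x) (lattice_fiber g x) = c)"
proof -
  have e: "L2_inner lebesgue f (modulate k g)
    = (\<integral>x. ell2_inner (lattice_fiber f x) (lattice_fiber g x) * character (- k) x \<partial>lebesgue_on torus)" for k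
    by (simp add: L2_inner_lattice_fiber(2)[OF f modulate_L2[OF g]] lattice_fiber_modulate L2_inner_cscale_right
        character_minus mult.commute)
  have "(\<forall>k. L2_inner lebesgue f (modulate k g) = (if k = 0 then c else 0)) \<longleftrightarrow>
    (\<forall>k. (\<integral>x. ell2_inner (lattice_fiber f x) (lattice_fiber g x) * character k x \<partial>lebesgue_on torus) = (if k = 0 then c else 0))"
    (is "_ \<longleftrightarrow> (\<forall>k. ?J k = _)")
  proof -
    have "?J k = (if k = 0 then c else 0)" if "\<forall>k. ?J (- k) = (if k = 0 then c else 0)" for k
      using that[rule_format, of "- k"] by simp
    moreover have "?J (- k) = (if k = 0 then c else 0)" if "\<forall>k. ?J k = (if k = 0 then c else 0)" for k
      using that[rule_format, of "- k"] by simp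
    ultimately show ?thesis unfolding e by blast
  qed
  also have "\<dots> \<longleftrightarrow> (AE x in lebesgue_on torus. ell2_inner (lattice_fiber f x) (lattice_fiber g x) = c)"
    by (rule fourier_coefficients_const[OF L2_inner_lattice_fiber(1)[OF f g]])
  finally show ?thesis .
qed

section \<open>The Plancherel theorem\<close>

text \<open>Fubini and joint measurability are applied over \<open>lborel\<close>, whereas the
  function spaces are built on the completed measure; a Borel function equal almost everywhere
  mediates between the two.\<close>

lemma borel_representative:
  fixes f :: "'a::euclidean_space \<Rightarrow> complex"
  assumes f: "f \<in> borel_measurable lebesgue"
  shows "\<exists>f'\<in>borel_measurable borel. AE x in lebesgue. f x = f' x"
proof -
  have "(\<lambda>x. Re (f x)) \<in> borel_measurable lebesgue" using f by auto
  from completion_ex_borel_measurable_real[OF this] obtain r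
    where r: "r \<in> borel_measurable lborel" "AE x in lborel. Re (f x) = r x" by blast
  have "(\<lambda>x. Im (f x)) \<in> borel_measurable lebesgue" using f by auto
  from completion_ex_borel_measurable_real[OF this] obtain i
    where i: "i \<in> borel_measurable lborel" "AE x in lborel. Im (f x) = i x" by blast
  have "AE x in lborel. f x = Complex (r x) (i x)" using r(2) i(2) by eventually_elim (simp add: complex_eq_iff)
  then have "AE x in lebesgue. f x = Complex (r x) (i x)" by (rule AE_completion)
  moreover have "(\<lambda>x. Complex (r x) (i x)) \<in> borel_measurable borel"
  proof -
    have [measurable]: "r \<in> borel_measurable borel" "i \<in> borel_measurable borel" using r(1) i(1) by simp_all
    show ?thesis unfolding Complex_eq by measurable
  qed
  ultimately show ?thesis by (intro bexI[of _ "\<lambda>x. Complex (r x) (i x)"])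
qed

lemma integral_lebesgue_lborel:
  fixes f :: "'a::euclidean_space \<Rightarrow> 'b::{banach, second_countable_topology}"
  shows "f \<in> borel_measurable borel \<Longrightarrow> integral\<^sup>L lebesgue f = integral\<^sup>L lborel f"
  by (rule integral_completion) simp

lemma integrable_lebesgue_lborel:
  fixes f :: "'a::euclidean_space \<Rightarrow> 'b::{banach, second_countable_topology}"
  shows "f \<in> borel_measurable borel \<Longrightarrow> integrable lebesgue f \<longleftrightarrow> integrable lborel f"
  by (rule integrable_completion) simp

lemma borel_measurable_lebesgue [intro]: "f \<in> borel_measurable borel \<Longrightarrow> f \<in> borel_measurable lebesgue"
  by (rule measurable_completion) simp

lemma integral_lborel_affine:
  fixes f :: "'a::euclidean_space \<Rightarrow> complex"
  assumes f[measurable]: "f \<in> borel_measurable borel" and c: "c \<noteq> 0"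
  shows "(\<integral>x. f x \<partial>lborel) = of_real (\<bar>c\<bar> ^ DIM('a)) * (\<integral>x. f (t + c *\<^sub>R x) \<partial>lborel)"
proof -
  have "(\<integral>x. f x \<partial>lborel) = (\<integral>x. f x \<partial>density (distr lborel borel (\<lambda>x. t + c *\<^sub>R x)) (\<lambda>_. ennreal (\<bar>c\<bar> ^ DIM('a))))"
    by (rule arg_cong[OF lborel_affine[OF c, of t]])
  also have "\<dots> = (\<integral>x. (\<bar>c\<bar> ^ DIM('a)) *\<^sub>R f x \<partial>distr lborel borel (\<lambda>x. t + c *\<^sub>R x))"
    by (subst integral_density) auto
  also have "\<dots> = (\<integral>x. (\<bar>c\<bar> ^ DIM('a)) *\<^sub>R f (t + c *\<^sub>R x) \<partial>lborel)"
    by (subst integral_distr) auto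
  also have "\<dots> = of_real (\<bar>c\<bar> ^ DIM('a)) * (\<integral>x. f (t + c *\<^sub>R x) \<partial>lborel)"
    by (simp add: scaleR_conv_of_real)
  finally show ?thesis .
qed

lemma integrable_lborel_affine:
  fixes f :: "'a::euclidean_space \<Rightarrow> 'b::{banach, second_countable_topology}"
  assumes f: "integrable lborel f" and c: "c \<noteq> 0"
  shows "integrable lborel (\<lambda>x. f (t + c *\<^sub>R x))"
proof -
  have [measurable]: "f \<in> borel_measurable borel" using f by auto
  have "integrable (density (distr lborel borel (\<lambda>x. t + c *\<^sub>R x)) (\<lambda>_. ennreal (\<bar>c\<bar> ^ DIM('a)))) f"
    by (rule subst[OF lborel_affine[OF c, of t], of "\<lambda>M. integrable M f"]) (rule f)
  then have "integrable (distr lborel borel (\<lambda>x. t + c *\<^sub>R x)) (\<lambda>x. (\<bar>c\<bar> ^ DIM('a)) *\<^sub>R f x)"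
    by (subst (asm) integrable_density) auto
  then have "integrable lborel (\<lambda>x. (\<bar>c\<bar> ^ DIM('a)) *\<^sub>R f (t + c *\<^sub>R x))"
    by (subst (asm) integrable_distr_eq) auto
  then have "integrable lborel (\<lambda>x. (1 / \<bar>c\<bar> ^ DIM('a)) *\<^sub>R ((\<bar>c\<bar> ^ DIM('a)) *\<^sub>R f (t + c *\<^sub>R x)))"
    by (rule integrable_scaleR_right)
  then show ?thesis using c by simp
qed

section \<open>Gaussian functions and their Fourier integrals\<close>

definition gaussian :: "'a::euclidean_space \<Rightarrow> real" where
  "gaussian v = exp (- (v \<bullet> v) / 2)"

text \<open>The total integral of \<open>gaussian\<close>; the type argument carries the
  dimension.\<close>

definition gaussian_mass :: "'a::euclidean_space itself \<Rightarrow> real" where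
  "gaussian_mass _ = sqrt (2 * pi) ^ DIM('a)"

text \<open>Up to the factor \<open>sqrt (2 * pi)\<close> from the normal density, this is the
  characteristic function of the standard normal distribution.\<close>

lemma gaussian_fourier_real:
  "integrable lborel (\<lambda>x::real. complex_of_real (exp (- x\<^sup>2 / 2)) * exp (\<i> * of_real (t * x)))"
  "(\<integral>x. complex_of_real (exp (- x\<^sup>2 / 2)) * exp (\<i> * of_real (t * x)) \<partial>lborel) = of_real (sqrt (2 * pi) * exp (- t\<^sup>2 / 2))"
proof -
  have e: "complex_of_real (exp (- x\<^sup>2 / 2)) * exp (\<i> * of_real (t * x)) = of_real (sqrt (2 * pi)) * (std_normal_density x *\<^sub>R exp (\<i> * of_real (t * x)))" for x
    by (simp add: std_normal_density_def scaleR_conv_of_real)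
  have "integrable lborel std_normal_density" by (rule integrable_normal_density) simp
  then have i: "integrable lborel (\<lambda>x. std_normal_density x *\<^sub>R exp (\<i> * of_real (t * x)))"
    by (rule Bochner_Integration.integrable_bound) (auto simp: norm_exp_i_times intro!: AE_I2)
  show "integrable lborel (\<lambda>x::real. complex_of_real (exp (- x\<^sup>2 / 2)) * exp (\<i> * of_real (t * x)))"
    unfolding e by (rule integrable_mult_right[OF i])
  have "(\<integral>x. std_normal_density x *\<^sub>R exp (\<i> * of_real (t * x)) \<partial>lborel) = char std_normal_distribution t"
    unfolding char_def by (subst integral_density) auto
  then show "(\<integral>x. complex_of_real (exp (- x\<^sup>2 / 2)) * exp (\<i> * of_real (t * x)) \<partial>lborel) = of_real (sqrt (2 * pi) * exp (- t\<^sup>2 / 2))"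
    unfolding e integral_mult_right_zero by (simp add: char_std_normal_distribution)
qed

text \<open>The measure \<open>lborel\<close> is the image of a product of one-dimensional measures
  under coordinate expansion, so integrals of products over coordinates factor.\<close>

lemma lborel_integral_prod:
  fixes f :: "'a::euclidean_space \<Rightarrow> real \<Rightarrow> complex"
  assumes f: "\<And>b. b \<in> Basis \<Longrightarrow> integrable lborel (f b)"
  shows "integrable lborel (\<lambda>x. \<Prod>b\<in>Basis. f b (x \<bullet> b))"
    "(\<integral>x. (\<Prod>b\<in>Basis. f b (x \<bullet> b)) \<partial>lborel) = (\<Prod>b\<in>Basis. \<integral>x. f b x \<partial>lborel)"
proof -
  interpret product_sigma_finite "\<lambda>_ :: 'a. lborel :: real measure" by unfold_locales
  have [measurable]: "f b \<in> borel_measurable borel" if "b \<in> Basis" for b using f[OF that] by auto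
  have m: "(\<lambda>x. \<Prod>b\<in>Basis. f b (x \<bullet> b)) \<in> borel_measurable borel" by measurable
  have T: "(\<lambda>g. \<Sum>b\<in>Basis. g b *\<^sub>R b) \<in> (\<Pi>\<^sub>M b\<in>(Basis :: 'a set). lborel) \<rightarrow>\<^sub>M borel" by measurable
  have e: "(\<Prod>b\<in>Basis. f b ((\<Sum>b\<in>Basis. g b *\<^sub>R b) \<bullet> b)) = (\<Prod>b\<in>Basis. f b (g b))" for g :: "'a \<Rightarrow> real"
    by (intro prod.cong) auto
  show "integrable lborel (\<lambda>x. \<Prod>b\<in>Basis. f b (x \<bullet> b))"
    using product_integrable_prod[of Basis f] f
    by (subst lborel_eq, subst integrable_distr_eq[OF T m]) (simp add: e)
  show "(\<integral>x. (\<Prod>b\<in>Basis. f b (x \<bullet> b)) \<partial>lborel) = (\<Prod>b\<in>Basis. \<integral>x. f b x \<partial>lborel)"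
    using product_integral_prod[of Basis f] f
    by (subst lborel_eq, subst integral_distr[OF T m]) (simp add: e)
qed

lemma gaussian_prod: "gaussian v = (\<Prod>b\<in>Basis. exp (- (v \<bullet> b)\<^sup>2 / 2))"
proof -
  have "- (v \<bullet> v) / 2 = (\<Sum>b\<in>Basis. - (v \<bullet> b)\<^sup>2 / 2)"
    by (subst euclidean_inner) (simp add: sum_negf[symmetric] sum_divide_distrib power2_eq_square)
  then show ?thesis by (simp add: gaussian_def exp_sum)
qed

lemma gaussian_fourier:
  fixes s :: "'a::euclidean_space"
  shows "integrable lborel (\<lambda>v. complex_of_real (gaussian v) * exp (\<i> * of_real (s \<bullet> v)))"
    "(\<integral>v. complex_of_real (gaussian v) * exp (\<i> * of_real (s \<bullet> v)) \<partial>lborel) = of_real (gaussian_mass TYPE('a) * gaussian s)"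
proof -
  let ?f = "\<lambda>b x. complex_of_real (exp (- x\<^sup>2 / 2)) * exp (\<i> * of_real ((s \<bullet> b) * x))"
  have e: "complex_of_real (gaussian v) * exp (\<i> * of_real (s \<bullet> v)) = (\<Prod>b\<in>Basis. ?f b (v \<bullet> b))" for v
  proof -
    have "\<i> * of_real (s \<bullet> v) = (\<Sum>b\<in>Basis. \<i> * of_real ((s \<bullet> b) * (v \<bullet> b)))"
      by (subst euclidean_inner) (simp add: sum_distrib_left)
    then have "exp (\<i> * of_real (s \<bullet> v)) = (\<Prod>b\<in>Basis. exp (\<i> * of_real ((s \<bullet> b) * (v \<bullet> b))))"
      by (simp only: exp_sum finite_Basis)
    then show ?thesis by (simp only: gaussian_prod of_real_prod prod.distrib)
  qed
  show "integrable lborel (\<lambda>v. complex_of_real (gaussian v) * exp (\<i> * of_real (s \<bullet> v)))"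
    unfolding e by (rule lborel_integral_prod(1)[OF gaussian_fourier_real(1)])
  have "(\<integral>v. complex_of_real (gaussian v) * exp (\<i> * of_real (s \<bullet> v)) \<partial>lborel)
    = (\<Prod>b\<in>Basis. complex_of_real (sqrt (2 * pi) * exp (- (s \<bullet> b)\<^sup>2 / 2)))"
    unfolding e by (subst lborel_integral_prod(2)[OF gaussian_fourier_real(1)]) (simp only: gaussian_fourier_real(2))
  then show "(\<integral>v. complex_of_real (gaussian v) * exp (\<i> * of_real (s \<bullet> v)) \<partial>lborel) = of_real (gaussian_mass TYPE('a) * gaussian s)"
    by (simp only: of_real_prod[symmetric] prod.distrib prod_constant gaussian_mass_def gaussian_prod)
qed

lemma gaussian_0 [simp]: "gaussian 0 = 1" by (simp add: gaussian_def)

lemma gaussian_nonneg [simp]: "0 \<le> gaussian v" by (simp add: gaussian_def)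

lemma gaussian_le_1: "gaussian v \<le> 1" by (simp add: gaussian_def)

lemma gaussian_minus [simp]: "gaussian (- v) = gaussian v" by (simp add: gaussian_def)

lemma borel_measurable_gaussian [measurable]: "gaussian \<in> borel_measurable borel"
  unfolding gaussian_def by (intro borel_measurable_continuous_onI continuous_intros) simp

lemma integrable_gaussian: "integrable lborel (gaussian :: 'a::euclidean_space \<Rightarrow> real)"
  using integrable_norm[OF gaussian_fourier(1)[of "0 :: 'a"]] by simp

lemma integral_gaussian: "(\<integral>v. gaussian (v :: 'a::euclidean_space) \<partial>lborel) = gaussian_mass TYPE('a)"
  using gaussian_fourier(2)[of "0 :: 'a"] by (simp del: of_real_mult)

lemma gaussian_mass_pos: "0 < gaussian_mass TYPE('a::euclidean_space)"
  by (simp add: gaussian_mass_def)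

lemma gaussian_mass_sq: "gaussian_mass TYPE('a::euclidean_space) * gaussian_mass TYPE('a) = (2 * pi) ^ DIM('a)"
  unfolding gaussian_mass_def power_mult_distrib[symmetric] by simp

section \<open>The Fourier integral of integrable functions\<close>

abbreviation fourier_kernel :: "real ^ 'n \<Rightarrow> real ^ 'n \<Rightarrow> complex" where
  "fourier_kernel \<xi> x \<equiv> exp (- (2 * complex_of_real pi * \<i> * complex_of_real (\<xi> \<bullet> x)))"

lemma fourier_kernel_alt: "fourier_kernel \<xi> x = exp (\<i> * of_real ((- (2 * pi) *\<^sub>R \<xi>) \<bullet> x))"
  by (simp add: algebra_simps)

lemma norm_fourier_kernel [simp]: "cmod (fourier_kernel \<xi> x) = 1"
  by simp

lemma borel_measurable_fourier_kernel' [measurable]: "fourier_kernel \<xi> \<in> borel_measurable borel"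
  by measurable

lemma fourier_integrable:
  assumes "integrable lebesgue f" shows "integrable lebesgue (\<lambda>x. f x * fourier_kernel \<xi> x)"
proof (rule Bochner_Integration.integrable_bound[OF assms])
  have "fourier_kernel \<xi> \<in> borel_measurable lebesgue" by (intro borel_measurable_lebesgue) measurable
  then show "(\<lambda>x. f x * fourier_kernel \<xi> x) \<in> borel_measurable lebesgue" using assms by measurable
qed (simp add: norm_mult)

lemma fourier_integral_cong_AE:
  fixes f g :: "real ^ 'n \<Rightarrow> complex"
  assumes "f \<in> borel_measurable lebesgue" "g \<in> borel_measurable lebesgue" "AE x in lebesgue. f x = g x"
  shows "fourier_integral f = fourier_integral g"
proof
  fix \<xi> :: "real ^ 'n"
  have [measurable]: "fourier_kernel \<xi> \<in> borel_measurable lebesgue" by (intro borel_measurable_lebesgue) measurable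
  show "fourier_integral f \<xi> = fourier_integral g \<xi>"
    unfolding fourier_integral_def using assms by (intro integral_cong_AE) auto
qed

lemma fourier_integral_borel:
  assumes "f \<in> borel_measurable borel"
  shows "fourier_integral f \<xi> = (\<integral>x. f x * fourier_kernel \<xi> x \<partial>lborel)"
  unfolding fourier_integral_def
  by (intro integral_lebesgue_lborel borel_measurable_times assms borel_measurable_fourier_kernel')

lemma fourier_integral_diff:
  fixes f g :: "real ^ 'n \<Rightarrow> complex"
  assumes "integrable lebesgue f" "integrable lebesgue g"
  shows "fourier_integral (f - g) = fourier_integral f - fourier_integral g"
proof
  fix \<xi> :: "real ^ 'n"
  show "fourier_integral (f - g) \<xi> = (fourier_integral f - fourier_integral g) \<xi>"
    using Bochner_Integration.integral_diff[OF fourier_integrable[OF assms(1)] fourier_integrable[OF assms(2)], of \<xi> \<xi>]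
    by (simp add: fourier_integral_def algebra_simps)
qed

lemma fourier_integral_cscale: "fourier_integral (cscale c f) = cscale c (fourier_integral f)"
  by (simp add: fun_eq_iff fourier_integral_def mult.assoc)

lemma fourier_integral_bound: "cmod (fourier_integral f \<xi>) \<le> (\<integral>x. cmod (f x) \<partial>lebesgue)"
proof -
  have "cmod (fourier_integral f \<xi>) \<le> (\<integral>x. cmod (f x * fourier_kernel \<xi> x) \<partial>lebesgue)"
    unfolding fourier_integral_def by (rule integral_norm_bound)
  then show ?thesis by (simp only: norm_mult norm_fourier_kernel mult_1_right)
qed

lemma borel_measurable_fourier_integral:
  assumes f: "f \<in> borel_measurable lebesgue" shows "fourier_integral f \<in> borel_measurable borel"
proof -
  obtain f' where f': "f' \<in> borel_measurable borel" "AE x in lebesgue. f x = f' x"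
    using borel_representative[OF f] by blast
  have "(\<lambda>(\<xi>, x). f' x * fourier_kernel \<xi> x) \<in> borel_measurable (borel \<Otimes>\<^sub>M lborel)"
    using f'(1) by measurable
  then have "(\<lambda>\<xi>. \<integral>x. f' x * fourier_kernel \<xi> x \<partial>lborel) \<in> borel_measurable borel"
    by (rule lborel.borel_measurable_lebesgue_integral)
  then have "fourier_integral f' \<in> borel_measurable borel"
    by (simp only: fourier_integral_borel[OF f'(1), abs_def])
  then show ?thesis
    using fourier_integral_cong_AE[OF f _ f'(2)] f'(1) by (simp add: borel_measurable_lebesgue)
qed

text \<open>Fubini for a kernel that is symmetric in its two variables. As the kernel has modulus 1,
  absolute integrability is that of the product of \<open>f\<close> and \<open>g\<close>.\<close>

lemma fourier_multiplication_borel: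
  fixes f g :: "real ^ 'n \<Rightarrow> complex"
  assumes f: "integrable lborel f" and g: "integrable lborel g"
  shows "(\<integral>x. fourier_integral f x * g x \<partial>lborel) = (\<integral>x. f x * fourier_integral g x \<partial>lborel)"
proof -
  have [measurable]: "f \<in> borel_measurable borel" "g \<in> borel_measurable borel" using f g by auto
  let ?F = "\<lambda>p. f (snd p) * g (fst p) * fourier_kernel (fst p) (snd p)"
  have int: "integrable (lborel \<Otimes>\<^sub>M lborel) ?F"
  proof (rule lborel_pair.Fubini_integrable)
    show "integrable lborel (\<lambda>\<xi>. \<integral>x. norm (?F (\<xi>, x)) \<partial>lborel)"
      using g by (simp add: norm_mult)
    show "AE \<xi> in lborel. integrable lborel (\<lambda>x. ?F (\<xi>, x))"
    proof (rule AE_I2)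
      fix \<xi>
      have "integrable lborel (\<lambda>x. f x * (g \<xi> * fourier_kernel \<xi> x))"
        by (rule integrable_bounded_mult[OF f, of _ "cmod (g \<xi>)"]) (auto simp: norm_mult)
      then show "integrable lborel (\<lambda>x. ?F (\<xi>, x))" by (simp add: mult.assoc)
    qed
  qed measurable
  have "(\<integral>\<xi>. fourier_integral f \<xi> * g \<xi> \<partial>lborel) = (\<integral>\<xi>. \<integral>x. f x * g \<xi> * fourier_kernel \<xi> x \<partial>lborel \<partial>lborel)"
  proof (rule Bochner_Integration.integral_cong[OF refl])
    fix \<xi>
    have "(\<integral>x. f x * g \<xi> * fourier_kernel \<xi> x \<partial>lborel) = (\<integral>x. (f x * fourier_kernel \<xi> x) * g \<xi> \<partial>lborel)"
      by (simp only: mult_ac)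
    then show "fourier_integral f \<xi> * g \<xi> = (\<integral>x. f x * g \<xi> * fourier_kernel \<xi> x \<partial>lborel)"
      by (simp only: fourier_integral_borel[OF \<open>f \<in> borel_measurable borel\<close>] integral_mult_left_zero)
  qed
  also have "\<dots> = (\<integral>x. \<integral>\<xi>. f x * g \<xi> * fourier_kernel \<xi> x \<partial>lborel \<partial>lborel)"
    using lborel_pair.Fubini_integral[of "\<lambda>\<xi> x. f x * g \<xi> * fourier_kernel \<xi> x"] int by (simp add: case_prod_beta')
  also have "\<dots> = (\<integral>x. f x * fourier_integral g x \<partial>lborel)"
  proof (rule Bochner_Integration.integral_cong[OF refl])
    fix x
    have "(\<integral>\<xi>. f x * g \<xi> * fourier_kernel \<xi> x \<partial>lborel) = (\<integral>\<xi>. f x * (g \<xi> * fourier_kernel x \<xi>) \<partial>lborel)"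
      by (simp only: mult_ac inner_commute[of _ x])
    then show "(\<integral>\<xi>. f x * g \<xi> * fourier_kernel \<xi> x \<partial>lborel) = f x * fourier_integral g x"
      by (simp only: fourier_integral_borel[OF \<open>g \<in> borel_measurable borel\<close>] integral_mult_right_zero)
  qed
  finally show ?thesis .
qed

section \<open>Translations in \<open>L2\<close> and their weak continuity\<close>

lemma lebesgue_translate:
  fixes f :: "'a::euclidean_space \<Rightarrow> 'b::{banach, second_countable_topology}"
  assumes f: "f \<in> borel_measurable lebesgue"
  shows "(\<lambda>x. f (x + u)) \<in> borel_measurable lebesgue"
    "integrable lebesgue (\<lambda>x. f (x + u)) \<longleftrightarrow> integrable lebesgue f"
    "(\<integral>x. f (x + u) \<partial>lebesgue) = (\<integral>x. f x \<partial>lebesgue)"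
proof -
  show "(\<lambda>x. f (x + u)) \<in> borel_measurable lebesgue" by (rule measurable_compose[OF measurable_lebesgue_plus' f])
  show "integrable lebesgue (\<lambda>x. f (x + u)) \<longleftrightarrow> integrable lebesgue f"
    using integrable_distr_eq[OF measurable_lebesgue_plus' f, of u] by (simp add: distr_lebesgue_plus')
  show "(\<integral>x. f (x + u) \<partial>lebesgue) = (\<integral>x. f x \<partial>lebesgue)"
    using integral_distr[OF measurable_lebesgue_plus' f, of u] by (simp add: distr_lebesgue_plus')
qed

lemma L2_translate:
  fixes f :: "'a::euclidean_space \<Rightarrow> complex"
  assumes f: "f \<in> L2 lebesgue"
  shows "(\<lambda>x. f (x + u)) \<in> L2 lebesgue" "L2_norm lebesgue (\<lambda>x. f (x + u)) = L2_norm lebesgue f"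
proof -
  have m: "(\<lambda>x. (cmod (f x))\<^sup>2) \<in> borel_measurable lebesgue" using f by (auto simp: L2_def)
  show "(\<lambda>x. f (x + u)) \<in> L2 lebesgue"
    using f lebesgue_translate(1)[OF L2_measurable[OF f]] lebesgue_translate(2)[OF m] by (simp add: L2_def)
  show "L2_norm lebesgue (\<lambda>x. f (x + u)) = L2_norm lebesgue f"
    unfolding L2_norm_def using lebesgue_translate(3)[OF m] by simp
qed

text \<open>Off the boundary of the box, a null set, the shifted indicators are eventually constant
  in \<open>m\<close>. The shifts are bounded by some \<open>R\<close>, so the box enlarged by
  \<open>R\<close> in every direction supplies a common majorant.\<close>

lemma translate_box_weakly_continuous:
  fixes f :: "'a::euclidean_space \<Rightarrow> complex"
  assumes f: "f \<in> L2 lebesgue" and u: "u \<longlonglongrightarrow> 0"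
  shows "(\<lambda>m. L2_inner lebesgue f (\<lambda>x. cind (box a b) (x + u m))) \<longlonglongrightarrow> L2_inner lebesgue f (cind (box a b))"
proof -
  obtain R where R: "\<And>m. norm (u m) \<le> R" using convergent_imp_Bseq[of u] u by (auto simp: convergent_def Bseq_def)
  let ?B = "box (a - R *\<^sub>R One) (b + R *\<^sub>R One)"
  have sub: "x \<in> ?B" if "x + u m \<in> box a b" for x m
    unfolding mem_box
  proof (intro ballI conjI)
    fix i :: 'a assume i: "i \<in> Basis"
    have "\<bar>u m \<bullet> i\<bar> \<le> R" using Basis_le_norm[OF i, of "u m"] R[of m] by linarith
    moreover have "a \<bullet> i < x \<bullet> i + u m \<bullet> i" "x \<bullet> i + u m \<bullet> i < b \<bullet> i"
      using that i by (auto simp: mem_box inner_add_left)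
    ultimately show "(a - R *\<^sub>R One) \<bullet> i < x \<bullet> i" "x \<bullet> i < (b + R *\<^sub>R One) \<bullet> i"
      using i by (simp_all add: inner_diff_left inner_add_left)
  qed
  show ?thesis
    unfolding L2_inner_def
  proof (rule integral_dominated_convergence)
    show "(\<lambda>x. f x * cnj (cind (box a b) x)) \<in> borel_measurable lebesgue"
      by (rule borel_measurable_integrable[OF L2_integrable_inner[OF f cind_box_L2]])
    show "(\<lambda>x. f x * cnj (cind (box a b) (x + u m))) \<in> borel_measurable lebesgue" for m
      by (rule borel_measurable_integrable[OF L2_integrable_inner[OF f L2_translate(1)[OF cind_box_L2]]])
    show "integrable lebesgue (\<lambda>x. norm (f x * cind ?B x))"
      by (rule integrable_norm[OF L2_integrable_prod[OF f cind_box_L2]])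
    show "AE x in lebesgue. norm (f x * cnj (cind (box a b) (x + u m))) \<le> norm (f x * cind ?B x)" for m
    proof (rule AE_I2)
      fix x
      show "norm (f x * cnj (cind (box a b) (x + u m))) \<le> norm (f x * cind ?B x)"
        using sub[of x m] by (cases "x + u m \<in> box a b") (simp_all add: cind_def)
    qed
    have "AE x in lebesgue. x \<notin> cbox a b - box a b"
      using negligible_frontier_interval[of a b] unfolding negligible_iff_null_sets by (rule AE_not_in)
    then show "AE x in lebesgue. (\<lambda>m. f x * cnj (cind (box a b) (x + u m))) \<longlonglongrightarrow> f x * cnj (cind (box a b) x)"
    proof eventually_elim
      case (elim x)
      have xu: "(\<lambda>m. x + u m) \<longlonglongrightarrow> x" using tendsto_add[OF tendsto_const u, of x] by simp
      have "\<forall>\<^sub>F m in sequentially. cind (box a b) (x + u m) = cind (box a b) x"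
      proof (cases "x \<in> box a b")
        case True
        have "\<forall>\<^sub>F m in sequentially. x + u m \<in> box a b" by (rule topological_tendstoD[OF xu open_box True])
        then show ?thesis by eventually_elim (simp add: cind_def True)
      next
        case False
        then have "x \<in> - cbox a b" using elim by blast
        have "\<forall>\<^sub>F m in sequentially. x + u m \<in> - cbox a b"
          by (rule topological_tendstoD[OF xu _ \<open>x \<in> - cbox a b\<close>]) (rule open_Compl[OF closed_cbox])
        then show ?thesis
        proof eventually_elim
          case (elim m)
          then have "x + u m \<notin> box a b" using box_subset_cbox by blast
          with False show ?case by (simp add: cind_def)
        qed
      qed
      then have "\<forall>\<^sub>F m in sequentially. f x * cnj (cind (box a b) (x + u m)) = f x * cnj (cind (box a b) x)"
        by eventually_elim simp
      then show ?case by (rule tendsto_eventually)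
    qed
  qed
qed

lemma closed_subspace_L2: "closed_subspace M (L2 M)"
  by (simp add: closed_subspace_def subspace_L2)

lemma closed_span_rat_boxes: "closed_span lebesgue (cind ` rat_boxes) = L2 (lebesgue :: 'a::euclidean_space measure)"
proof -
  have sub: "cind ` rat_boxes \<subseteq> L2 (lebesgue :: 'a measure)" using cind_rat_box_L2 by blast
  show ?thesis
    unfolding closed_span_eq_iff[OF closed_subspace_L2 sub]
    by (intro ballI impI, rule L2_zero_on_rat_boxes) auto
qed

text \<open>The functions \<open>g\<close> with this property form a closed subspace, since
  translations preserve the norm and approximation errors are therefore uniform in \<open>m\<close>;
  and it contains the indicators of boxes, which are total.\<close>

lemma translate_weakly_continuous:
  fixes f g :: "'a::euclidean_space \<Rightarrow> complex"
  assumes f: "f \<in> L2 lebesgue" and g: "g \<in> L2 lebesgue" and u: "u \<longlonglongrightarrow> 0"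
  shows "(\<lambda>m. L2_inner lebesgue f (\<lambda>x. g (x + u m))) \<longlonglongrightarrow> L2_inner lebesgue f g"
proof -
  let ?G = "{g \<in> L2 lebesgue. (\<lambda>m. L2_inner lebesgue f (\<lambda>x. g (x + u m))) \<longlonglongrightarrow> L2_inner lebesgue f g}"
  note TL = L2_translate(1)
  have "closed_subspace lebesgue ?G"
    unfolding closed_subspace_def
  proof (intro conjI allI impI)
    show "cfun.subspace ?G"
      unfolding cfun.subspace_def
    proof (intro conjI ballI allI)
      show "0 \<in> ?G" by (simp add: L2_inner_def)
      fix v w assume v: "v \<in> ?G" and w: "w \<in> ?G"
      have "(\<lambda>x. (v + w) (x + u m)) = (\<lambda>x. v (x + u m)) + (\<lambda>x. w (x + u m))" for m by (simp add: fun_eq_iff)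
      then have "L2_inner lebesgue f (\<lambda>x. (v + w) (x + u m)) = L2_inner lebesgue f (\<lambda>x. v (x + u m)) + L2_inner lebesgue f (\<lambda>x. w (x + u m))" for m
        using v w f by (simp only: L2_inner_add_right TL mem_Collect_eq)
      then show "v + w \<in> ?G"
        using v w f tendsto_add[of "\<lambda>m. L2_inner lebesgue f (\<lambda>x. v (x + u m))" "L2_inner lebesgue f v" sequentially "\<lambda>m. L2_inner lebesgue f (\<lambda>x. w (x + u m))" "L2_inner lebesgue f w"]
        by (simp only: mem_Collect_eq L2_inner_add_right L2_add)
    next
      fix c v assume v: "v \<in> ?G"
      have "(\<lambda>x. cscale c v (x + u m)) = cscale c (\<lambda>x. v (x + u m))" for m by (simp add: fun_eq_iff)
      then have "L2_inner lebesgue f (\<lambda>x. cscale c v (x + u m)) = cnj c * L2_inner lebesgue f (\<lambda>x. v (x + u m))" for m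
        by (simp only: L2_inner_cscale_right)
      then show "cscale c v \<in> ?G"
        using v tendsto_mult_left[of "\<lambda>m. L2_inner lebesgue f (\<lambda>x. v (x + u m))" "L2_inner lebesgue f v" sequentially "cnj c"]
        by (simp only: mem_Collect_eq L2_inner_cscale_right L2_cscale)
    qed
  next
    fix s h assume "(\<forall>k. s k \<in> ?G) \<and> h \<in> L2 lebesgue \<and> L2_converges lebesgue s h"
    then have s: "\<And>k. s k \<in> L2 lebesgue" "\<And>k. (\<lambda>m. L2_inner lebesgue f (\<lambda>x. s k (x + u m))) \<longlonglongrightarrow> L2_inner lebesgue f (s k)"
      and h: "h \<in> L2 lebesgue" and lim: "(\<lambda>k. L2_norm lebesgue (s k - h)) \<longlonglongrightarrow> 0" by (auto simp: L2_converges_def)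
    have "(\<lambda>m. L2_inner lebesgue f (\<lambda>x. h (x + u m))) \<longlonglongrightarrow> L2_inner lebesgue f h"
    proof (rule LIMSEQ_I)
      fix e :: real assume e: "0 < e"
      let ?N = "L2_norm lebesgue f"
      have N: "0 < 3 * (?N + 1)" by (simp add: add_nonneg_pos)
      then obtain k where k: "L2_norm lebesgue (s k - h) < e / (3 * (?N + 1))"
        using order_tendstoD(2)[OF lim, of "e / (3 * (?N + 1))"] e by (auto simp: eventually_sequentially)
      have small: "?N * L2_norm lebesgue (s k - h) < e / 3"
      proof -
        have "?N * L2_norm lebesgue (s k - h) \<le> (?N + 1) * L2_norm lebesgue (s k - h)" by (intro mult_right_mono) auto
        also have "\<dots> < (?N + 1) * (e / (3 * (?N + 1)))" using k by (intro mult_strict_left_mono) (auto simp: add_nonneg_pos)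
        also have "\<dots> = e / 3" using N by (simp add: field_simps)
        finally show ?thesis .
      qed
      obtain M where M: "\<And>m. m \<ge> M \<Longrightarrow> cmod (L2_inner lebesgue f (\<lambda>x. s k (x + u m)) - L2_inner lebesgue f (s k)) < e / 3"
        using LIMSEQ_D[OF s(2)[of k], of "e/3"] e by auto
      have "cmod (L2_inner lebesgue f (\<lambda>x. h (x + u m)) - L2_inner lebesgue f h) < e" if m: "m \<ge> M" for m
      proof -
        have d: "(\<lambda>x. s k (x + u m)) - (\<lambda>x. h (x + u m)) = (\<lambda>x. (s k - h) (x + u m))" by (simp add: fun_eq_iff)
        have 1: "cmod (L2_inner lebesgue f (\<lambda>x. s k (x + u m)) - L2_inner lebesgue f (\<lambda>x. h (x + u m))) \<le> ?N * L2_norm lebesgue (s k - h)"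
        proof -
          have "L2_inner lebesgue f (\<lambda>x. s k (x + u m)) - L2_inner lebesgue f (\<lambda>x. h (x + u m)) = L2_inner lebesgue f (\<lambda>x. (s k - h) (x + u m))"
            using L2_inner_diff_right[OF TL[OF s(1)] TL[OF h] f] by (simp only: d[symmetric])
          then show ?thesis using L2_Cauchy_Schwarz[OF f TL[OF L2_diff[OF s(1) h]], of k "u m"] L2_translate(2)[OF L2_diff[OF s(1) h], of k "u m"]
            by (simp only:)
        qed
        have 2: "cmod (L2_inner lebesgue f (s k) - L2_inner lebesgue f h) \<le> ?N * L2_norm lebesgue (s k - h)"
          using L2_inner_diff_right[OF s(1)[of k] h f] L2_Cauchy_Schwarz[OF f L2_diff[OF s(1)[of k] h]] by simp
        have tri: "cmod (a - d) < e" if "cmod (b - a) \<le> X" "cmod (b - c) < e / 3" "cmod (c - d) \<le> X" "X < e / 3" for a b c d :: complex and X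
        proof -
          have "a - d = (b - c) + (c - d) - (b - a)" by simp
          from arg_cong[OF this, of cmod] have "cmod (a - d) \<le> cmod (b - c) + cmod (c - d) + cmod (b - a)"
            using norm_triangle_ineq4[of "(b - c) + (c - d)" "b - a"] norm_triangle_ineq[of "b - c" "c - d"] by linarith
          then show ?thesis using that by linarith
        qed
        show ?thesis by (rule tri[OF 1 M[OF m] 2 small])
      qed
      then show "\<exists>no. \<forall>n\<ge>no. norm (L2_inner lebesgue f (\<lambda>x. h (x + u n)) - L2_inner lebesgue f h) < e" by blast
    qed
    then show "h \<in> ?G" using h by blast
  qed auto
  moreover have "cind ` rat_boxes \<subseteq> ?G"
  proof
    fix c assume "c \<in> cind ` (rat_boxes :: 'a set set)"
    then obtain a b where "c = cind (box a b)" by (auto simp: rat_boxes_def)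
    then show "c \<in> ?G" using cind_box_L2 translate_box_weakly_continuous[OF f u] by blast
  qed
  ultimately have "closed_span lebesgue (cind ` rat_boxes) \<subseteq> ?G" by (rule closed_span_minimal)
  then show ?thesis using g closed_span_rat_boxes by blast
qed

section \<open>The Plancherel identity by Gaussian regularization\<close>

lemma gaussian_kernel_integral:
  fixes z :: "real ^ 'n"
  assumes d: "0 < d"
  shows "integrable lborel (\<lambda>\<xi>. complex_of_real (gaussian (d *\<^sub>R \<xi>)) * fourier_kernel z \<xi>)"
    "(\<integral>\<xi>. complex_of_real (gaussian (d *\<^sub>R \<xi>)) * fourier_kernel z \<xi> \<partial>lborel)
      = of_real (gaussian_mass TYPE(real ^ 'n) / d ^ DIM(real ^ 'n) * gaussian ((2 * pi / d) *\<^sub>R z))"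
proof -
  \<comment> \<open>Replacing \<open>\<xi>\<close> by \<open>v = d \<xi>\<close> divides the
    frequency by \<open>d\<close>; the factor \<open>- 2 * pi\<close> is that of the Fourier
    kernel.\<close>
  let ?s = "(- (2 * pi / d)) *\<^sub>R z"
  let ?F = "\<lambda>v. complex_of_real (gaussian v) * exp (\<i> * of_real (?s \<bullet> v))"
  have e: "complex_of_real (gaussian (d *\<^sub>R \<xi>)) * fourier_kernel z \<xi> = ?F (0 + d *\<^sub>R \<xi>)" for \<xi>
    using d by (simp add: fourier_kernel_alt)
  show "integrable lborel (\<lambda>\<xi>. complex_of_real (gaussian (d *\<^sub>R \<xi>)) * fourier_kernel z \<xi>)"
    unfolding e using d by (intro integrable_lborel_affine[OF gaussian_fourier(1)]) auto
  have "(\<integral>v. ?F v \<partial>lborel) = of_real (\<bar>d\<bar> ^ DIM(real ^ 'n)) * (\<integral>\<xi>. ?F (0 + d *\<^sub>R \<xi>) \<partial>lborel)"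
    using d by (intro integral_lborel_affine borel_measurable_integrable[OF gaussian_fourier(1), simplified]) auto
  then have "(\<integral>\<xi>. ?F (0 + d *\<^sub>R \<xi>) \<partial>lborel) = of_real (gaussian_mass TYPE(real ^ 'n) * gaussian ?s) / of_real (d ^ DIM(real ^ 'n))"
    using d unfolding gaussian_fourier(2) by (simp add: field_simps)
  also have "gaussian ?s = gaussian ((2 * pi / d) *\<^sub>R z)" by (metis gaussian_minus scaleR_minus_left)
  finally show "(\<integral>\<xi>. complex_of_real (gaussian (d *\<^sub>R \<xi>)) * fourier_kernel z \<xi> \<partial>lborel)
      = of_real (gaussian_mass TYPE(real ^ 'n) / d ^ DIM(real ^ 'n) * gaussian ((2 * pi / d) *\<^sub>R z))"
    unfolding e by (simp del: add_0)
qed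

text \<open>Substitution of \<open>- y\<close> for \<open>y\<close>. It makes the squared modulus of
  a Fourier integral a product of two Fourier integrals, to which the multiplication formula
  applies.\<close>

lemma cnj_fourier_integral:
  fixes f :: "real ^ 'n \<Rightarrow> complex"
  assumes f[measurable]: "f \<in> borel_measurable borel"
  shows "cnj (fourier_integral f \<xi>) = fourier_integral (\<lambda>y. cnj (f (- y))) \<xi>"
proof -
  have m: "(\<lambda>y. cnj (f (- y))) \<in> borel_measurable borel" by measurable
  have "(\<integral>y. cnj (f (- y)) * fourier_kernel \<xi> y \<partial>lborel)
    = of_real (\<bar>-1\<bar> ^ DIM(real ^ 'n)) * (\<integral>y. cnj (f (- (0 + (-1) *\<^sub>R y))) * fourier_kernel \<xi> (0 + (-1) *\<^sub>R y) \<partial>lborel)"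
    by (rule integral_lborel_affine) auto
  also have "\<dots> = (\<integral>y. cnj (f y * fourier_kernel \<xi> y) \<partial>lborel)"
    by (simp add: exp_cnj)
  also have "\<dots> = cnj (\<integral>y. f y * fourier_kernel \<xi> y \<partial>lborel)" by (rule Bochner_Integration.integral_cnj)
  finally show ?thesis by (simp only: fourier_integral_borel[OF f] fourier_integral_borel[OF m])
qed

lemma L2_inner_borel:
  assumes "f \<in> borel_measurable borel" "g \<in> borel_measurable borel"
  shows "L2_inner lebesgue f g = (\<integral>x. f x * cnj (g x) \<partial>lborel)"
  unfolding L2_inner_def using assms
  by (intro integral_lebesgue_lborel borel_measurable_times borel_measurable_cnj)

text \<open>The Gaussian weight makes the integral of \<open>|F f|\<^sup>2\<close> converge absolutely; the multiplication formula,
  applied twice, turns it into a Gaussian average of the autocorrelation of \<open>f\<close>.\<close>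

lemma gaussian_regularized_plancherel:
  fixes f :: "real ^ 'n \<Rightarrow> complex"
  assumes f: "f \<in> borel_measurable borel" "integrable lborel f" "f \<in> L2 lebesgue" and d: "0 < d"
  shows "(\<integral>\<xi>. fourier_integral f \<xi> * (cnj (fourier_integral f \<xi>) * of_real (gaussian (d *\<^sub>R \<xi>))) \<partial>lborel)
    = of_real (1 / gaussian_mass TYPE(real ^ 'n)) *
      (\<integral>w. of_real (gaussian w) * L2_inner lebesgue f (\<lambda>x. f (x + - ((d / (2 * pi)) *\<^sub>R w))) \<partial>lborel)"
proof -
  note [measurable] = f(1)
  \<comment> \<open>The scale of the transformed weight: with \<open>y = - x + a v\<close>, the
    Gaussian of \<open>2 * pi / d\<close> times \<open>x + y\<close> becomes the standard Gaussian
    of \<open>v\<close>.\<close>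
  define a where "a = d / (2 * pi)"
  have a: "0 < a" using d by (simp add: a_def)
  let ?c = "gaussian_mass TYPE(real ^ 'n)"
  let ?n = "DIM(real ^ 'n)"
  define h where "h y = cnj (f (- y))" for y
  have [measurable]: "h \<in> borel_measurable borel" unfolding h_def[abs_def] by measurable
  have hi: "integrable lborel h"
    unfolding h_def[abs_def] using integrable_lborel_affine[OF f(2), of "-1" 0] by simp
  have Fm[measurable]: "fourier_integral f \<in> borel_measurable borel" "fourier_integral h \<in> borel_measurable borel"
    by (intro borel_measurable_fourier_integral borel_measurable_lebesgue; measurable)+
  have Fh: "cnj (fourier_integral f \<xi>) = fourier_integral h \<xi>" for \<xi>
    unfolding h_def by (rule cnj_fourier_integral[OF f(1)])
  define W where "W \<xi> = complex_of_real (gaussian (d *\<^sub>R \<xi>))" for \<xi> :: "real ^ 'n"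
  have [measurable]: "W \<in> borel_measurable borel" unfolding W_def[abs_def] by measurable
  define g where "g \<xi> = fourier_integral h \<xi> * W \<xi>" for \<xi>
  have [measurable]: "g \<in> borel_measurable borel" unfolding g_def[abs_def] by measurable
  have Wi: "integrable lborel W"
    using gaussian_kernel_integral(1)[OF d, of 0] by (simp add: W_def[abs_def])
  have gi: "integrable lborel g"
    unfolding g_def[abs_def] mult.commute[of "fourier_integral h _"]
    by (rule integrable_bounded_mult[OF Wi _ fourier_integral_bound]) measurable
  define w where "w x \<xi> = W \<xi> * fourier_kernel x \<xi>" for x \<xi>
  have [measurable]: "w x \<in> borel_measurable borel" for x unfolding w_def[abs_def] by measurable
  have wi: "integrable lborel (w x)" for x
    unfolding w_def[abs_def] by (rule integrable_bounded_mult[OF Wi, of _ 1]) auto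
  have Fw: "fourier_integral (w x) y = of_real (?c / d ^ ?n * gaussian ((2 * pi / d) *\<^sub>R (x + y)))" for x y
  proof -
    have "fourier_integral (w x) y = (\<integral>\<xi>. W \<xi> * fourier_kernel (x + y) \<xi> \<partial>lborel)"
    proof -
      have "w x \<xi> * fourier_kernel y \<xi> = W \<xi> * fourier_kernel (x + y) \<xi>" for \<xi>
        unfolding w_def mult.assoc by (simp add: inner_add_left exp_add[symmetric] algebra_simps)
      moreover have "fourier_integral (w x) y = (\<integral>\<xi>. w x \<xi> * fourier_kernel y \<xi> \<partial>lborel)"
        by (rule fourier_integral_borel) measurable
      ultimately show ?thesis by (simp only:)
    qed
    also have "\<dots> = of_real (?c / d ^ ?n * gaussian ((2 * pi / d) *\<^sub>R (x + y)))"
      unfolding W_def by (rule gaussian_kernel_integral(2)[OF d])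
    finally show ?thesis .
  qed
  \<comment> \<open>The Jacobian \<open>a ^ ?n\<close> of the substitution times the constant of the
    transformed weight is the reciprocal of the Gaussian mass, so the autocorrelation is averaged
    against a probability density.\<close>
  have const: "a ^ ?n * (?c / d ^ ?n) = 1 / ?c"
  proof -
    have "a ^ ?n * (?c / d ^ ?n) = ?c / (2 * pi) ^ ?n" using d by (simp add: a_def power_divide)
    also have "\<dots> = ?c / (?c * ?c)" by (simp only: gaussian_mass_sq)
    also have "\<dots> = 1 / ?c" using gaussian_mass_pos[where 'a="real ^ 'n"] by simp
    finally show ?thesis .
  qed
  have Fg: "fourier_integral g x = of_real (1 / ?c) * (\<integral>v. cnj (f (x + - (a *\<^sub>R v))) * of_real (gaussian v) \<partial>lborel)" for x
  proof -
    have "fourier_integral g x = (\<integral>\<xi>. fourier_integral h \<xi> * w x \<xi> \<partial>lborel)"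
      by (subst fourier_integral_borel) (simp_all add: g_def w_def mult.assoc)
    also have "\<dots> = (\<integral>y. h y * fourier_integral (w x) y \<partial>lborel)"
      by (rule fourier_multiplication_borel[OF hi wi])
    also have "\<dots> = (\<integral>y. h y * of_real (?c / d ^ ?n * gaussian ((2 * pi / d) *\<^sub>R (x + y))) \<partial>lborel)"
      by (simp only: Fw)
    also have "\<dots> = of_real (\<bar>a\<bar> ^ ?n) * (\<integral>v. h (- x + a *\<^sub>R v) * of_real (?c / d ^ ?n * gaussian ((2 * pi / d) *\<^sub>R (x + (- x + a *\<^sub>R v)))) \<partial>lborel)"
      by (rule integral_lborel_affine) (use a in \<open>measurable, simp\<close>)
    also have "\<dots> = of_real (a ^ ?n) * (\<integral>v. of_real (?c / d ^ ?n) * (cnj (f (x + - (a *\<^sub>R v))) * of_real (gaussian v)) \<partial>lborel)"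
    proof -
      have "(2 * pi / d) *\<^sub>R (x + (- x + a *\<^sub>R v)) = v" for v :: "real ^ 'n" using d by (simp add: a_def)
      moreover have "h (- x + a *\<^sub>R v) = cnj (f (x + - (a *\<^sub>R v)))" for v by (simp add: h_def)
      ultimately show ?thesis using a by (simp only: abs_of_pos of_real_mult mult_ac)
    qed
    also have "\<dots> = of_real (a ^ ?n * (?c / d ^ ?n)) * (\<integral>v. cnj (f (x + - (a *\<^sub>R v))) * of_real (gaussian v) \<partial>lborel)"
      by (simp only: integral_mult_right_zero of_real_mult mult.assoc)
    finally show ?thesis by (simp only: const)
  qed
  let ?P = "\<lambda>p. f (snd p) * (cnj (f (snd p + - (a *\<^sub>R fst p))) * of_real (gaussian (fst p)))"
  have sL: "(\<lambda>x. f (x + - (a *\<^sub>R v))) \<in> L2 lebesgue" for v by (rule L2_translate(1)[OF f(3)])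
  have int_x: "integrable lborel (\<lambda>x. f x * cnj (f (x + - (a *\<^sub>R v))))" for v
    using L2_integrable_inner[OF f(3) sL[of v]] by (subst (asm) integrable_lebesgue_lborel) measurable
  \<comment> \<open>Cauchy-Schwarz for the moduli gives a bound uniform in \<open>v\<close>.
    Multiplied by the integrable Gaussian it provides the absolute integrability that justifies
    exchanging the integrals.\<close>
  have nb: "(\<integral>x. norm (f x * cnj (f (x + - (a *\<^sub>R v)))) \<partial>lborel) \<le> (L2_norm lebesgue f)\<^sup>2" for v
  proof -
    let ?u = "\<lambda>x. complex_of_real (cmod (f x))" and ?t = "\<lambda>x. complex_of_real (cmod (f (x + - (a *\<^sub>R v))))"
    have uL: "?u \<in> L2 lebesgue" "?t \<in> L2 lebesgue" using f(3) sL[of v] by (auto simp: L2_def)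
    have n: "L2_norm lebesgue ?u = L2_norm lebesgue f" "L2_norm lebesgue ?t = L2_norm lebesgue f"
      using L2_translate(2)[OF f(3), of "- (a *\<^sub>R v)"] by (simp_all add: L2_norm_def)
    have "of_real (\<integral>x. norm (f x * cnj (f (x + - (a *\<^sub>R v)))) \<partial>lborel) = (\<integral>x. ?u x * cnj (?t x) \<partial>lborel)"
      by (subst integral_complex_of_real[symmetric]) (simp add: norm_mult)
    also have "\<dots> = L2_inner lebesgue ?u ?t" by (rule L2_inner_borel[symmetric]) measurable
    finally have "cmod (of_real (\<integral>x. norm (f x * cnj (f (x + - (a *\<^sub>R v)))) \<partial>lborel)) \<le> L2_norm lebesgue f * L2_norm lebesgue f"
      using L2_Cauchy_Schwarz[OF uL] n by simp
    then show ?thesis by (simp add: power2_eq_square)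
  qed
  have Pint: "integrable (lborel \<Otimes>\<^sub>M lborel) ?P"
  proof (rule lborel_pair.Fubini_integrable)
    show Pm: "?P \<in> borel_measurable (lborel \<Otimes>\<^sub>M lborel)" by measurable
    have eq: "(\<integral>x. norm (?P (v, x)) \<partial>lborel) = gaussian v * (\<integral>x. norm (f x * cnj (f (x + - (a *\<^sub>R v)))) \<partial>lborel)" for v
      by (simp add: norm_mult mult_ac)
    have Pn: "(\<lambda>(v, x). norm (?P (v, x))) \<in> borel_measurable (lborel \<Otimes>\<^sub>M lborel)" using Pm by measurable
    show "integrable lborel (\<lambda>v. \<integral>x. norm (?P (v, x)) \<partial>lborel)"
    proof (rule Bochner_Integration.integrable_bound)
      show "integrable lborel (\<lambda>v :: real ^ 'n. gaussian v * (L2_norm lebesgue f)\<^sup>2)"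
        by (intro integrable_mult_left integrable_gaussian)
      show "(\<lambda>v. \<integral>x. norm (?P (v, x)) \<partial>lborel) \<in> borel_measurable lborel"
        using lborel.borel_measurable_lebesgue_integral[OF Pn] by simp
      show "AE v in lborel. norm (\<integral>x. norm (?P (v, x)) \<partial>lborel) \<le> norm (gaussian v * (L2_norm lebesgue f)\<^sup>2)"
        unfolding eq
      proof (intro AE_I2)
        fix v :: "real ^ 'n"
        have I0: "0 \<le> (\<integral>x. norm (f x * cnj (f (x + - (a *\<^sub>R v)))) \<partial>lborel)" by simp
        show "norm (gaussian v * (\<integral>x. norm (f x * cnj (f (x + - (a *\<^sub>R v)))) \<partial>lborel)) \<le> norm (gaussian v * (L2_norm lebesgue f)\<^sup>2)"
          unfolding real_norm_def abs_mult abs_of_nonneg[OF gaussian_nonneg] abs_of_nonneg[OF I0] abs_of_nonneg[OF zero_le_power2]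
          by (rule mult_left_mono[OF nb gaussian_nonneg])
      qed
    qed
    show "AE v in lborel. integrable lborel (\<lambda>x. ?P (v, x))"
      using integrable_mult_left[OF int_x] by (intro AE_I2) (simp add: mult.assoc)
  qed
  have "(\<integral>\<xi>. fourier_integral f \<xi> * (cnj (fourier_integral f \<xi>) * of_real (gaussian (d *\<^sub>R \<xi>))) \<partial>lborel)
    = (\<integral>\<xi>. fourier_integral f \<xi> * g \<xi> \<partial>lborel)" by (simp only: Fh g_def W_def)
  also have "\<dots> = (\<integral>x. f x * fourier_integral g x \<partial>lborel)" by (rule fourier_multiplication_borel[OF f(2) gi])
  also have "\<dots> = (\<integral>x. of_real (1 / ?c) * (\<integral>v. ?P (v, x) \<partial>lborel) \<partial>lborel)"
  proof (rule Bochner_Integration.integral_cong[OF refl])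
    fix x
    have "(\<integral>v. ?P (v, x) \<partial>lborel) = f x * (\<integral>v. cnj (f (x + - (a *\<^sub>R v))) * of_real (gaussian v) \<partial>lborel)"
      by (simp only: fst_conv snd_conv integral_mult_right_zero)
    then show "f x * fourier_integral g x = of_real (1 / ?c) * (\<integral>v. ?P (v, x) \<partial>lborel)"
      by (simp only: Fg mult_ac)
  qed
  also have "\<dots> = of_real (1 / ?c) * (\<integral>x. \<integral>v. ?P (v, x) \<partial>lborel \<partial>lborel)" by (rule integral_mult_right_zero)
  also have "(\<integral>x. \<integral>v. ?P (v, x) \<partial>lborel \<partial>lborel) = (\<integral>v. \<integral>x. ?P (v, x) \<partial>lborel \<partial>lborel)"
    using lborel_pair.Fubini_integral[of "\<lambda>v x. ?P (v, x)"] Pint by (simp add: case_prod_beta')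
  also have "\<dots> = (\<integral>v. of_real (gaussian v) * L2_inner lebesgue f (\<lambda>x. f (x + - (a *\<^sub>R v))) \<partial>lborel)"
  proof (rule Bochner_Integration.integral_cong[OF refl])
    fix v :: "real ^ 'n"
    have m: "(\<lambda>x. f (x + - (a *\<^sub>R v))) \<in> borel_measurable borel" by measurable
    have "(\<integral>x. ?P (v, x) \<partial>lborel) = (\<integral>x. of_real (gaussian v) * (f x * cnj (f (x + - (a *\<^sub>R v)))) \<partial>lborel)"
      by (simp only: fst_conv snd_conv mult_ac)
    also have "\<dots> = of_real (gaussian v) * L2_inner lebesgue f (\<lambda>x. f (x + - (a *\<^sub>R v)))"
      by (simp only: L2_inner_borel[OF f(1) m] integral_mult_right_zero)
    finally show "(\<integral>x. ?P (v, x) \<partial>lborel) = of_real (gaussian v) * L2_inner lebesgue f (\<lambda>x. f (x + - (a *\<^sub>R v)))" .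
  qed
  finally show ?thesis by (simp only: a_def)
qed

lemma gaussian_half_square: "gaussian ((d / sqrt 2) *\<^sub>R x) * gaussian ((d / sqrt 2) *\<^sub>R x) = gaussian (d *\<^sub>R x)"
  by (simp add: gaussian_def exp_add[symmetric])

text \<open>As \<open>d m\<close> tends to 0, the translates in the Gaussian average converge weakly
  to \<open>f\<close>, so the regularized integrals \<open>I m\<close> tend to the squared norm of
  \<open>f\<close>. Fatou's lemma along \<open>t m\<close> puts \<open>F\<close> into
  \<open>L2\<close> and gives one inequality; the other holds because the modulus of
  \<open>t m\<close> is at most that of \<open>F\<close>.\<close>

lemma plancherel_borel:
  fixes f :: "real ^ 'n \<Rightarrow> complex"
  assumes f: "f \<in> borel_measurable borel" "integrable lborel f" "f \<in> L2 lebesgue"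
  shows "fourier_integral f \<in> L2 lebesgue" "L2_norm lebesgue (fourier_integral f) = L2_norm lebesgue f"
proof -
  note [measurable] = f(1)
  define F where "F = fourier_integral f"
  have [measurable]: "F \<in> borel_measurable borel"
    unfolding F_def by (intro borel_measurable_fourier_integral borel_measurable_lebesgue) measurable
  obtain B where B: "\<And>\<xi>. cmod (F \<xi>) \<le> B" unfolding F_def using fourier_integral_bound by blast
  define d where "d m = 1 / (real m + 1)" for m
  have d: "0 < d m" for m by (simp add: d_def)
  have dlim: "d \<longlonglongrightarrow> 0"
    using LIMSEQ_inverse_real_of_nat by (simp add: d_def[abs_def] inverse_eq_divide add.commute)
  define G where "G m \<xi> = complex_of_real (gaussian (d m *\<^sub>R \<xi>))" for m and \<xi> :: "real ^ 'n"
  have [measurable]: "G m \<in> borel_measurable borel" for m unfolding G_def[abs_def] by measurable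
  have Gi: "integrable lborel (G m)" for m
    using gaussian_kernel_integral(1)[OF d, of m 0] by (simp add: G_def[abs_def])
  define I where "I m = (\<integral>\<xi>. F \<xi> * (cnj (F \<xi>) * G m \<xi>) \<partial>lborel)" for m
  have Ii: "integrable lborel (\<lambda>\<xi>. F \<xi> * (cnj (F \<xi>) * G m \<xi>))" for m
  proof -
    have "integrable lborel (\<lambda>\<xi>. G m \<xi> * (F \<xi> * cnj (F \<xi>)))"
    proof (rule integrable_bounded_mult[OF Gi])
      show "cmod (F \<xi> * cnj (F \<xi>)) \<le> B * B" for \<xi>
        unfolding norm_mult complex_mod_cnj by (rule mult_mono'[OF B B]) simp_all
    qed measurable
    then show ?thesis by (simp only: mult_ac)
  qed
  \<comment> \<open>Dividing by \<open>sqrt 2\<close> takes the square root of the weight, so the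
    squared modulus of \<open>t m\<close> is the integrand of \<open>I m\<close>, and the norms of
    \<open>t m\<close> are accessible before \<open>F\<close> is known to be square
    integrable.\<close>
  define t where "t m \<xi> = F \<xi> * complex_of_real (gaussian ((d m / sqrt 2) *\<^sub>R \<xi>))" for m and \<xi>
  have [measurable]: "t m \<in> borel_measurable borel" for m unfolding t_def[abs_def] by measurable
  have tt: "t m \<xi> * cnj (t m \<xi>) = F \<xi> * (cnj (F \<xi>) * G m \<xi>)" for m \<xi>
    unfolding t_def G_def gaussian_half_square[of "d m" \<xi>, symmetric] by simp
  have tsq: "(cmod (t m \<xi>))\<^sup>2 = Re (F \<xi> * (cnj (F \<xi>) * G m \<xi>))" for m \<xi>
    unfolding tt[symmetric] complex_norm_square[symmetric] by simp
  have tL: "t m \<in> L2 lebesgue" for m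
  proof (rule L2I)
    show "t m \<in> borel_measurable lebesgue" by (rule borel_measurable_lebesgue) measurable
    have "integrable lborel (\<lambda>\<xi>. (cmod (t m \<xi>))\<^sup>2)" unfolding tsq by (rule integrable_Re[OF Ii])
    then show "integrable lebesgue (\<lambda>\<xi>. (cmod (t m \<xi>))\<^sup>2)" by (subst integrable_lebesgue_lborel) measurable
  qed
  have tn: "(L2_norm lebesgue (t m))\<^sup>2 = Re (I m)" for m
  proof -
    have "(L2_norm lebesgue (t m))\<^sup>2 = (\<integral>\<xi>. (cmod (t m \<xi>))\<^sup>2 \<partial>lborel)"
      unfolding L2_norm_sq by (rule integral_lebesgue_lborel) measurable
    also have "\<dots> = Re (I m)" unfolding tsq I_def by (rule integral_Re[OF Ii])
    finally show ?thesis .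
  qed
  let ?\<tau> = "\<lambda>m w x. f (x + - ((d m / (2 * pi)) *\<^sub>R w))"
  let ?c = "gaussian_mass TYPE(real ^ 'n)" and ?N = "L2_norm lebesgue f"
  have "I \<longlonglongrightarrow> of_real (1 / ?c) * (\<integral>w. of_real (gaussian (w :: real ^ 'n)) * L2_inner lebesgue f f \<partial>lborel)"
  proof -
    have "(\<lambda>m. \<integral>w. of_real (gaussian w) * L2_inner lebesgue f (?\<tau> m w) \<partial>lborel)
      \<longlonglongrightarrow> (\<integral>w. of_real (gaussian (w :: real ^ 'n)) * L2_inner lebesgue f f \<partial>lborel)"
    proof (rule integral_dominated_convergence)
      show "integrable lborel (\<lambda>w :: real ^ 'n. gaussian w * ?N\<^sup>2)" by (intro integrable_mult_left integrable_gaussian)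
      show "(\<lambda>w :: real ^ 'n. complex_of_real (gaussian w) * L2_inner lebesgue f f) \<in> borel_measurable lborel" by measurable
      show "(\<lambda>w. of_real (gaussian w) * L2_inner lebesgue f (?\<tau> m w)) \<in> borel_measurable lborel" for m
      proof -
        have "(\<lambda>(w, x). f x * cnj (f (x + - ((d m / (2 * pi)) *\<^sub>R w)))) \<in> borel_measurable (borel \<Otimes>\<^sub>M lborel)" by measurable
        then have "(\<lambda>w. \<integral>x. f x * cnj (f (x + - ((d m / (2 * pi)) *\<^sub>R w))) \<partial>lborel) \<in> borel_measurable borel"
          by (rule lborel.borel_measurable_lebesgue_integral)
        moreover have "L2_inner lebesgue f (?\<tau> m w) = (\<integral>x. f x * cnj (f (x + - ((d m / (2 * pi)) *\<^sub>R w))) \<partial>lborel)" for w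
          by (rule L2_inner_borel) measurable
        ultimately show ?thesis by simp
      qed
      show "AE w in lborel. (\<lambda>m. of_real (gaussian w) * L2_inner lebesgue f (?\<tau> m w))
          \<longlonglongrightarrow> of_real (gaussian w) * L2_inner lebesgue f f"
      proof (rule AE_I2)
        fix w :: "real ^ 'n"
        have "(\<lambda>m. - ((d m / (2 * pi)) *\<^sub>R w)) \<longlonglongrightarrow> - ((0 / (2 * pi)) *\<^sub>R w)" by (intro tendsto_intros dlim) simp
        then have "(\<lambda>m. - ((d m / (2 * pi)) *\<^sub>R w)) \<longlonglongrightarrow> 0" by simp
        from translate_weakly_continuous[OF f(3) f(3) this]
        show "(\<lambda>m. of_real (gaussian w) * L2_inner lebesgue f (?\<tau> m w))
          \<longlonglongrightarrow> of_real (gaussian w) * L2_inner lebesgue f f" by (rule tendsto_mult_left)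
      qed
      show "AE w in lborel. norm (of_real (gaussian w) * L2_inner lebesgue f (?\<tau> m w)) \<le> gaussian w * ?N\<^sup>2" for m
      proof (rule AE_I2)
        fix w :: "real ^ 'n"
        have "cmod (L2_inner lebesgue f (?\<tau> m w)) \<le> ?N * ?N"
          using L2_Cauchy_Schwarz[OF f(3) L2_translate(1)[OF f(3)]] by (simp only: L2_translate(2)[OF f(3)])
        from mult_left_mono[OF this gaussian_nonneg[of w]]
        show "norm (of_real (gaussian w) * L2_inner lebesgue f (?\<tau> m w)) \<le> gaussian w * ?N\<^sup>2"
          by (simp only: norm_mult norm_of_real abs_of_nonneg[OF gaussian_nonneg] power2_eq_square)
      qed
    qed
    then have "(\<lambda>m. of_real (1 / ?c) * (\<integral>w. of_real (gaussian w) * L2_inner lebesgue f (?\<tau> m w) \<partial>lborel))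
      \<longlonglongrightarrow> of_real (1 / ?c) * (\<integral>w. of_real (gaussian (w :: real ^ 'n)) * L2_inner lebesgue f f \<partial>lborel)" by (rule tendsto_mult_left)
    then show ?thesis
      unfolding I_def[abs_def] F_def G_def by (simp only: gaussian_regularized_plancherel[OF f d])
  qed
  also have "of_real (1 / ?c) * (\<integral>w. of_real (gaussian (w :: real ^ 'n)) * L2_inner lebesgue f f \<partial>lborel) = L2_inner lebesgue f f"
  proof -
    have "(\<integral>w. of_real (gaussian (w :: real ^ 'n)) * L2_inner lebesgue f f \<partial>lborel) = of_real ?c * L2_inner lebesgue f f"
      by (simp only: integral_mult_left_zero integral_complex_of_real integral_gaussian)
    then show ?thesis using gaussian_mass_pos[where 'a="real ^ 'n"] by (simp add: integral_gaussian)
  qed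
  finally have Ilim: "I \<longlonglongrightarrow> L2_inner lebesgue f f" .
  have "(\<lambda>m. sqrt (Re (I m))) \<longlonglongrightarrow> sqrt (Re (L2_inner lebesgue f f))"
    by (intro tendsto_intros Ilim)
  then have tlim: "(\<lambda>m. L2_norm lebesgue (t m)) \<longlonglongrightarrow> ?N"
    by (simp add: tn[symmetric] L2_inner_self del: of_real_power)
  have Fm: "F \<in> borel_measurable lebesgue" by (rule borel_measurable_lebesgue) measurable
  have ptw: "AE \<xi> in lebesgue. (\<lambda>m. t m \<xi>) \<longlonglongrightarrow> F \<xi>"
  proof (rule AE_I2)
    fix \<xi> :: "real ^ 'n"
    have "(\<lambda>m. (d m / sqrt 2) *\<^sub>R \<xi>) \<longlonglongrightarrow> (0 / sqrt 2) *\<^sub>R \<xi>" by (intro tendsto_intros dlim) simp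
    moreover have "isCont gaussian (0 :: real ^ 'n)" unfolding gaussian_def[abs_def] by (intro continuous_intros) simp
    ultimately have "(\<lambda>m. gaussian ((d m / sqrt 2) *\<^sub>R \<xi>)) \<longlonglongrightarrow> gaussian (0 :: real ^ 'n)"
      by (intro isCont_tendsto_compose[of 0 gaussian]) simp_all
    then have "(\<lambda>m. t m \<xi>) \<longlonglongrightarrow> F \<xi> * of_real (gaussian (0 :: real ^ 'n))"
      unfolding t_def by (intro tendsto_intros)
    then show "(\<lambda>m. t m \<xi>) \<longlonglongrightarrow> F \<xi>" by simp
  qed
  have up: "F \<in> L2 lebesgue \<and> L2_norm lebesgue F \<le> ?N + e" if e: "0 < e" for e
  proof -
    have "\<forall>\<^sub>F m in sequentially. L2_norm lebesgue (t m) < ?N + e" by (rule order_tendstoD(2)[OF tlim]) (use e in simp)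
    then have "\<forall>\<^sub>F m in sequentially. L2_norm lebesgue (t m) \<le> ?N + e" by eventually_elim simp
    from L2_Fatou[OF tL Fm ptw this] e show ?thesis by (simp add: add_nonneg_nonneg)
  qed
  have FL: "F \<in> L2 lebesgue" using up[of 1] by simp
  then show "fourier_integral f \<in> L2 lebesgue" by (simp add: F_def)
  have "L2_norm lebesgue F \<le> ?N" by (rule field_le_epsilon) (use up in blast)
  moreover have "?N \<le> L2_norm lebesgue F"
  proof (rule LIMSEQ_le_const2[OF tlim])
    have "L2_norm lebesgue (t m) \<le> L2_norm lebesgue F" for m
      unfolding L2_norm_def
    proof (intro real_sqrt_le_mono integral_mono L2_integrable_sq tL FL power_mono)
      show "cmod (t m \<xi>) \<le> cmod (F \<xi>)" for \<xi>
        unfolding t_def by (simp add: norm_mult mult_left_le gaussian_le_1)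
    qed simp
    then show "\<exists>M. \<forall>m\<ge>M. L2_norm lebesgue (t m) \<le> L2_norm lebesgue F" by blast
  qed
  ultimately show "L2_norm lebesgue (fourier_integral f) = ?N" by (simp add: F_def)
qed

lemma integrable_borel_representative:
  fixes f :: "real ^ 'n \<Rightarrow> complex"
  assumes f: "integrable lebesgue f"
  obtains f' where "f' \<in> borel_measurable borel" "AE x in lebesgue. f x = f' x" "integrable lborel f'"
    "fourier_integral f = fourier_integral f'"
proof -
  have fm: "f \<in> borel_measurable lebesgue" using f by (rule borel_measurable_integrable)
  obtain f' where f': "f' \<in> borel_measurable borel" "AE x in lebesgue. f x = f' x"
    using borel_representative[OF fm] by blast
  have fm': "f' \<in> borel_measurable lebesgue" by (rule borel_measurable_lebesgue[OF f'(1)])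
  have "integrable lebesgue f'" using integrable_cong_AE[OF fm fm' f'(2)] f by simp
  then have "integrable lborel f'" by (simp only: integrable_lebesgue_lborel[OF f'(1)])
  then show ?thesis using that[OF f'] fourier_integral_cong_AE[OF fm fm' f'(2)] by simp
qed

lemma plancherel_L1_L2:
  fixes f :: "real ^ 'n \<Rightarrow> complex"
  assumes i: "integrable lebesgue f" and f: "f \<in> L2 lebesgue"
  shows "fourier_integral f \<in> L2 lebesgue" "L2_norm lebesgue (fourier_integral f) = L2_norm lebesgue f"
proof -
  obtain f' where f': "f' \<in> borel_measurable borel" "AE x in lebesgue. f x = f' x" "integrable lborel f'"
    "fourier_integral f = fourier_integral f'"
    by (rule integrable_borel_representative[OF i])
  have fm': "f' \<in> borel_measurable lebesgue" by (rule borel_measurable_lebesgue[OF f'(1)])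
  have L': "f' \<in> L2 lebesgue" by (rule L2_cong_AE[OF f fm' f'(2)])
  have "L2_norm lebesgue f = L2_norm lebesgue f'" by (rule L2_norm_cong_AE[OF L2_measurable[OF f] fm' f'(2)])
  then show "fourier_integral f \<in> L2 lebesgue" "L2_norm lebesgue (fourier_integral f) = L2_norm lebesgue f"
    using plancherel_borel[OF f'(1,3) L'] f'(4) by simp_all
qed

lemma fourier_multiplication:
  fixes f g :: "real ^ 'n \<Rightarrow> complex"
  assumes f: "integrable lebesgue f" and g: "integrable lebesgue g"
  shows "(\<integral>x. fourier_integral f x * g x \<partial>lebesgue) = (\<integral>x. f x * fourier_integral g x \<partial>lebesgue)"
proof -
  obtain f' where f': "f' \<in> borel_measurable borel" "AE x in lebesgue. f x = f' x" "integrable lborel f'" "fourier_integral f = fourier_integral f'"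
    by (rule integrable_borel_representative[OF f])
  obtain g' where g': "g' \<in> borel_measurable borel" "AE x in lebesgue. g x = g' x" "integrable lborel g'" "fourier_integral g = fourier_integral g'"
    by (rule integrable_borel_representative[OF g])
  note m = borel_measurable_integrable[OF f] borel_measurable_integrable[OF g]
    borel_measurable_lebesgue[OF f'(1)] borel_measurable_lebesgue[OF g'(1)]
  have Fm: "fourier_integral f' \<in> borel_measurable borel" "fourier_integral g' \<in> borel_measurable borel"
    using m by (simp_all add: borel_measurable_fourier_integral)
  note Fm' = Fm[THEN borel_measurable_lebesgue]
  have "(\<integral>x. fourier_integral f x * g x \<partial>lebesgue) = (\<integral>x. fourier_integral f' x * g' x \<partial>lebesgue)"
    unfolding f'(4) by (intro integral_cong_AE borel_measurable_times Fm' m) (use g'(2) in auto)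
  also have "\<dots> = (\<integral>x. fourier_integral f' x * g' x \<partial>lborel)"
    by (intro integral_lebesgue_lborel borel_measurable_times Fm g'(1))
  also have "\<dots> = (\<integral>x. f' x * fourier_integral g' x \<partial>lborel)"
    by (rule fourier_multiplication_borel[OF f'(3) g'(3)])
  also have "\<dots> = (\<integral>x. f' x * fourier_integral g' x \<partial>lebesgue)"
    by (intro integral_lebesgue_lborel[symmetric] borel_measurable_times Fm f'(1))
  also have "\<dots> = (\<integral>x. f x * fourier_integral g x \<partial>lebesgue)"
    unfolding g'(4) by (intro integral_cong_AE borel_measurable_times Fm' m) (use f'(2) in auto)
  finally show ?thesis .
qed

section \<open>The Fourier transform of square integrable functions\<close>

lemma L2_converges_diff:
  assumes "\<And>m. s m \<in> L2 M" "\<And>m. t m \<in> L2 M" "f \<in> L2 M" "g \<in> L2 M" "L2_converges M s f" "L2_converges M t g"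
  shows "L2_converges M (\<lambda>m. s m - t m) (f - g)"
  unfolding L2_converges_def
proof (rule Lim_null_comparison)
  show "(\<lambda>m. L2_norm M (s m - f) + L2_norm M (t m - g)) \<longlonglongrightarrow> 0"
    using assms(5,6) unfolding L2_converges_def by (rule tendsto_add_zero)
  have "L2_norm M ((s m - t m) - (f - g)) \<le> L2_norm M (s m - f) + L2_norm M (t m - g)" for m
  proof -
    have "(s m - t m) - (f - g) = (s m - f) + (g - t m)" by (simp add: fun_eq_iff)
    then have "L2_norm M ((s m - t m) - (f - g)) \<le> L2_norm M (s m - f) + L2_norm M (g - t m)"
      using L2_norm_triangle[OF L2_diff[OF assms(1,3)] L2_diff[OF assms(4,2)]] by (simp only:)
    then show ?thesis by (simp only: L2_norm_minus_commute)
  qed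
  then show "\<forall>\<^sub>F m in sequentially. norm (L2_norm M ((s m - t m) - (f - g))) \<le> L2_norm M (s m - f) + L2_norm M (t m - g)"
    by (intro always_eventually) simp
qed

lemma L2_converges_cscale:
  assumes "L2_converges M s f" shows "L2_converges M (\<lambda>m. cscale c (s m)) (cscale c f)"
proof -
  have "cscale c (s m) - cscale c f = cscale c (s m - f)" for m by (simp add: fun_eq_iff algebra_simps)
  then have "L2_norm M (cscale c (s m) - cscale c f) = cmod c * L2_norm M (s m - f)" for m
    by (simp only: L2_norm_cscale)
  then show ?thesis using assms unfolding L2_converges_def by (simp only: tendsto_mult_right_zero)
qed

text \<open>Multiplied by the indicator of a bounded box, a square integrable function becomes
  integrable; dominated convergence of the squared errors gives convergence in norm.\<close>

lemma L2_truncation_converges: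
  fixes f :: "'a::euclidean_space \<Rightarrow> complex"
  assumes f: "f \<in> L2 lebesgue"
  obtains s where "\<And>m. s m \<in> L2 lebesgue" "\<And>m. integrable lebesgue (s m)" "L2_converges lebesgue s f"
proof -
  let ?B = "\<lambda>m::nat. box (- real m *\<^sub>R One) (real m *\<^sub>R One) :: 'a set"
  define s where "s m x = cind (?B m) x * f x" for m x
  have fm: "f \<in> borel_measurable lebesgue" using f by (rule L2_measurable)
  have cm: "cind (?B m) \<in> borel_measurable lebesgue" for m using cind_box_L2 by (rule L2_measurable)
  have si: "integrable lebesgue (s m)" for m
    unfolding s_def[abs_def] by (rule L2_integrable_prod[OF cind_box_L2 f])
  have sL: "s m \<in> L2 lebesgue" for m
  proof (rule L2I)
    show "s m \<in> borel_measurable lebesgue" using si by (rule borel_measurable_integrable)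
    then have "(\<lambda>x. (cmod (s m x))\<^sup>2) \<in> borel_measurable lebesgue" by measurable
    then show "integrable lebesgue (\<lambda>x. (cmod (s m x))\<^sup>2)"
      by (rule Bochner_Integration.integrable_bound[OF L2_integrable_sq[OF f]])
        (intro AE_I2, simp add: s_def cind_def indicator_def)
  qed
  have "(\<lambda>m. \<integral>x. (cmod ((s m - f) x))\<^sup>2 \<partial>lebesgue) \<longlonglongrightarrow> (\<integral>x. 0 \<partial>(lebesgue :: 'a measure))"
  proof (rule integral_dominated_convergence)
    show "integrable lebesgue (\<lambda>x. (cmod (f x))\<^sup>2)" by (rule L2_integrable_sq[OF f])
    show "(\<lambda>x. (cmod ((s m - f) x))\<^sup>2) \<in> borel_measurable lebesgue" for m
      using L2_integrable_sq[OF L2_diff[OF sL f], of m] by (rule borel_measurable_integrable)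
    show "AE x in lebesgue. norm ((cmod ((s m - f) x))\<^sup>2) \<le> (cmod (f x))\<^sup>2" for m
      by (intro AE_I2) (simp add: s_def cind_def indicator_def)
    show "AE x in lebesgue. (\<lambda>m. (cmod ((s m - f) x))\<^sup>2) \<longlonglongrightarrow> 0"
    proof (rule AE_I2)
      fix x :: 'a
      have "(\<lambda>m. s m x) \<longlonglongrightarrow> of_real 1 * f x"
        unfolding s_def cind_def by (intro tendsto_intros indicator_box_tendsto)
      then have "(\<lambda>m. (cmod (s m x - f x))\<^sup>2) \<longlonglongrightarrow> (cmod (of_real 1 * f x - f x))\<^sup>2" by (intro tendsto_intros)
      then show "(\<lambda>m. (cmod ((s m - f) x))\<^sup>2) \<longlonglongrightarrow> 0" by simp
    qed
  qed simp
  then have "(\<lambda>m. sqrt (\<integral>x. (cmod ((s m - f) x))\<^sup>2 \<partial>lebesgue)) \<longlonglongrightarrow> sqrt 0"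
    by (intro tendsto_real_sqrt) simp
  then have "L2_converges lebesgue s f" by (simp add: L2_converges_def L2_norm_def)
  then show ?thesis using that sL si by blast
qed

lemma is_fourier_transformE:
  assumes "is_fourier_transform f g"
  obtains s where "\<And>m. s m \<in> L2 lebesgue" "\<And>m. integrable lebesgue (s m)" "L2_converges lebesgue s f"
    "\<And>m. fourier_integral (s m) \<in> L2 lebesgue" "L2_converges lebesgue (\<lambda>m. fourier_integral (s m)) g"
  using assms plancherel_L1_L2(1) unfolding is_fourier_transform_def by blast

lemma is_fourier_transform_L2: "is_fourier_transform f g \<Longrightarrow> g \<in> L2 lebesgue"
  by (simp add: is_fourier_transform_def)

lemma is_fourier_transformI:
  "g \<in> L2 lebesgue \<Longrightarrow> (\<And>m. s m \<in> L2 lebesgue) \<Longrightarrow> (\<And>m. integrable lebesgue (s m)) \<Longrightarrow> L2_converges lebesgue s f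
   \<Longrightarrow> L2_converges lebesgue (\<lambda>m. fourier_integral (s m)) g \<Longrightarrow> is_fourier_transform f g"
  unfolding is_fourier_transform_def by blast

lemma is_fourier_transform_norm:
  assumes "f \<in> L2 lebesgue" "is_fourier_transform f g" shows "L2_norm lebesgue g = L2_norm lebesgue f"
proof -
  obtain s where s: "\<And>m. s m \<in> L2 lebesgue" "\<And>m. integrable lebesgue (s m)" "L2_converges lebesgue s f"
    "\<And>m. fourier_integral (s m) \<in> L2 lebesgue" "L2_converges lebesgue (\<lambda>m. fourier_integral (s m)) g"
    using is_fourier_transformE[OF assms(2)] by blast
  have "(\<lambda>m. L2_norm lebesgue (fourier_integral (s m))) \<longlonglongrightarrow> L2_norm lebesgue g"
    by (rule L2_converges_norm[OF s(4) is_fourier_transform_L2[OF assms(2)] s(5)])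
  moreover have "(\<lambda>m. L2_norm lebesgue (fourier_integral (s m))) \<longlonglongrightarrow> L2_norm lebesgue f"
    unfolding plancherel_L1_L2(2)[OF s(2,1)] by (rule L2_converges_norm[OF s(1) assms(1) s(3)])
  ultimately show ?thesis by (rule LIMSEQ_unique)
qed

text \<open>The isometry on integrable functions carries the Cauchy property of an approximating
  sequence over to its Fourier integrals, and completeness supplies their limit.\<close>

lemma is_fourier_transform_exists:
  assumes f: "f \<in> L2 lebesgue" shows "\<exists>g. is_fourier_transform f g"
proof -
  obtain s where s: "\<And>m. s m \<in> L2 lebesgue" "\<And>m. integrable lebesgue (s m)" "L2_converges lebesgue s f"
    using L2_truncation_converges[OF f] by blast
  have FL: "fourier_integral (s m) \<in> L2 lebesgue" for m using plancherel_L1_L2(1)[OF s(2,1)] .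
  have "\<exists>g\<in>L2 lebesgue. L2_converges lebesgue (\<lambda>m. fourier_integral (s m)) g"
  proof (rule L2_complete[OF FL])
    fix e :: real assume "0 < e"
    then obtain N where N: "\<And>m. m \<ge> N \<Longrightarrow> L2_norm lebesgue (s m - f) < e / 2"
      using order_tendstoD(2)[OF s(3)[unfolded L2_converges_def], of "e/2"] by (auto simp: eventually_sequentially)
    have "L2_norm lebesgue (fourier_integral (s m) - fourier_integral (s n)) < e" if "m \<ge> N" "n \<ge> N" for m n
    proof -
      have "L2_norm lebesgue (fourier_integral (s m) - fourier_integral (s n)) = L2_norm lebesgue (fourier_integral (s m - s n))"
        by (simp only: fourier_integral_diff[OF s(2) s(2)])
      also have "\<dots> = L2_norm lebesgue (s m - s n)"
        using Bochner_Integration.integrable_diff[OF s(2) s(2), of m n]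
        by (intro plancherel_L1_L2(2) L2_diff s) (simp add: fun_diff_def)
      also have "\<dots> \<le> L2_norm lebesgue (s m - f) + L2_norm lebesgue (f - s n)"
        by (rule L2_norm_triangle_diff[OF s(1) f s(1)])
      also have "\<dots> < e" using N[OF that(1)] N[OF that(2)] L2_norm_minus_commute[of lebesgue f "s n"] by linarith
      finally show ?thesis .
    qed
    then show "\<exists>N. \<forall>m\<ge>N. \<forall>n\<ge>N. L2_norm lebesgue (fourier_integral (s m) - fourier_integral (s n)) < e" by blast
  qed
  then obtain g where "g \<in> L2 lebesgue" "L2_converges lebesgue (\<lambda>m. fourier_integral (s m)) g" by blast
  then show ?thesis using is_fourier_transformI[OF _ s] by blast
qed

lemma fourier_is_fourier_transform: "f \<in> L2 lebesgue \<Longrightarrow> is_fourier_transform f (fourier f)"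
  unfolding fourier_def by (rule someI_ex[OF is_fourier_transform_exists])

lemma fourier_L2: "f \<in> L2 lebesgue \<Longrightarrow> fourier f \<in> L2 lebesgue"
  using fourier_is_fourier_transform is_fourier_transform_L2 by blast

lemma is_fourier_transform_diff:
  assumes "f \<in> L2 lebesgue" "f' \<in> L2 lebesgue" "is_fourier_transform f g" "is_fourier_transform f' g'"
  shows "is_fourier_transform (f - f') (g - g')"
proof -
  obtain s where s: "\<And>m. s m \<in> L2 lebesgue" "\<And>m. integrable lebesgue (s m)" "L2_converges lebesgue s f"
    "\<And>m. fourier_integral (s m) \<in> L2 lebesgue" "L2_converges lebesgue (\<lambda>m. fourier_integral (s m)) g"
    using is_fourier_transformE[OF assms(3)] by blast
  obtain t where t: "\<And>m. t m \<in> L2 lebesgue" "\<And>m. integrable lebesgue (t m)" "L2_converges lebesgue t f'"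
    "\<And>m. fourier_integral (t m) \<in> L2 lebesgue" "L2_converges lebesgue (\<lambda>m. fourier_integral (t m)) g'"
    using is_fourier_transformE[OF assms(4)] by blast
  note gL = is_fourier_transform_L2[OF assms(3)] is_fourier_transform_L2[OF assms(4)]
  show ?thesis
  proof (rule is_fourier_transformI[of _ "\<lambda>m. s m - t m"])
    show "g - g' \<in> L2 lebesgue" by (rule L2_diff[OF gL])
    show "s m - t m \<in> L2 lebesgue" for m by (rule L2_diff[OF s(1) t(1)])
    show "integrable lebesgue (s m - t m)" for m
      unfolding fun_diff_def by (rule Bochner_Integration.integrable_diff[OF s(2) t(2)])
    show "L2_converges lebesgue (\<lambda>m. s m - t m) (f - f')" by (rule L2_converges_diff[OF s(1) t(1) assms(1,2) s(3) t(3)])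
    show "L2_converges lebesgue (\<lambda>m. fourier_integral (s m - t m)) (g - g')"
      unfolding fourier_integral_diff[OF s(2) t(2)] by (rule L2_converges_diff[OF s(4) t(4) gL s(5) t(5)])
  qed
qed

lemma is_fourier_transform_cscale:
  assumes "is_fourier_transform f g" shows "is_fourier_transform (cscale c f) (cscale c g)"
proof -
  obtain s where s: "\<And>m. s m \<in> L2 lebesgue" "\<And>m. integrable lebesgue (s m)" "L2_converges lebesgue s f"
    "\<And>m. fourier_integral (s m) \<in> L2 lebesgue" "L2_converges lebesgue (\<lambda>m. fourier_integral (s m)) g"
    using is_fourier_transformE[OF assms] by blast
  show ?thesis
  proof (rule is_fourier_transformI[of _ "\<lambda>m. cscale c (s m)"])
    show "cscale c g \<in> L2 lebesgue" by (rule L2_cscale[OF is_fourier_transform_L2[OF assms]])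
    show "cscale c (s m) \<in> L2 lebesgue" for m by (rule L2_cscale[OF s(1)])
    show "integrable lebesgue (cscale c (s m))" for m
      unfolding cscale_def by (rule integrable_mult_right[OF s(2)])
    show "L2_converges lebesgue (\<lambda>m. cscale c (s m)) (cscale c f)" by (rule L2_converges_cscale[OF s(3)])
    show "L2_converges lebesgue (\<lambda>m. fourier_integral (cscale c (s m))) (cscale c g)"
      unfolding fourier_integral_cscale by (rule L2_converges_cscale[OF s(5)])
  qed
qed

lemma is_fourier_transform_add:
  assumes "f \<in> L2 lebesgue" "f' \<in> L2 lebesgue" "is_fourier_transform f g" "is_fourier_transform f' g'"
  shows "is_fourier_transform (f + f') (g + g')"
proof -
  have e: "u + v = u - cscale (-1) v" for u v :: "real ^ 'n \<Rightarrow> complex" by (simp add: fun_eq_iff)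
  show ?thesis unfolding e
    by (rule is_fourier_transform_diff[OF assms(1) L2_cscale[OF assms(2)] assms(3) is_fourier_transform_cscale[OF assms(4)]])
qed

text \<open>Both equalities say that a difference has norm zero, and the transform preserves norms.
  One direction shows that the choice made in \<open>fourier\<close> affects only a null set, the
  other that the transform is injective.\<close>

lemma is_fourier_transform_AE_iff:
  assumes "f \<in> L2 lebesgue" "f' \<in> L2 lebesgue" "is_fourier_transform f g" "is_fourier_transform f' g'"
  shows "(AE x in lebesgue. f x = f' x) \<longleftrightarrow> (AE x in lebesgue. g x = g' x)"
proof -
  note gL = is_fourier_transform_L2[OF assms(3)] is_fourier_transform_L2[OF assms(4)]
  have "(AE x in lebesgue. f x = f' x) \<longleftrightarrow> L2_norm lebesgue (f - f') = 0"
    by (subst L2_norm_eq_0_iff[OF L2_diff[OF assms(1,2)]]) simp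
  also have "\<dots> \<longleftrightarrow> L2_norm lebesgue (g - g') = 0"
    using is_fourier_transform_norm[OF L2_diff[OF assms(1,2)] is_fourier_transform_diff[OF assms]] by simp
  also have "\<dots> \<longleftrightarrow> (AE x in lebesgue. g x = g' x)"
    by (subst L2_norm_eq_0_iff[OF L2_diff[OF gL]]) simp
  finally show ?thesis .
qed

lemma is_fourier_transform_cong_AE:
  assumes "is_fourier_transform f g" "g' \<in> borel_measurable lebesgue" "AE x in lebesgue. g x = g' x"
  shows "is_fourier_transform f g'"
proof -
  obtain s where s: "\<And>m. s m \<in> L2 lebesgue" "\<And>m. integrable lebesgue (s m)" "L2_converges lebesgue s f"
    "\<And>m. fourier_integral (s m) \<in> L2 lebesgue" "L2_converges lebesgue (\<lambda>m. fourier_integral (s m)) g"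
    using is_fourier_transformE[OF assms(1)] by blast
  have gL: "g \<in> L2 lebesgue" by (rule is_fourier_transform_L2[OF assms(1)])
  have gL': "g' \<in> L2 lebesgue" by (rule L2_cong_AE[OF gL assms(2,3)])
  have "L2_norm lebesgue (fourier_integral (s m) - g) = L2_norm lebesgue (fourier_integral (s m) - g')" for m
    by (rule L2_norm_cong_AE[OF L2_measurable[OF L2_diff[OF s(4) gL]] L2_measurable[OF L2_diff[OF s(4) gL']]])
      (use assms(3) in auto)
  then have "L2_converges lebesgue (\<lambda>m. fourier_integral (s m)) g'" using s(5) by (simp add: L2_converges_def)
  then show ?thesis by (rule is_fourier_transformI[OF gL' s(1-3)])
qed

text \<open>Polarization: the norms of sums determine the real part, and
  \<open>Re (- \<i> * z) = Im z\<close> reduces the imaginary part to it.\<close>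

lemma is_fourier_transform_inner:
  assumes f: "f \<in> L2 lebesgue" "f' \<in> L2 lebesgue" and g: "is_fourier_transform f g" "is_fourier_transform f' g'"
  shows "L2_inner lebesgue g g' = L2_inner lebesgue f f'"
proof -
  have re: "Re (L2_inner lebesgue g g') = Re (L2_inner lebesgue f f')"
    if f: "f \<in> L2 lebesgue" "f' \<in> L2 lebesgue" and g: "is_fourier_transform f g" "is_fourier_transform f' g'" for f f' g g' :: "real ^ 'n \<Rightarrow> complex"
  proof -
    note gL = is_fourier_transform_L2[OF g(1)] is_fourier_transform_L2[OF g(2)]
    have "(L2_norm lebesgue (g + g'))\<^sup>2 = (L2_norm lebesgue (f + f'))\<^sup>2"
      by (simp only: is_fourier_transform_norm[OF L2_add[OF f] is_fourier_transform_add[OF f g]])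
    then show ?thesis
      unfolding L2_norm_add_sq[OF gL] L2_norm_add_sq[OF f]
        is_fourier_transform_norm[OF f(1) g(1)] is_fourier_transform_norm[OF f(2) g(2)] by simp
  qed
  have "Re (L2_inner lebesgue (cscale (- \<i>) g) g') = Re (L2_inner lebesgue (cscale (- \<i>) f) f')"
    by (rule re[OF L2_cscale[OF f(1)] f(2) is_fourier_transform_cscale[OF g(1)] g(2)])
  then have "Im (L2_inner lebesgue g g') = Im (L2_inner lebesgue f f')" unfolding L2_inner_cscale_left by simp
  with re[OF f g] show ?thesis by (simp add: complex_eq_iff)
qed

text \<open>Two successive limits, one in each argument, extend the formula from integrable
  functions. The conjugations write the bilinear integrals as values of \<open>L2_inner\<close>,
  whose continuity is known.\<close>

lemma is_fourier_transform_multiplication: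
  assumes f: "f \<in> L2 lebesgue" "f' \<in> L2 lebesgue" and g: "is_fourier_transform f g" "is_fourier_transform f' g'"
  shows "L2_inner lebesgue g (\<lambda>x. cnj (f' x)) = L2_inner lebesgue f (\<lambda>x. cnj (g' x))"
proof -
  obtain s where s: "\<And>m. s m \<in> L2 lebesgue" "\<And>m. integrable lebesgue (s m)" "L2_converges lebesgue s f"
    "\<And>m. fourier_integral (s m) \<in> L2 lebesgue" "L2_converges lebesgue (\<lambda>m. fourier_integral (s m)) g"
    using is_fourier_transformE[OF g(1)] by blast
  obtain t where t: "\<And>m. t m \<in> L2 lebesgue" "\<And>m. integrable lebesgue (t m)" "L2_converges lebesgue t f'"
    "\<And>m. fourier_integral (t m) \<in> L2 lebesgue" "L2_converges lebesgue (\<lambda>m. fourier_integral (t m)) g'"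
    using is_fourier_transformE[OF g(2)] by blast
  note gL = is_fourier_transform_L2[OF g(1)] is_fourier_transform_L2[OF g(2)]
  have sym: "L2_inner lebesgue u (\<lambda>x. cnj (v x)) = L2_inner lebesgue v (\<lambda>x. cnj (u x))" for u v :: "real ^ 'n \<Rightarrow> complex"
    by (simp add: L2_inner_def mult.commute)
  have 1: "L2_inner lebesgue g (\<lambda>x. cnj (t l x)) = L2_inner lebesgue f (\<lambda>x. cnj (fourier_integral (t l) x))" for l
  proof (rule LIMSEQ_unique)
    show "(\<lambda>m. L2_inner lebesgue (fourier_integral (s m)) (\<lambda>x. cnj (t l x))) \<longlonglongrightarrow> L2_inner lebesgue g (\<lambda>x. cnj (t l x))"
      by (rule L2_converges_inner[OF s(4) gL(1) L2_cnj[OF t(1)] s(5)])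
    have "L2_inner lebesgue (fourier_integral (s m)) (\<lambda>x. cnj (t l x)) = L2_inner lebesgue (s m) (\<lambda>x. cnj (fourier_integral (t l) x))" for m
      using fourier_multiplication[OF s(2) t(2), of m l] by (simp add: L2_inner_def)
    then show "(\<lambda>m. L2_inner lebesgue (fourier_integral (s m)) (\<lambda>x. cnj (t l x))) \<longlonglongrightarrow> L2_inner lebesgue f (\<lambda>x. cnj (fourier_integral (t l) x))"
      by (simp only: L2_converges_inner[OF s(1) f(1) L2_cnj[OF t(4)] s(3)])
  qed
  show ?thesis
  proof (rule LIMSEQ_unique)
    show "(\<lambda>l. L2_inner lebesgue (t l) (\<lambda>x. cnj (g x))) \<longlonglongrightarrow> L2_inner lebesgue g (\<lambda>x. cnj (f' x))"
      unfolding sym[of g f'] by (rule L2_converges_inner[OF t(1) f(2) L2_cnj[OF gL(1)] t(3)])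
    have "L2_inner lebesgue (t l) (\<lambda>x. cnj (g x)) = L2_inner lebesgue (fourier_integral (t l)) (\<lambda>x. cnj (f x))" for l
      using 1[of l] unfolding sym[of g "t l"] sym[of f "fourier_integral (t l)"] .
    then show "(\<lambda>l. L2_inner lebesgue (t l) (\<lambda>x. cnj (g x))) \<longlonglongrightarrow> L2_inner lebesgue f (\<lambda>x. cnj (g' x))"
      unfolding sym[of f g'] by (simp only: L2_converges_inner[OF t(4) gL(2) L2_cnj[OF f(1)] t(5)])
  qed
qed

text \<open>Preimages in \<open>V\<close> of a convergent sequence are Cauchy because the transform
  is isometric; their limit lies in \<open>V\<close>, and its transform equals the given limit
  almost everywhere.\<close>

lemma closed_subspace_fourier_image:
  fixes V :: "(real ^ 'n \<Rightarrow> complex) set"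
  assumes V: "closed_subspace lebesgue V"
  shows "closed_subspace lebesgue {g. \<exists>f\<in>V. is_fourier_transform f g}"
  unfolding closed_subspace_def
proof (intro conjI allI impI)
  let ?W = "{g. \<exists>f\<in>V. is_fourier_transform f g}"
  note VD = closed_subspaceD[OF V]
  have VL: "f \<in> L2 lebesgue" if "f \<in> V" for f using VD(1) that by blast
  show WL: "?W \<subseteq> L2 lebesgue" using is_fourier_transform_L2 by blast
  show "cfun.subspace ?W"
    unfolding cfun.subspace_def
  proof (intro conjI ballI allI)
    have "is_fourier_transform (cscale 0 0) (cscale 0 (fourier (0 :: real ^ 'n \<Rightarrow> complex)))"
      by (rule is_fourier_transform_cscale[OF fourier_is_fourier_transform]) simp
    moreover have "cscale 0 h = 0" for h :: "real ^ 'n \<Rightarrow> complex" by (simp add: fun_eq_iff)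
    ultimately have "is_fourier_transform (0 :: real ^ 'n \<Rightarrow> complex) 0" by (simp only:)
    then show "0 \<in> ?W" using cfun.subspace_0[OF VD(2)] by blast
  next
    fix g g' assume "g \<in> ?W" "g' \<in> ?W"
    then obtain f f' where f: "f \<in> V" "is_fourier_transform f g" and f': "f' \<in> V" "is_fourier_transform f' g'" by blast
    have "is_fourier_transform (f + f') (g + g')" by (rule is_fourier_transform_add[OF VL[OF f(1)] VL[OF f'(1)] f(2) f'(2)])
    moreover have "f + f' \<in> V" by (rule cfun.subspace_add[OF VD(2) f(1) f'(1)])
    ultimately show "g + g' \<in> ?W" by blast
  next
    fix c g assume "g \<in> ?W"
    then obtain f where f: "f \<in> V" "is_fourier_transform f g" by blast
    have "is_fourier_transform (cscale c f) (cscale c g)" by (rule is_fourier_transform_cscale[OF f(2)])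
    moreover have "cscale c f \<in> V" by (rule cfun.subspace_scale[OF VD(2) f(1)])
    ultimately show "cscale c g \<in> ?W" by blast
  qed
  fix s g assume *: "(\<forall>m. s m \<in> ?W) \<and> g \<in> L2 lebesgue \<and> L2_converges lebesgue s g"
  then have g: "g \<in> L2 lebesgue" and lim: "L2_converges lebesgue s g" by blast+
  have "\<forall>m. \<exists>f. f \<in> V \<and> is_fourier_transform f (s m)" using * by blast
  then obtain t where t: "\<And>m. t m \<in> V" "\<And>m. is_fourier_transform (t m) (s m)" by metis
  have tL: "t m \<in> L2 lebesgue" for m by (rule VL[OF t(1)])
  have sL: "s m \<in> L2 lebesgue" for m by (rule is_fourier_transform_L2[OF t(2)])
  have "\<exists>f\<in>L2 lebesgue. L2_converges lebesgue t f"
  proof (rule L2_complete[OF tL])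
    fix e :: real assume "0 < e"
    then obtain N where N: "\<And>m. m \<ge> N \<Longrightarrow> L2_norm lebesgue (s m - g) < e / 2"
      using order_tendstoD(2)[OF lim[unfolded L2_converges_def], of "e/2"] by (auto simp: eventually_sequentially)
    have "L2_norm lebesgue (t m - t n) < e" if "m \<ge> N" "n \<ge> N" for m n
    proof -
      have "L2_norm lebesgue (t m - t n) = L2_norm lebesgue (s m - s n)"
        by (rule is_fourier_transform_norm[OF L2_diff[OF tL tL] is_fourier_transform_diff[OF tL tL t(2) t(2)], symmetric])
      also have "\<dots> \<le> L2_norm lebesgue (s m - g) + L2_norm lebesgue (g - s n)"
        by (rule L2_norm_triangle_diff[OF sL g sL])
      also have "\<dots> < e" using N[OF that(1)] N[OF that(2)] L2_norm_minus_commute[of lebesgue g "s n"] by linarith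
      finally show ?thesis .
    qed
    then show "\<exists>N. \<forall>m\<ge>N. \<forall>n\<ge>N. L2_norm lebesgue (t m - t n) < e" by blast
  qed
  then obtain f where f: "f \<in> L2 lebesgue" "L2_converges lebesgue t f" by blast
  have fV: "f \<in> V" by (rule VD(3)[OF t(1) f])
  have Ff: "is_fourier_transform f (fourier f)" by (rule fourier_is_fourier_transform[OF f(1)])
  have "L2_norm lebesgue (s m - fourier f) = L2_norm lebesgue (t m - f)" for m
    by (rule is_fourier_transform_norm[OF L2_diff[OF tL f(1)] is_fourier_transform_diff[OF tL f(1) t(2) Ff]])
  then have "L2_converges lebesgue s (fourier f)" using f(2) by (simp add: L2_converges_def)
  then have "AE x in lebesgue. fourier f x = g x"
    by (rule L2_converges_unique[OF sL fourier_L2[OF f(1)] g _ lim])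
  then have "is_fourier_transform f g" by (rule is_fourier_transform_cong_AE[OF Ff L2_measurable[OF g]])
  then show "g \<in> ?W" using fV by blast
qed

text \<open>By the multiplication formula, a function orthogonal to the range of the Fourier transform has
  a conjugate whose transform vanishes.\<close>

lemma is_fourier_transform_surj:
  fixes h :: "real ^ 'n \<Rightarrow> complex"
  assumes h: "h \<in> L2 lebesgue" shows "\<exists>f\<in>L2 lebesgue. is_fourier_transform f h"
proof -
  let ?W = "{g :: real ^ 'n \<Rightarrow> complex. \<exists>f\<in>L2 lebesgue. is_fourier_transform f g}"
  have W: "closed_subspace lebesgue ?W" by (rule closed_subspace_fourier_image[OF closed_subspace_L2])
  have WL: "?W \<subseteq> L2 lebesgue" by (rule closed_subspaceD(1)[OF W])
  have "closed_span lebesgue ?W = L2 lebesgue"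
    unfolding closed_span_eq_iff[OF closed_subspace_L2 WL]
  proof (intro ballI impI)
    fix g :: "real ^ 'n \<Rightarrow> complex" assume g: "g \<in> L2 lebesgue" "\<forall>w\<in>?W. L2_inner lebesgue g w = 0"
    let ?c = "\<lambda>x. cnj (g x)"
    have c: "?c \<in> L2 lebesgue" by (rule L2_cnj[OF g(1)])
    define k where "k = fourier ?c"
    have k: "is_fourier_transform ?c k" unfolding k_def by (rule fourier_is_fourier_transform[OF c])
    have kL: "k \<in> L2 lebesgue" by (rule is_fourier_transform_L2[OF k])
    \<comment> \<open>Testing orthogonality against the transform of the conjugate of
      \<open>k\<close> makes the other side of the multiplication formula the squared norm of
      \<open>k\<close>.\<close>
    define u where "u = fourier (\<lambda>x. cnj (k x))"
    have u: "is_fourier_transform (\<lambda>x. cnj (k x)) u" unfolding u_def by (rule fourier_is_fourier_transform[OF L2_cnj[OF kL]])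
    have "L2_inner lebesgue u (\<lambda>x. cnj (?c x)) = L2_inner lebesgue (\<lambda>x. cnj (k x)) (\<lambda>x. cnj (k x))"
      by (rule is_fourier_transform_multiplication[OF L2_cnj[OF kL] c u k])
    moreover have "L2_inner lebesgue u (\<lambda>x. cnj (?c x)) = 0"
    proof -
      have "u \<in> ?W" using u L2_cnj[OF kL] by blast
      then have "L2_inner lebesgue g u = 0" using g(2) by blast
      then show ?thesis by (subst L2_inner_commute) simp
    qed
    ultimately have "L2_norm lebesgue (\<lambda>x. cnj (k x)) = 0" by (simp add: L2_inner_self)
    then have "L2_norm lebesgue k = 0" by (simp add: L2_norm_def)
    then have "L2_norm lebesgue ?c = 0" by (simp add: is_fourier_transform_norm[OF c k])
    then show "AE x in lebesgue. g x = 0" using L2_norm_eq_0_iff[OF c] by simp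
  qed
  moreover have "closed_span lebesgue ?W \<subseteq> ?W" by (rule closed_span_minimal[OF W subset_refl])
  ultimately show ?thesis using h by blast
qed

section \<open>Translations become modulations\<close>

lemma fourier_integral_shift:
  fixes f :: "real ^ 'n \<Rightarrow> complex"
  assumes f: "integrable lebesgue f"
  shows "fourier_integral (\<lambda>x. f (x + lattice_vec k)) = modulate k (fourier_integral f)"
proof
  fix \<xi> :: "real ^ 'n"
  have m: "(\<lambda>x. f x * fourier_kernel \<xi> (x - lattice_vec k)) \<in> borel_measurable lebesgue"
  proof (intro borel_measurable_times borel_measurable_integrable[OF f])
    show "(\<lambda>x. fourier_kernel \<xi> (x - lattice_vec k)) \<in> borel_measurable lebesgue"
      by (rule borel_measurable_lebesgue) measurable
  qed
  have "fourier_integral (\<lambda>x. f (x + lattice_vec k)) \<xi> = (\<integral>x. f (x + lattice_vec k) * fourier_kernel \<xi> (x + lattice_vec k - lattice_vec k) \<partial>lebesgue)"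
    unfolding fourier_integral_def by (simp only: add_diff_cancel_right')
  also have "\<dots> = (\<integral>x. f x * fourier_kernel \<xi> (x - lattice_vec k) \<partial>lebesgue)"
    by (rule lebesgue_translate(3)[OF m])
  also have "\<dots> = (\<integral>x. character k \<xi> * (f x * fourier_kernel \<xi> x) \<partial>lebesgue)"
  proof -
    have "f x * fourier_kernel \<xi> (x - lattice_vec k) = character k \<xi> * (f x * fourier_kernel \<xi> x)" for x
      by (simp add: character_def inner_diff_right inner_commute[of \<xi> "lattice_vec k"] algebra_simps exp_add exp_diff exp_minus divide_inverse)
    then show ?thesis by (simp only:)
  qed
  also have "\<dots> = modulate k (fourier_integral f) \<xi>"
    by (simp only: integral_mult_right_zero modulate_def fourier_integral_def)
  finally show "fourier_integral (\<lambda>x. f (x + lattice_vec k)) \<xi> = modulate k (fourier_integral f) \<xi>" .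
qed

text \<open>Translation and modulation both preserve the norm, so the identity for integrable
  functions passes to limits of approximating sequences.\<close>

lemma is_fourier_transform_shift:
  assumes f: "f \<in> L2 lebesgue" and g: "is_fourier_transform f g"
  shows "is_fourier_transform (\<lambda>x. f (x + lattice_vec k)) (modulate k g)"
proof -
  obtain s where s: "\<And>m. s m \<in> L2 lebesgue" "\<And>m. integrable lebesgue (s m)" "L2_converges lebesgue s f"
    "\<And>m. fourier_integral (s m) \<in> L2 lebesgue" "L2_converges lebesgue (\<lambda>m. fourier_integral (s m)) g"
    using is_fourier_transformE[OF g] by blast
  have norm_shift: "L2_norm lebesgue (\<lambda>x. s m (x + lattice_vec k) - f (x + lattice_vec k)) = L2_norm lebesgue (s m - f)" for m
    using L2_translate(2)[OF L2_diff[OF s(1)[of m] f], of "lattice_vec k"] by simp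
  have norm_mod: "L2_norm lebesgue (modulate k u - modulate k v) = L2_norm lebesgue (u - v)" for u v
  proof -
    have "cmod ((modulate k u - modulate k v) x) = cmod ((u - v) x)" for x
      by (simp add: modulate_def right_diff_distrib[symmetric] norm_mult)
    then show ?thesis by (simp only: L2_norm_def)
  qed
  show ?thesis
  proof (rule is_fourier_transformI[of _ "\<lambda>m x. s m (x + lattice_vec k)"])
    show "modulate k g \<in> L2 lebesgue" by (rule modulate_L2[OF is_fourier_transform_L2[OF g]])
    show "(\<lambda>x. s m (x + lattice_vec k)) \<in> L2 lebesgue" for m by (rule L2_translate(1)[OF s(1)])
    show "integrable lebesgue (\<lambda>x. s m (x + lattice_vec k))" for m
      using s(2)[of m] by (simp only: lebesgue_translate(2)[OF L2_measurable[OF s(1)]])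
    show "L2_converges lebesgue (\<lambda>m. fourier_integral (\<lambda>x. s m (x + lattice_vec k))) (modulate k g)"
      using s(5) unfolding fourier_integral_shift[OF s(2)] L2_converges_def norm_mod .
    show "L2_converges lebesgue (\<lambda>m x. s m (x + lattice_vec k)) (\<lambda>x. f (x + lattice_vec k))"
      using s(3) norm_shift by (simp add: L2_converges_def fun_diff_def)
  qed
qed

section \<open>Range functions\<close>

text \<open>Helson's description of a shift-invariant space by a range function, read on the
  transform side.\<close>

definition fiber_space :: "(real ^ 'n \<Rightarrow> (int ^ 'n \<Rightarrow> complex) set) \<Rightarrow> (real ^ 'n \<Rightarrow> complex) set" where
  "fiber_space J = {f \<in> L2 lebesgue. AE x in lebesgue_on torus. lattice_fiber f x \<in> J x}"

lemma AE_torusI: "(\<And>x. x \<in> torus \<Longrightarrow> P x) \<Longrightarrow> AE x in lebesgue_on torus. P x"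
  by (rule AE_I2) (simp add: space_restrict_space)

text \<open>The norm of a function is the \<open>L2\<close> norm over the torus of its fiber norms,
  so choosing indices with geometric errors makes the fiber errors summable at almost every point.
  Any such choice \<open>r\<close> serves, as closedness of a fiber space asks only for some
  sequence with the given limit.\<close>

lemma L2_converges_fiber_subseq:
  fixes f :: "real ^ 'n \<Rightarrow> complex"
  assumes s: "\<And>m. s m \<in> L2 lebesgue" and f: "f \<in> L2 lebesgue" and lim: "L2_converges lebesgue s f"
  shows "\<exists>r :: nat \<Rightarrow> nat. AE x in lebesgue_on torus.
    (\<lambda>m. ell2_norm (lattice_fiber (s (r m)) x - lattice_fiber f x)) \<longlonglongrightarrow> 0"
proof -
  have "\<exists>m. L2_norm lebesgue (s m - f) < (1/2)^k" for k
  proof -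
    have "0 < (1/2 :: real)^k" by simp
    from order_tendstoD(2)[OF lim[unfolded L2_converges_def] this] show ?thesis
      by (auto simp: eventually_sequentially)
  qed
  then obtain r where r: "\<And>k. L2_norm lebesgue (s (r k) - f) < (1/2)^k" by metis
  define d where "d k x = complex_of_real (ell2_norm (lattice_fiber (s (r k) - f) x))" for k x
  have dL: "s (r k) - f \<in> L2 lebesgue" for k by (rule L2_diff[OF s f])
  have dT: "d k \<in> L2 (lebesgue_on torus)" for k
  proof (rule L2I)
    have "(\<lambda>x. ell2_norm (lattice_fiber (s (r k) - f) x)) \<in> borel_measurable (lebesgue_on torus)"
      by (intro borel_measurable_ell2_norm borel_measurable_lattice_fiber L2_measurable[OF dL])
    then show "d k \<in> borel_measurable (lebesgue_on torus)" unfolding d_def[abs_def] by measurable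
    show "integrable (lebesgue_on torus) (\<lambda>x. (cmod (d k x))\<^sup>2)"
      using L2_norm_lattice_fiber(1)[OF dL, of k] by (simp add: d_def)
  qed
  have dn: "L2_norm (lebesgue_on torus) (d k) = L2_norm lebesgue (s (r k) - f)" for k
  proof -
    have "(L2_norm (lebesgue_on torus) (d k))\<^sup>2 = (\<integral>x. (cmod (d k x))\<^sup>2 \<partial>lebesgue_on torus)"
      by (rule L2_norm_sq)
    also have "\<dots> = (L2_norm lebesgue (s (r k) - f))\<^sup>2"
      unfolding L2_norm_lattice_fiber(2)[OF dL] by (simp add: d_def)
    finally show ?thesis by (simp add: power2_eq_iff_nonneg)
  qed
  have "AE x in lebesgue_on torus. summable (\<lambda>k. cmod (d k x))"
  proof (rule L2_abs_summable_AE[OF dT])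
    fix n
    have "(\<Sum>k<n. L2_norm (lebesgue_on torus) (d k)) \<le> (\<Sum>k<n. (1/2)^k)"
      unfolding dn by (intro sum_mono less_imp_le r)
    also have "\<dots> \<le> (\<Sum>k. (1/2)^k)" by (intro sum_le_suminf) auto
    also have "\<dots> = (2::real)" by (simp add: suminf_geometric)
    finally show "(\<Sum>k<n. L2_norm (lebesgue_on torus) (d k)) \<le> 2" .
  qed
  then have "AE x in lebesgue_on torus. (\<lambda>m. ell2_norm (lattice_fiber (s (r m)) x - lattice_fiber f x)) \<longlonglongrightarrow> 0"
  proof eventually_elim
    case (elim x)
    from summable_LIMSEQ_zero[OF elim] show ?case by (simp add: d_def lattice_fiber_diff)
  qed
  then show ?thesis by blast
qed

text \<open>Along suitable indices the fibers converge in norm at almost every point, where all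
  fibers of the sequence lie in the closed space \<open>J x\<close>.\<close>

lemma closed_subspace_fiber_space:
  fixes J :: "real ^ 'n \<Rightarrow> (int ^ 'n \<Rightarrow> complex) set"
  assumes J: "\<And>x. x \<in> torus \<Longrightarrow> ell2_closed (J x)"
  shows "closed_subspace lebesgue (fiber_space J)"
  unfolding closed_subspace_def
proof (intro conjI allI impI)
  have J': "AE x in lebesgue_on torus. ell2_closed (J x)" by (rule AE_torusI[OF J])
  show "fiber_space J \<subseteq> L2 lebesgue" by (auto simp: fiber_space_def)
  show "cfun.subspace (fiber_space J)"
    unfolding cfun.subspace_def
  proof (intro conjI ballI allI)
    have "AE x in lebesgue_on torus. lattice_fiber 0 x \<in> J x"
      using J'
    proof eventually_elim
      case (elim x)
      have "lattice_fiber 0 x = 0" by (simp add: lattice_fiber_def fun_eq_iff)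
      then show ?case using cfun.subspace_0[OF closed_subspaceD(2)[OF elim]] by (simp only:)
    qed
    then show "0 \<in> fiber_space J" by (simp add: fiber_space_def)
  next
    fix f g assume f: "f \<in> fiber_space J" and g: "g \<in> fiber_space J"
    have "AE x in lebesgue_on torus. lattice_fiber f x \<in> J x" "AE x in lebesgue_on torus. lattice_fiber g x \<in> J x"
      using f g by (simp_all add: fiber_space_def)
    with J' have "AE x in lebesgue_on torus. lattice_fiber (f + g) x \<in> J x"
    proof eventually_elim
      case (elim x)
      then show ?case unfolding lattice_fiber_add by (intro cfun.subspace_add[OF closed_subspaceD(2)])
    qed
    then show "f + g \<in> fiber_space J" using f g by (simp add: fiber_space_def L2_add)
  next
    fix c f assume f: "f \<in> fiber_space J"
    have "AE x in lebesgue_on torus. lattice_fiber f x \<in> J x"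
      using f by (simp_all add: fiber_space_def)
    with J' have "AE x in lebesgue_on torus. lattice_fiber (cscale c f) x \<in> J x"
    proof eventually_elim
      case (elim x)
      then show ?case unfolding lattice_fiber_cscale by (intro cfun.subspace_scale[OF closed_subspaceD(2)])
    qed
    then show "cscale c f \<in> fiber_space J" using f by (simp add: fiber_space_def L2_cscale)
  qed
  fix s f assume *: "(\<forall>m. s m \<in> fiber_space J) \<and> f \<in> L2 lebesgue \<and> L2_converges lebesgue s f"
  then have s: "\<And>m. s m \<in> L2 lebesgue" and sJ: "\<And>m. AE x in lebesgue_on torus. lattice_fiber (s m) x \<in> J x"
    and f: "f \<in> L2 lebesgue" and lim: "L2_converges lebesgue s f" by (auto simp: fiber_space_def)
  obtain r :: "nat \<Rightarrow> nat" where r: "AE x in lebesgue_on torus. (\<lambda>m. ell2_norm (lattice_fiber (s (r m)) x - lattice_fiber f x)) \<longlonglongrightarrow> 0"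
    using L2_converges_fiber_subseq[OF s f lim] by blast
  have "AE x in lebesgue_on torus. \<forall>m. lattice_fiber (s m) x \<in> J x"
    unfolding AE_all_countable using sJ by blast
  with r J' AE_lattice_fiber_ell2[OF f] have "AE x in lebesgue_on torus. lattice_fiber f x \<in> J x"
  proof eventually_elim
    case (elim x)
    show ?case
    proof (rule closed_subspaceD(3)[OF elim(2), of "\<lambda>m. lattice_fiber (s (r m)) x"])
      show "L2_converges (count_space UNIV) (\<lambda>m. lattice_fiber (s (r m)) x) (lattice_fiber f x)"
        unfolding L2_converges_def by (rule elim(1))
    qed (use elim(3,4) in blast)+
  qed
  then show "f \<in> fiber_space J" using f by (simp add: fiber_space_def)
qed

text \<open>Orthogonality to all modulates of \<open>\<Phi> i\<close> makes the fibers of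
  \<open>f\<close> and \<open>\<Phi> i\<close> orthogonal almost everywhere. As \<open>I\<close> is
  countable, almost every fiber of \<open>f\<close> is orthogonal to all generators of a closed span
  in which it lies.\<close>

lemma fiber_space_orthogonal_zero:
  assumes \<Phi>: "\<And>i. i \<in> I \<Longrightarrow> \<Phi> i \<in> L2 lebesgue" and cI: "countable I"
    and J: "AE x in lebesgue_on torus. J x \<subseteq> ell2_span ((\<lambda>i. lattice_fiber (\<Phi> i) x) ` I)"
    and f: "f \<in> fiber_space J" and orth: "\<And>i k. i \<in> I \<Longrightarrow> L2_inner lebesgue f (modulate k (\<Phi> i)) = 0"
  shows "AE x in lebesgue. f x = 0"
proof -
  have fL: "f \<in> L2 lebesgue" and fJ: "AE x in lebesgue_on torus. lattice_fiber f x \<in> J x"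
    using f by (auto simp: fiber_space_def)
  have "AE x in lebesgue_on torus. ell2_inner (lattice_fiber f x) (lattice_fiber (\<Phi> i) x) = 0" if "i \<in> I" for i
    using lattice_fiber_inner_const_iff[OF fL \<Phi>[OF that], of 0] orth[OF that] by simp
  then have "AE x in lebesgue_on torus. \<forall>i\<in>I. ell2_inner (lattice_fiber f x) (lattice_fiber (\<Phi> i) x) = 0"
    by (subst AE_ball_countable[OF cI]) blast
  moreover have "AE x in lebesgue_on torus. \<forall>i\<in>I. lattice_fiber (\<Phi> i) x \<in> ell2"
    by (subst AE_ball_countable[OF cI]) (use AE_lattice_fiber_ell2 \<Phi> in blast)
  ultimately have "AE x in lebesgue_on torus. lattice_fiber f x = lattice_fiber (\<lambda>x. 0) x"
    using J fJ AE_lattice_fiber_ell2[OF fL]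
  proof eventually_elim
    case (elim x)
    let ?a = "lattice_fiber f x"
    have "ell2_inner s ?a = 0" if "s \<in> (\<lambda>i. lattice_fiber (\<Phi> i) x) ` I" for s
    proof -
      have "ell2_inner ?a s = 0" using elim(1) that by blast
      then show ?thesis by (subst L2_inner_commute) simp
    qed
    moreover have "(\<lambda>i. lattice_fiber (\<Phi> i) x) ` I \<subseteq> ell2" using elim(2) by blast
    ultimately have "ell2_inner ?a ?a = 0" using elim(3,4,5) closed_span_orthogonal by blast
    then have "?a = 0" using ell2_inner_self_eq_0[OF elim(5)] by simp
    then show ?case by (simp add: lattice_fiber_def fun_eq_iff)
  qed
  then show ?thesis by (simp only: AE_lattice_fiber_eq)
qed

text \<open>Both spaces are the closed span of the modulates of the generators: these are total in
  \<open>W\<close> by assumption, and total in \<open>fiber_space J\<close> because their fibers are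
  total in almost every \<open>J x\<close>.\<close>

lemma modulation_generated_eq_fiber_space:
  fixes W :: "(real ^ 'n \<Rightarrow> complex) set"
  assumes W: "closed_subspace lebesgue W" and inv: "\<And>f k. f \<in> W \<Longrightarrow> modulate k f \<in> W"
    and \<Phi>: "\<And>i. i \<in> I \<Longrightarrow> \<Phi> i \<in> W" and cI: "countable I"
    and compl: "\<And>f. f \<in> W \<Longrightarrow> (\<And>i k. i \<in> I \<Longrightarrow> L2_inner lebesgue f (modulate k (\<Phi> i)) = 0) \<Longrightarrow> AE x in lebesgue. f x = 0"
    and J: "\<And>x. x \<in> torus \<Longrightarrow> ell2_closed (J x)"
    and JI: "AE x in lebesgue_on torus. J x = ell2_span ((\<lambda>i. lattice_fiber (\<Phi> i) x) ` I)"
  shows "W = fiber_space J"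
proof -
  let ?S = "{modulate k (\<Phi> i) | i k. i \<in> I}"
  have \<Phi>L: "\<Phi> i \<in> L2 lebesgue" if "i \<in> I" for i using \<Phi>[OF that] closed_subspaceD(1)[OF W] by blast
  have SW: "?S \<subseteq> W" using inv \<Phi> by blast
  have F: "closed_subspace lebesgue (fiber_space J)" by (rule closed_subspace_fiber_space[OF J])
  have "modulate k (\<Phi> i) \<in> fiber_space J" if i: "i \<in> I" for i k
  proof -
    have "AE x in lebesgue_on torus. ell2_closed (J x)" by (rule AE_torusI[OF J])
    moreover have "AE x in lebesgue_on torus. \<forall>i\<in>I. lattice_fiber (\<Phi> i) x \<in> ell2"
      by (subst AE_ball_countable[OF cI]) (use AE_lattice_fiber_ell2 \<Phi>L in blast)
    ultimately have "AE x in lebesgue_on torus. lattice_fiber (modulate k (\<Phi> i)) x \<in> J x"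
      using JI
    proof eventually_elim
      case (elim x)
      have "(\<lambda>i. lattice_fiber (\<Phi> i) x) ` I \<subseteq> ell2" using elim(2) by blast
      then have "lattice_fiber (\<Phi> i) x \<in> J x" using closed_span_base i unfolding elim(3) by blast
      then show ?case unfolding lattice_fiber_modulate by (rule cfun.subspace_scale[OF closed_subspaceD(2)[OF elim(1)]])
    qed
    then show ?thesis using modulate_L2[OF \<Phi>L[OF i]] by (simp add: fiber_space_def)
  qed
  then have SF: "?S \<subseteq> fiber_space J" by blast
  have "closed_span lebesgue ?S = W"
    unfolding closed_span_eq_iff[OF W SW]
  proof (intro ballI impI)
    fix f assume "f \<in> W" "\<forall>s\<in>?S. L2_inner lebesgue f s = 0"
    then show "AE x in lebesgue. f x = 0" by (intro compl) blast+
  qed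
  moreover have "closed_span lebesgue ?S = fiber_space J"
    unfolding closed_span_eq_iff[OF F SF]
  proof (intro ballI impI)
    fix f assume f: "f \<in> fiber_space J" "\<forall>s\<in>?S. L2_inner lebesgue f s = 0"
    show "AE x in lebesgue. f x = 0"
    proof (rule fiber_space_orthogonal_zero[of I \<Phi> J f])
      show "AE x in lebesgue_on torus. J x \<subseteq> ell2_span ((\<lambda>i. lattice_fiber (\<Phi> i) x) ` I)"
        using JI by eventually_elim simp
      show "L2_inner lebesgue f (modulate k (\<Phi> i)) = 0" if "i \<in> I" for i k using f(2) that by blast
    qed (use \<Phi>L cI f(1) in auto)
  qed
  ultimately show ?thesis by simp
qed

lemma orthonormal_or_zero_range_functionI:
  fixes e :: "real ^ 'n \<Rightarrow> nat \<Rightarrow> int ^ 'n \<Rightarrow> complex"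
  assumes m: "\<And>j k. (\<lambda>x. e x j k) \<in> borel_measurable (lebesgue_on torus)" and e: "\<And>x. x \<in> torus \<Longrightarrow> orthonormal_or_zero (e x)"
  shows "measurable_range_function (\<lambda>x. ell2_span (range (e x)))"
  unfolding measurable_range_function_def range_function_def
proof (intro conjI ballI)
  fix x :: "real ^ 'n" assume "x \<in> torus"
  then show "ell2_closed (ell2_span (range (e x)))"
    using orthonormal_or_zeroD(1)[OF e] by (intro closed_subspace_closed_span) auto
next
  fix a b :: "int ^ 'n \<Rightarrow> complex" assume ab: "a \<in> ell2" "b \<in> ell2"
  show "(\<lambda>x. ell2_inner (ell2_proj (ell2_span (range (e x))) a) b) \<in> borel_measurable (lebesgue_on torus)"
    by (rule borel_measurable_orthonormal_or_zero_proj[OF m _ ab]) (simp add: e space_restrict_space)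
qed

lemma gram_schmidt_fibers:
  fixes \<Phi> :: "nat \<Rightarrow> real ^ 'n \<Rightarrow> complex"
  assumes \<Phi>: "\<And>j. \<Phi> j \<in> L2 lebesgue"
  obtains e where "\<And>j k. (\<lambda>x. e x j k) \<in> borel_measurable (lebesgue_on torus)" "\<And>x. orthonormal_or_zero (e x)"
    "AE x in lebesgue_on torus. ell2_span (range (e x))
      = ell2_span (range (\<lambda>j. lattice_fiber (\<Phi> j) x))"
proof -
  let ?T = "lebesgue_on (torus :: (real ^ 'n) set)"
  have "AE x in ?T. \<forall>j. lattice_fiber (\<Phi> j) x \<in> ell2"
    unfolding AE_all_countable using AE_lattice_fiber_ell2[OF \<Phi>] by blast
  then obtain N where N: "N \<in> null_sets ?T" "{x \<in> space ?T. \<not> (\<forall>j. lattice_fiber (\<Phi> j) x \<in> ell2)} \<subseteq> N"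
    unfolding eventually_ae_filter by blast
  \<comment> \<open>Fibers are square summable only almost everywhere; zero on the exceptional set
    makes the Gram-Schmidt output orthonormal or zero at every \<open>x\<close>, as range functions
    require throughout the torus.\<close>
  define v where "v x j = (if x \<in> N \<or> x \<notin> torus then 0 else lattice_fiber (\<Phi> j) x)" for x j
  have vL: "v x j \<in> ell2" for x j
    using N(2) by (auto simp: v_def space_restrict_space)
  have "(\<lambda>x. v x j k) \<in> borel_measurable ?T" for j k
  proof -
    have "(\<lambda>x. if x \<in> N then 0 else lattice_fiber (\<Phi> j) x k) \<in> borel_measurable ?T"
      using borel_measurable_lattice_fiber[OF L2_measurable[OF \<Phi>]] null_setsD2[OF N(1)]
      by (intro measurable_If_set) auto
    then show ?thesis
      by (rule measurable_cong[THEN iffD1, rotated]) (auto simp: v_def space_restrict_space)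
  qed
  then have m: "(\<lambda>x. gram_schmidt (v x) j k) \<in> borel_measurable ?T" for j k
    by (rule borel_measurable_gram_schmidt)
  have "AE x in ?T. x \<notin> N" by (rule AE_not_in[OF N(1)])
  moreover have "AE x in ?T. x \<in> torus" by (rule AE_torusI)
  ultimately have "AE x in ?T. ell2_span (range (gram_schmidt (v x)))
      = ell2_span (range (\<lambda>j. lattice_fiber (\<Phi> j) x))"
  proof eventually_elim
    case (elim x)
    then have "v x = (\<lambda>j. lattice_fiber (\<Phi> j) x)" by (simp add: v_def fun_eq_iff)
    then show ?case using closed_span_gram_schmidt[of "v x", OF vL] by simp
  qed
  moreover have "orthonormal_or_zero (gram_schmidt (v x))" for x by (rule gram_schmidt_orthonormal_or_zero) (rule vL)
  ultimately show ?thesis using that[of "\<lambda>x. gram_schmidt (v x)"] m by blast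
qed

definition unit_seq :: "'k \<Rightarrow> 'k \<Rightarrow> complex" where
  "unit_seq k l = (if l = k then 1 else 0)"

lemma unit_seq_sum: "(\<integral>l. unit_seq k l * g l \<partial>count_space UNIV) = g k" for g :: "'k \<Rightarrow> complex"
proof -
  have "(\<integral>l. unit_seq k l * g l \<partial>count_space UNIV) = (\<integral>l. indicator {k} l *\<^sub>R g k \<partial>count_space UNIV)"
    by (intro Bochner_Integration.integral_cong) (auto simp: unit_seq_def indicator_def)
  then show ?thesis by simp
qed

lemma unit_seq_ell2: "unit_seq k \<in> ell2" "ell2_norm (unit_seq k) = 1"
proof -
  have e: "(cmod (unit_seq k l))\<^sup>2 = indicator {k} l" for l by (simp add: unit_seq_def indicator_def)
  show "unit_seq k \<in> ell2" by (rule L2I) (simp_all add: e)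
  show "ell2_norm (unit_seq k) = 1" by (simp add: L2_norm_def e)
qed

lemma ell2_inner_unit_seq: "ell2_inner a (unit_seq k) = a k" "ell2_inner (unit_seq k) a = cnj (a k)"
proof -
  show "ell2_inner (unit_seq k) a = cnj (a k)" unfolding L2_inner_def by (rule unit_seq_sum)
  then show "ell2_inner a (unit_seq k) = a k" by (subst L2_inner_commute) simp
qed

text \<open>The sections \<open>x \<mapsto> P(x) \<delta>\<^sub>k\<close> glue to square integrable functions, and their values
  span \<open>J x\<close>; this is what makes the range function unique.\<close>

lemma range_function_mono:
  fixes J J' :: "real ^ 'n \<Rightarrow> (int ^ 'n \<Rightarrow> complex) set"
  assumes J: "measurable_range_function J" and J': "measurable_range_function J'"
    and sub: "fiber_space J \<subseteq> fiber_space J'"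
  shows "AE x in lebesgue_on torus. J x \<subseteq> J' x"
proof -
  have cJ: "ell2_closed (J x)" "ell2_closed (J' x)" if "x \<in> torus" for x
    using J J' that by (auto simp: measurable_range_function_def range_function_def)
  define E where "E k x = ell2_proj (J x) (unit_seq k)" for k x
  have EJ: "E k x \<in> J x" if "x \<in> torus" for k x
    unfolding E_def by (rule ell2_proj(1)[OF cJ(1)[OF that] unit_seq_ell2(1)])
  have EL: "E k x \<in> ell2" if "x \<in> torus" for k x 
    by (rule subsetD[OF closed_subspaceD(1)[OF cJ(1)[OF that]] EJ[OF that]])
  have "AE x in lebesgue_on torus. E k x \<in> J' x" for k
  proof -
    have "glue_fibers (E k) \<in> L2 lebesgue"
    proof (rule glue_fibers_L2[of _ 1])
      show "(\<lambda>x. E k x l) \<in> borel_measurable (lebesgue_on torus)" for l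
      proof -
        have "(\<lambda>x. ell2_inner (ell2_proj (J x) (unit_seq k)) (unit_seq l)) \<in> borel_measurable (lebesgue_on torus)"
          by (rule bspec[OF bspec[OF conjunct2[OF J[unfolded measurable_range_function_def]] unit_seq_ell2(1)] unit_seq_ell2(1)])
        then show ?thesis by (simp only: ell2_inner_unit_seq E_def)
      qed
      show "ell2_norm (E k x) \<le> 1" if "x \<in> torus" for x
        using ell2_proj_norm_le[OF cJ(1)[OF that] unit_seq_ell2(1)[of k]] by (simp add: E_def unit_seq_ell2(2))
    qed (use EL in auto)
    moreover have "AE x in lebesgue_on torus. lattice_fiber (glue_fibers (E k)) x \<in> J x"
      by (rule AE_torusI) (simp add: lattice_fiber_glue EJ)
    ultimately have "glue_fibers (E k) \<in> fiber_space J" unfolding fiber_space_def by blast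
    then have "glue_fibers (E k) \<in> fiber_space J'" using sub by blast
    then have "AE x in lebesgue_on torus. lattice_fiber (glue_fibers (E k)) x \<in> J' x" by (simp add: fiber_space_def)
    moreover have "AE x in lebesgue_on (torus :: (real ^ 'n) set). x \<in> torus" by (rule AE_torusI)
    ultimately show ?thesis by eventually_elim (simp add: lattice_fiber_glue)
  qed
  then have "AE x in lebesgue_on torus. \<forall>k. E k x \<in> J' x" unfolding AE_all_countable by blast
  moreover have "AE x in lebesgue_on (torus :: (real ^ 'n) set). x \<in> torus" by (rule AE_torusI)
  ultimately show ?thesis
  proof eventually_elim
    case (elim x)
    have sub: "range (\<lambda>k. E k x) \<subseteq> J x" using EJ[OF elim(2)] by blast
    have "ell2_span (range (\<lambda>k. E k x)) = J x"
      unfolding closed_span_eq_iff[OF cJ(1)[OF elim(2)] sub]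
    proof (intro ballI impI AE_I2)
      fix f k assume f: "f \<in> J x" "\<forall>s\<in>range (\<lambda>k. E k x). ell2_inner f s = 0"
      \<comment> \<open>For \<open>f\<close> in \<open>J x\<close> the projection may be dropped
        from the inner product, so orthogonality to all \<open>E k x\<close> says that every
        coordinate of \<open>f\<close> vanishes.\<close>
      have "ell2_inner (E k x) f = ell2_inner (unit_seq k) f"
        unfolding E_def by (rule ell2_proj_inner[OF cJ(1)[OF elim(2)] unit_seq_ell2(1) f(1)])
      moreover have "ell2_inner f (E k x) = 0" using f(2) by blast
      then have "ell2_inner (E k x) f = 0" by (subst L2_inner_commute) simp
      ultimately show "f k = 0" by (simp add: ell2_inner_unit_seq)
    qed
    moreover have "ell2_span (range (\<lambda>k. E k x)) \<subseteq> J' x"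
      by (rule closed_span_minimal[OF cJ(2)[OF elim(2)]]) (use elim(1) in blast)
    ultimately show ?case by simp
  qed
qed

lemma range_function_unique:
  assumes "measurable_range_function J" "measurable_range_function J'" "fiber_space J = fiber_space J'"
  shows "AE x in lebesgue_on torus. J x = J' x"
proof -
  have "AE x in lebesgue_on torus. J x \<subseteq> J' x" by (rule range_function_mono[OF assms(1,2)]) (simp add: assms(3))
  moreover have "AE x in lebesgue_on torus. J' x \<subseteq> J x" by (rule range_function_mono[OF assms(2,1)]) (simp add: assms(3))
  ultimately show ?thesis by eventually_elim (rule subset_antisym)
qed

text \<open>Projecting a total family, here the indicators of rational boxes, yields generators of \<open>W\<close>.\<close>

theorem modulation_invariant_fibers:
  fixes W :: "(real ^ 'n \<Rightarrow> complex) set"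
  assumes W: "closed_subspace lebesgue W" and inv: "\<And>f k. f \<in> W \<Longrightarrow> modulate k f \<in> W"
  obtains e where "\<And>j k. (\<lambda>x. e x j k) \<in> borel_measurable (lebesgue_on torus)" "\<And>x. orthonormal_or_zero (e x)"
    "W = fiber_space (\<lambda>x. ell2_span (range (e x)))"
proof -
  have WL: "f \<in> L2 lebesgue" if "f \<in> W" for f using that closed_subspaceD(1)[OF W] by blast
  define Q where "Q = from_nat_into (rat_boxes :: (real ^ 'n) set set)"
  have ne: "(rat_boxes :: (real ^ 'n) set set) \<noteq> {}" using box_nat_rat by blast
  have Q: "range Q = rat_boxes" unfolding Q_def by (rule range_from_nat_into[OF ne countable_rat_boxes])
  have QL: "cind (Q j) \<in> L2 lebesgue" for j using cind_rat_box_L2 Q by blast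
  have "\<forall>j. \<exists>p\<in>W. \<forall>q\<in>W. L2_inner lebesgue (cind (Q j) - p) q = 0"
    using closed_subspace_projection[OF W QL] by blast
  then obtain \<Phi> where \<Phi>: "\<And>j. \<Phi> j \<in> W" "\<And>j q. q \<in> W \<Longrightarrow> L2_inner lebesgue (cind (Q j) - \<Phi> j) q = 0" by metis
  obtain e where e: "\<And>j k. (\<lambda>x. e x j k) \<in> borel_measurable (lebesgue_on torus)" "\<And>x. orthonormal_or_zero (e x)"
    and ae: "AE x in lebesgue_on torus. ell2_span (range (e x))
      = ell2_span (range (\<lambda>j. lattice_fiber (\<Phi> j) x))"
  proof (rule gram_schmidt_fibers[of \<Phi>, OF WL])
    show "\<Phi> j \<in> W" for j by (rule \<Phi>(1))
  qed (rule that)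
  have "W = fiber_space (\<lambda>x. ell2_span (range (e x)))"
  proof (rule modulation_generated_eq_fiber_space[OF W inv, of UNIV \<Phi>])
    fix f assume f: "f \<in> W" "\<And>i k. i \<in> UNIV \<Longrightarrow> L2_inner lebesgue f (modulate k (\<Phi> i)) = 0"
    have fL: "f \<in> L2 lebesgue" by (rule WL[OF f(1)])
    \<comment> \<open>An \<open>f\<close> in \<open>W\<close> has the same inner product with a box
      indicator as with its projection \<open>\<Phi> j\<close>, so the case \<open>k = 0\<close> of
      the orthogonality already determines \<open>f\<close>.\<close>
    have "L2_inner lebesgue f (cind (Q j)) = 0" for j
    proof -
      have "L2_inner lebesgue f (\<Phi> j) = 0" using f(2)[of j 0] by (simp add: modulate_def)
      then have "L2_inner lebesgue (\<Phi> j) f = 0" by (subst L2_inner_commute) simp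
      then have "L2_inner lebesgue (cind (Q j)) f = 0"
        using \<Phi>(2)[OF f(1), of j] L2_inner_diff_left[OF QL[of j] WL[OF \<Phi>(1)[of j]] fL] by simp
      then show ?thesis by (subst L2_inner_commute) simp
    qed
    then have "L2_inner lebesgue f (cind B) = 0" if "B \<in> range Q" for B using that by blast
    then show "AE x in lebesgue. f x = 0" unfolding Q by (rule L2_zero_on_rat_boxes[OF fL])
  next
    show "ell2_closed (ell2_span (range (e x)))" for x
      using orthonormal_or_zeroD(1)[OF e(2)] by (intro closed_subspace_closed_span) auto
  qed (use \<Phi>(1) ae in auto)
  with e show ?thesis using that by blast
qed

section \<open>Orthonormal bases of translates\<close>

lemma orthonormal_basis_iff:
  assumes V: "closed_subspace M V"
  shows "orthonormal_basis M I e V \<longleftrightarrow> (\<forall>i\<in>I. e i \<in> V) \<and>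
    (\<forall>i\<in>I. \<forall>j\<in>I. L2_inner M (e i) (e j) = (if i = j then 1 else 0)) \<and>
    (\<forall>f\<in>V. (\<forall>i\<in>I. L2_inner M f (e i) = 0) \<longrightarrow> (AE x in M. f x = 0))"
proof (cases "\<forall>i\<in>I. e i \<in> V")
  case True
  then have "e ` I \<subseteq> V" by blast
  from closed_span_eq_iff[OF V this] True show ?thesis unfolding orthonormal_basis_def by simp
next
  case False
  then show ?thesis unfolding orthonormal_basis_def by blast
qed

text \<open>All representatives of transforms are included, whereas applying \<open>fourier\<close>
  to the members of \<open>V\<close> would give only the selected ones, a set that is not saturated
  under equality almost everywhere.\<close>

definition fourier_image :: "(real ^ 'n \<Rightarrow> complex) set \<Rightarrow> (real ^ 'n \<Rightarrow> complex) set" where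
  "fourier_image V = {g. \<exists>f\<in>V. is_fourier_transform f g}"

text \<open>A preimage of \<open>g\<close> is determined only up to a null set, but a closed
  subspace is saturated, so membership is the same for all preimages.\<close>

lemma fourier_image_iff:
  assumes V: "closed_subspace lebesgue V" and f: "f \<in> L2 lebesgue" and g: "is_fourier_transform f g"
  shows "g \<in> fourier_image V \<longleftrightarrow> f \<in> V"
proof
  assume "g \<in> fourier_image V"
  then obtain f' where f': "f' \<in> V" "is_fourier_transform f' g" unfolding fourier_image_def by blast
  have fL': "f' \<in> L2 lebesgue" by (rule subsetD[OF closed_subspaceD(1)[OF V] f'(1)])
  have "AE x in lebesgue. f' x = f x" using is_fourier_transform_AE_iff[OF fL' f f'(2) g] by simp
  then show "f \<in> V" by (rule closed_subspace_AE[OF V f'(1) L2_measurable[OF f]])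
next
  assume "f \<in> V"
  then show "g \<in> fourier_image V" unfolding fourier_image_def using g by blast
qed

text \<open>Characterizing totality by orthogonal elements leaves only membership, inner products
  and vanishing almost everywhere to transport; closed spans do not have to be compared.\<close>

lemma orthonormal_basis_fourier_image:
  assumes V: "closed_subspace lebesgue V"
    and e: "\<And>i. i \<in> I \<Longrightarrow> e i \<in> L2 lebesgue" "\<And>i. i \<in> I \<Longrightarrow> is_fourier_transform (e i) (e' i)"
  shows "orthonormal_basis lebesgue I e V \<longleftrightarrow> orthonormal_basis lebesgue I e' (fourier_image V)"
proof -
  have W: "closed_subspace lebesgue (fourier_image V)"
    unfolding fourier_image_def by (rule closed_subspace_fourier_image[OF V])
  have VL: "f \<in> L2 lebesgue" if "f \<in> V" for f by (rule subsetD[OF closed_subspaceD(1)[OF V] that])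
  have mem: "e' i \<in> fourier_image V \<longleftrightarrow> e i \<in> V" if "i \<in> I" for i
    by (rule fourier_image_iff[OF V e(1)[OF that] e(2)[OF that]])
  have inner: "L2_inner lebesgue (e' i) (e' j) = L2_inner lebesgue (e i) (e j)" if "i \<in> I" "j \<in> I" for i j
    by (rule is_fourier_transform_inner[OF e(1)[OF that(1)] e(1)[OF that(2)] e(2)[OF that(1)] e(2)[OF that(2)]])
  have z: "is_fourier_transform 0 0"
  proof -
    have "is_fourier_transform (0 - 0) (fourier 0 - fourier 0)"
      by (intro is_fourier_transform_diff fourier_is_fourier_transform) simp_all
    then show ?thesis by (simp only: diff_self)
  qed
  have transfer: "(\<forall>i\<in>I. L2_inner lebesgue g (e' i) = 0) \<longleftrightarrow> (\<forall>i\<in>I. L2_inner lebesgue f (e i) = 0)"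
      "(AE x in lebesgue. g x = 0) \<longleftrightarrow> (AE x in lebesgue. f x = 0)"
    if f: "f \<in> V" and g: "is_fourier_transform f g" for f g
  proof -
    show "(\<forall>i\<in>I. L2_inner lebesgue g (e' i) = 0) \<longleftrightarrow> (\<forall>i\<in>I. L2_inner lebesgue f (e i) = 0)"
      using is_fourier_transform_inner[OF VL[OF f] e(1) g e(2)] by simp
    show "(AE x in lebesgue. g x = 0) \<longleftrightarrow> (AE x in lebesgue. f x = 0)"
      using is_fourier_transform_AE_iff[OF VL[OF f] L2_zero(1) g z] by simp
  qed
  have "(\<forall>g\<in>fourier_image V. (\<forall>i\<in>I. L2_inner lebesgue g (e' i) = 0) \<longrightarrow> (AE x in lebesgue. g x = 0))
    \<longleftrightarrow> (\<forall>f\<in>V. (\<forall>i\<in>I. L2_inner lebesgue f (e i) = 0) \<longrightarrow> (AE x in lebesgue. f x = 0))" (is "?L \<longleftrightarrow> ?R")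
  proof
    assume L: ?L
    show ?R
    proof (intro ballI impI)
      fix f assume f: "f \<in> V" "\<forall>i\<in>I. L2_inner lebesgue f (e i) = 0"
      have F: "is_fourier_transform f (fourier f)" by (rule fourier_is_fourier_transform[OF VL[OF f(1)]])
      have "fourier f \<in> fourier_image V" using F f(1) unfolding fourier_image_def by blast
      then show "AE x in lebesgue. f x = 0"
        using L transfer[OF f(1) F] f(2) by blast
    qed
  next
    assume R: ?R
    show ?L
    proof (intro ballI impI)
      fix g assume g: "g \<in> fourier_image V" "\<forall>i\<in>I. L2_inner lebesgue g (e' i) = 0"
      then obtain f where f: "f \<in> V" "is_fourier_transform f g" unfolding fourier_image_def by blast
      then show "AE x in lebesgue. g x = 0" using R transfer[OF f] g(2) by blast
    qed
  qed
  then show ?thesis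
    unfolding orthonormal_basis_iff[OF V] orthonormal_basis_iff[OF W] using mem inner by simp
qed

lemma AE_fiber_transform:
  assumes f: "f \<in> L2 lebesgue" and g: "is_fourier_transform f g"
  shows "(AE x in lebesgue_on torus. fiber f x \<in> J x) \<longleftrightarrow> (AE x in lebesgue_on torus. lattice_fiber g x \<in> J x)"
proof -
  have "AE x in lebesgue. fourier f x = g x"
    using is_fourier_transform_AE_iff[OF f f fourier_is_fourier_transform[OF f] g] by simp
  then have *: "AE x in lebesgue_on torus. fiber f x = lattice_fiber g x"
    unfolding AE_lattice_fiber_eq by (simp only: fiber_def lattice_fiber_def)
  show ?thesis
  proof
    assume "AE x in lebesgue_on torus. fiber f x \<in> J x"
    with * show "AE x in lebesgue_on torus. lattice_fiber g x \<in> J x" by eventually_elim simp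
  next
    assume "AE x in lebesgue_on torus. lattice_fiber g x \<in> J x"
    with * show "AE x in lebesgue_on torus. fiber f x \<in> J x" by eventually_elim simp
  qed
qed

text \<open>From the description of \<open>V\<close> to that of its image, surjectivity is the
  point: every \<open>g\<close> in \<open>L2\<close> must be the transform of some \<open>f\<close>
  before membership can be compared.\<close>

lemma is_range_function_of_iff:
  assumes V: "closed_subspace lebesgue V"
  shows "is_range_function_of J V \<longleftrightarrow> measurable_range_function J \<and> fourier_image V = fiber_space J"
proof -
  have VL: "f \<in> L2 lebesgue" if "f \<in> V" for f by (rule subsetD[OF closed_subspaceD(1)[OF V] that])
  have "V = {f \<in> L2 lebesgue. AE x in lebesgue_on torus. fiber f x \<in> J x} \<longleftrightarrow> fourier_image V = fiber_space J" (is "V = ?V \<longleftrightarrow> _")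
  proof
    assume eq: "V = ?V"
    show "fourier_image V = fiber_space J"
    proof (intro set_eqI)
      fix g
      show "g \<in> fourier_image V \<longleftrightarrow> g \<in> fiber_space J"
      proof (cases "g \<in> L2 lebesgue")
        case True
        obtain f where f: "f \<in> L2 lebesgue" "is_fourier_transform f g" using is_fourier_transform_surj[OF True] by blast
        have "g \<in> fourier_image V \<longleftrightarrow> f \<in> V" by (rule fourier_image_iff[OF V f])
        also have "\<dots> \<longleftrightarrow> f \<in> ?V" using eq by simp
        also have "\<dots> \<longleftrightarrow> g \<in> fiber_space J" using AE_fiber_transform[OF f] f(1) True by (simp add: fiber_space_def)
        finally show ?thesis .
      next
        case False
        then show ?thesis using is_fourier_transform_L2 unfolding fourier_image_def fiber_space_def by blast
      qed
    qed
  next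
    assume eq: "fourier_image V = fiber_space J"
    show "V = ?V"
    proof (intro set_eqI)
      fix f
      show "f \<in> V \<longleftrightarrow> f \<in> ?V"
      proof (cases "f \<in> L2 lebesgue")
        case True
        note F = fourier_is_fourier_transform[OF True]
        have "f \<in> V \<longleftrightarrow> fourier f \<in> fiber_space J" using fourier_image_iff[OF V True F] eq by simp
        also have "\<dots> \<longleftrightarrow> f \<in> ?V" using AE_fiber_transform[OF True F] fourier_L2[OF True] True by (simp add: fiber_space_def)
        finally show ?thesis .
      next
        case False
        then show ?thesis using VL by blast
      qed
    qed
  qed
  then show ?thesis unfolding is_range_function_of_def by simp
qed

lemma fourier_image_modulate:
  assumes V: "shift_invariant V" and g: "g \<in> fourier_image V"
  shows "modulate k g \<in> fourier_image V"
proof -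
  obtain f where f: "f \<in> V" "is_fourier_transform f g" using g unfolding fourier_image_def by blast
  have "f \<in> L2 lebesgue" using V f(1) unfolding shift_invariant_def closed_subspace_def by blast
  then have "is_fourier_transform (\<lambda>x. f (x + lattice_vec k)) (modulate k g)"
    using f(2) by (rule is_fourier_transform_shift)
  moreover have "(\<lambda>x. f (x + lattice_vec k)) \<in> V" using V f(1) unfolding shift_invariant_def by blast
  ultimately show ?thesis unfolding fourier_image_def by blast
qed

text \<open>Existence of one range function makes the \<open>SOME\<close> in
  \<open>range_function_of\<close> satisfy its specification; uniqueness then identifies the
  selected spaces with explicit spans almost everywhere.\<close>

lemma shift_invariant_range_function:
  fixes V :: "(real ^ 'n \<Rightarrow> complex) set"
  assumes V: "shift_invariant V"
  obtains e where "\<And>j k. (\<lambda>x. e x j k) \<in> borel_measurable (lebesgue_on torus)" "\<And>x. orthonormal_or_zero (e x)"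
    "fourier_image V = fiber_space (\<lambda>x. ell2_span (range (e x)))"
    "AE x in lebesgue_on torus. range_function_of V x = ell2_span (range (e x))"
proof -
  have cV: "closed_subspace lebesgue V" using V by (simp add: shift_invariant_def)
  have cW: "closed_subspace lebesgue (fourier_image V)"
    unfolding fourier_image_def by (rule closed_subspace_fourier_image[OF cV])
  obtain e where e: "\<And>j k. (\<lambda>x. e x j k) \<in> borel_measurable (lebesgue_on torus)" "\<And>x. orthonormal_or_zero (e x)"
    and eq: "fourier_image V = fiber_space (\<lambda>x. ell2_span (range (e x)))"
  proof (rule modulation_invariant_fibers[OF cW])
    show "modulate k f \<in> fourier_image V" if "f \<in> fourier_image V" for f k by (rule fourier_image_modulate[OF V that])
  qed (rule that)
  let ?J = "\<lambda>x. ell2_span (range (e x))"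
  have J: "measurable_range_function ?J" by (rule orthonormal_or_zero_range_functionI[OF e])
  then have "is_range_function_of ?J V" unfolding is_range_function_of_iff[OF cV] using eq by simp
  then have "is_range_function_of (range_function_of V) V" unfolding range_function_of_def
    by (rule someI[where P = "\<lambda>J. is_range_function_of J V"])
  then have R: "measurable_range_function (range_function_of V)" "fourier_image V = fiber_space (range_function_of V)"
    unfolding is_range_function_of_iff[OF cV] by simp_all
  have "AE x in lebesgue_on torus. range_function_of V x = ?J x"
    by (rule range_function_unique[OF R(1) J]) (simp add: R(2)[symmetric] eq)
  then show ?thesis by (rule that[OF e eq])
qed

section \<open>Counting and enumerating the nonzero members of a sequence\<close>

definition count_below :: "(nat \<Rightarrow> bool) \<Rightarrow> nat \<Rightarrow> nat" where
  "count_below d j = (\<Sum>l<j. if d l then 1 else 0)"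

text \<open>The definition as a sum suits measurability in a parameter, the cardinality suits the
  combinatorics.\<close>

lemma count_below_card: "count_below d j = card {l. l < j \<and> d l}"
proof -
  have "count_below d j = (\<Sum>l\<in>{l \<in> {..<j}. d l}. 1)"
    unfolding count_below_def by (rule sum.inter_filter[symmetric]) simp
  then show ?thesis by simp
qed

lemma count_below_mono_strict: "d i \<Longrightarrow> i < j \<Longrightarrow> count_below d i < count_below d j"
  unfolding count_below_card by (rule psubset_card_mono) auto

lemma count_below_surj: "c < count_below d m \<Longrightarrow> \<exists>j. d j \<and> count_below d j = c"
  by (induction m) (auto simp: count_below_def less_Suc_eq split: if_splits)

definition set_enat :: "'a set \<Rightarrow> enat" where
  "set_enat D = (if finite D then enat (card D) else \<infinity>)"

text \<open>The number of earlier members is the rank counted from 0, and \<open>Suc\<close> matches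
  the index sets, which start at 1. Surjectivity holds because the count rises by at most 1 at each
  step and so omits no value.\<close>

lemma bij_count_below: "bij_betw (\<lambda>j. Suc (count_below d j)) {j. d j} (index_set (set_enat {j. d j}))"
  unfolding bij_betw_def
proof
  show "inj_on (\<lambda>j. Suc (count_below d j)) {j. d j}"
  proof (rule inj_onI)
    fix i j assume "i \<in> {j. d j}" "j \<in> {j. d j}" "Suc (count_below d i) = Suc (count_below d j)"
    then show "i = j" using count_below_mono_strict[of d i j] count_below_mono_strict[of d j i]
      by (cases i j rule: linorder_cases) auto
  qed
  show "(\<lambda>j. Suc (count_below d j)) ` {j. d j} = index_set (set_enat {j. d j})"
  proof (intro equalityI subsetI)
    fix i assume "i \<in> (\<lambda>j. Suc (count_below d j)) ` {j. d j}"
    then obtain j where j: "d j" "i = Suc (count_below d j)" by auto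
    have "count_below d j < card {j. d j}" if "finite {j. d j}"
      unfolding count_below_card by (rule psubset_card_mono[OF that]) (use j(1) in auto)
    then show "i \<in> index_set (set_enat {j. d j})" using j(2) by (auto simp: index_set_def set_enat_def Suc_le_eq)
  next
    fix i assume i: "i \<in> index_set (set_enat {j. d j})"
    then have i1: "1 \<le> i" by (simp add: index_set_def)
    have "\<exists>m. i - 1 < count_below d m"
    proof (cases "finite {j. d j}")
      case True
      then obtain m where "\<forall>j\<in>{j. d j}. j < m" using finite_nat_set_iff_bounded by blast
      then have "{l. l < m \<and> d l} = {j. d j}" by blast
      moreover have "i \<le> card {j. d j}" using i True by (simp add: index_set_def set_enat_def)
      ultimately have "i - 1 < count_below d m" unfolding count_below_card using i1 by simp
      then show ?thesis by blast
    next
      case False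
      then obtain F where F: "F \<subseteq> {j. d j}" "finite F" "card F = i" using infinite_arbitrarily_large by blast
      obtain m where "\<forall>j\<in>F. j < m" using F(2) finite_nat_set_iff_bounded by blast
      then have "F \<subseteq> {l. l < m \<and> d l}" using F(1) by blast
      then have "card F \<le> card {l. l < m \<and> d l}" by (intro card_mono) auto
      then have "i - 1 < count_below d m" unfolding count_below_card using i1 F(3) by simp
      then show ?thesis by blast
    qed
    then obtain j where "d j" "count_below d j = i - 1" using count_below_surj by blast
    then show "i \<in> (\<lambda>j. Suc (count_below d j)) ` {j. d j}" using i1 by (intro image_eqI[of _ _ j]) auto
  qed
qed

lemma set_enat_index_set: "set_enat (index_set N) = N"
proof (cases N)
  case (enat m)
  have "index_set (enat m) = {1..m}" by (auto simp: index_set_def)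
  then show ?thesis by (simp add: enat set_enat_def)
next
  case infinity
  have "index_set \<infinity> = {1..}" by (auto simp: index_set_def)
  then show ?thesis by (simp add: infinity set_enat_def infinite_Ici)
qed

lemma cdim_orthonormal_family:
  assumes "\<And>i. i \<in> I \<Longrightarrow> e i \<in> ell2"
    and "\<And>i j. i \<in> I \<Longrightarrow> j \<in> I \<Longrightarrow> ell2_inner (e i) (e j) = (if i = j then 1 else 0)"
  shows "cdim (ell2_span (e ` I)) = set_enat I"
  unfolding set_enat_def by (rule cdim_orthonormal[OF assms])

lemma closed_span_insert_zeros:
  assumes A: "A \<subseteq> L2 M" and B: "B \<subseteq> L2 M" "A \<subseteq> B" "B \<subseteq> insert 0 A"
  shows "closed_span M B = closed_span M A"
proof (rule closed_span_eqI[OF B(1) A])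
  show "B \<subseteq> cfun.span A" using B(3) cfun.span_superset[of A] cfun.span_zero[of A] by blast
  show "A \<subseteq> cfun.span B" using B(2) cfun.span_superset[of B] by blast
qed

lemma cdim_orthonormal_or_zero:
  assumes e: "orthonormal_or_zero e"
  shows "cdim (ell2_span (range e)) = set_enat {j. e j \<noteq> 0}"
proof -
  have eL: "e j \<in> ell2" for j by (rule orthonormal_or_zeroD(1)[OF e])
  have "ell2_span (range e) = ell2_span (e ` {j. e j \<noteq> 0})"
    by (rule closed_span_insert_zeros) (use eL in auto)
  also have "cdim \<dots> = set_enat {j. e j \<noteq> 0}"
    by (rule cdim_orthonormal_family) (use eL orthonormal_or_zeroD(2)[OF e] in auto)
  finally show ?thesis .
qed

text \<open>At most one term of the series is nonzero, and none if \<open>i\<close> exceeds the number of nonzero members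
  of \<open>e\<close>.\<close>

definition nth_nonzero :: "(nat \<Rightarrow> 'k \<Rightarrow> complex) \<Rightarrow> nat \<Rightarrow> 'k \<Rightarrow> complex" where
  "nth_nonzero e i k = (\<Sum>j. if e j \<noteq> 0 \<and> Suc (count_below (\<lambda>l. e l \<noteq> 0) j) = i then e j k else 0)"

lemma nth_nonzero_count:
  assumes "e j \<noteq> 0" shows "nth_nonzero e (Suc (count_below (\<lambda>l. e l \<noteq> 0) j)) = e j"
proof
  fix k
  let ?c = "\<lambda>j. Suc (count_below (\<lambda>l. e l \<noteq> 0) j)"
  have "e l \<noteq> 0 \<and> ?c l = ?c j \<longleftrightarrow> l = j" for l
    using bij_betw_imp_inj_on[OF bij_count_below[of "\<lambda>l. e l \<noteq> 0"]] assms by (auto dest: inj_onD)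
  then have "nth_nonzero e (?c j) k = (\<Sum>l. if l = j then e l k else 0)" unfolding nth_nonzero_def by simp
  also have "\<dots> = (\<Sum>l\<in>{j}. if l = j then e l k else 0)" by (rule suminf_finite) auto
  finally show "nth_nonzero e (?c j) k = e j k" by simp
qed

lemma nth_nonzero_cases: "nth_nonzero e i = 0 \<or> (\<exists>j. e j \<noteq> 0 \<and> nth_nonzero e i = e j)"
proof (cases "\<exists>j. e j \<noteq> 0 \<and> Suc (count_below (\<lambda>l. e l \<noteq> 0) j) = i")
  case True
  then show ?thesis using nth_nonzero_count by blast
next
  case False
  then have "(if e j \<noteq> 0 \<and> Suc (count_below (\<lambda>l. e l \<noteq> 0) j) = i then e j k else 0) = 0" for j k by auto
  then have "nth_nonzero e i = 0" unfolding nth_nonzero_def[abs_def] zero_fun_def by simp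
  then show ?thesis by blast
qed

lemma nth_nonzero_enum:
  assumes "i \<in> index_set (set_enat {j. e j \<noteq> 0})"
  obtains j where "e j \<noteq> 0" "i = Suc (count_below (\<lambda>l. e l \<noteq> 0) j)" "nth_nonzero e i = e j"
proof -
  have "i \<in> (\<lambda>j. Suc (count_below (\<lambda>l. e l \<noteq> 0) j)) ` {j. e j \<noteq> 0}"
    using assms bij_betw_imp_surj_on[OF bij_count_below[of "\<lambda>j. e j \<noteq> 0"]] by simp
  then obtain j where "e j \<noteq> 0" "i = Suc (count_below (\<lambda>l. e l \<noteq> 0) j)" by auto
  then show ?thesis using that nth_nonzero_count[of e j] by simp
qed

lemma nth_nonzero_orthonormal:
  assumes e: "orthonormal_or_zero e" and i: "i \<in> index_set (set_enat {j. e j \<noteq> 0})" and i': "i' \<in> index_set (set_enat {j. e j \<noteq> 0})"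
  shows "ell2_inner (nth_nonzero e i) (nth_nonzero e i') = (if i = i' then 1 else 0)"
proof -
  obtain j where j: "e j \<noteq> 0" "i = Suc (count_below (\<lambda>l. e l \<noteq> 0) j)" "nth_nonzero e i = e j"
    by (rule nth_nonzero_enum[OF i])
  obtain j' where j': "e j' \<noteq> 0" "i' = Suc (count_below (\<lambda>l. e l \<noteq> 0) j')" "nth_nonzero e i' = e j'"
    by (rule nth_nonzero_enum[OF i'])
  have "i = i' \<longleftrightarrow> j = j'"
    using bij_betw_imp_inj_on[OF bij_count_below[of "\<lambda>l. e l \<noteq> 0"]] j(1,2) j'(1,2) by (auto dest: inj_onD)
  then show ?thesis unfolding j(3) j'(3) orthonormal_or_zeroD(2)[OF e] using j'(1) by simp
qed

lemma nth_nonzero_image: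
  "nth_nonzero e ` index_set (set_enat {j. e j \<noteq> 0}) = e ` {j. e j \<noteq> 0}"
proof (intro equalityI subsetI)
  fix a assume "a \<in> nth_nonzero e ` index_set (set_enat {j. e j \<noteq> 0})"
  then obtain i where i: "i \<in> index_set (set_enat {j. e j \<noteq> 0})" "a = nth_nonzero e i" by blast
  obtain j where "e j \<noteq> 0" "i = Suc (count_below (\<lambda>l. e l \<noteq> 0) j)" "nth_nonzero e i = e j"
    by (rule nth_nonzero_enum[OF i(1)])
  then show "a \<in> e ` {j. e j \<noteq> 0}" using i(2) by simp
next
  fix a assume "a \<in> e ` {j. e j \<noteq> 0}"
  then obtain j where j: "e j \<noteq> 0" "a = e j" by blast
  have "Suc (count_below (\<lambda>l. e l \<noteq> 0) j) \<in> index_set (set_enat {j. e j \<noteq> 0})"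
    using bij_betwE[OF bij_count_below[of "\<lambda>l. e l \<noteq> 0"]] j(1) by blast
  then show "a \<in> nth_nonzero e ` index_set (set_enat {j. e j \<noteq> 0})"
    using nth_nonzero_count[of e j] j by (metis image_eqI)
qed

text \<open>Whether a member vanishes is read off from its norm, a measurable function of the
  parameter; counts and the series are then built from measurable terms.\<close>

lemma borel_measurable_nth_nonzero:
  fixes e :: "'x \<Rightarrow> nat \<Rightarrow> 'k::countable \<Rightarrow> complex"
  assumes m: "\<And>j k. (\<lambda>x. e x j k) \<in> borel_measurable M" and e: "\<And>x. orthonormal_or_zero (e x)"
  shows "(\<lambda>x. nth_nonzero (e x) i k) \<in> borel_measurable M"
proof -
  have [measurable]: "(\<lambda>x. e x j k) \<in> borel_measurable M" for j k by (rule m)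
  have [measurable]: "(\<lambda>x. ell2_norm (e x j)) \<in> borel_measurable M" for j
    by (rule borel_measurable_ell2_norm) (rule m)
  have nz: "e x j \<noteq> 0 \<longleftrightarrow> ell2_norm (e x j) \<noteq> 0" for x j using ell2_norm_eq_0[OF orthonormal_or_zeroD(1)[OF e]] by blast
  show ?thesis unfolding nth_nonzero_def count_below_def nz by measurable
qed


section \<open>Bases of modulates and the dimension function\<close>

lemma modulate_0 [simp]: "modulate 0 f = f"
  by (simp add: modulate_def)

text \<open>The spans of the fibers of the \<open>\<psi> i\<close> form a range function of
  \<open>V\<close> after a change on a null set; uniqueness identifies them with
  \<open>range_function_of V\<close> almost everywhere, and the fibers, orthonormal and indexed by
  \<open>I\<close>, give the dimension.\<close>

lemma cdim_range_function_of_basis: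
  fixes V :: "(real ^ 'n \<Rightarrow> complex) set" and \<psi> :: "nat \<Rightarrow> real ^ 'n \<Rightarrow> complex"
  assumes V: "shift_invariant V" and \<psi>: "\<And>i. i \<in> I \<Longrightarrow> \<psi> i \<in> L2 lebesgue"
    and onb: "orthonormal_basis lebesgue (I \<times> UNIV) (\<lambda>(i, k). modulate k (\<psi> i)) (fourier_image V)"
  shows "AE x in lebesgue_on torus. dim_fun V x = set_enat I"
proof -
  let ?W = "fourier_image V"
  have cV: "closed_subspace lebesgue V" using V by (simp add: shift_invariant_def)
  have cW: "closed_subspace lebesgue ?W"
    unfolding fourier_image_def by (rule closed_subspace_fourier_image[OF cV])
  note onb' = onb[unfolded orthonormal_basis_iff[OF cW]]
  have mem: "\<psi> i \<in> ?W" if "i \<in> I" for i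
    using conjunct1[OF onb', rule_format, of "(i, 0)"] that by simp
  have inner: "L2_inner lebesgue (\<psi> i) (modulate k (\<psi> j)) = (if k = 0 then if i = j then 1 else 0 else 0)"
    if "i \<in> I" "j \<in> I" for i j k
    using conjunct1[OF conjunct2[OF onb'], rule_format, of "(i, 0)" "(j, k)"] that by auto
  have compl: "AE x in lebesgue. f x = 0"
    if "f \<in> ?W" "\<And>i k. i \<in> I \<Longrightarrow> L2_inner lebesgue f (modulate k (\<psi> i)) = 0" for f
    using conjunct2[OF conjunct2[OF onb'], rule_format, OF that(1)] that(2) by auto
  have "AE x in lebesgue_on torus. ell2_inner (lattice_fiber (\<psi> i) x) (lattice_fiber (\<psi> j) x) = (if i = j then 1 else 0)"
    if "i \<in> I" "j \<in> I" for i j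
    using lattice_fiber_inner_const_iff[OF \<psi>[OF that(1)] \<psi>[OF that(2)]] inner[OF that] by blast
  then have orth: "AE x in lebesgue_on torus. \<forall>i\<in>I. \<forall>j\<in>I.
      ell2_inner (lattice_fiber (\<psi> i) x) (lattice_fiber (\<psi> j) x) = (if i = j then 1 else 0)"
    by (simp add: AE_ball_countable)
  have fL: "AE x in lebesgue_on torus. \<forall>i\<in>I. lattice_fiber (\<psi> i) x \<in> ell2"
    using AE_lattice_fiber_ell2[OF \<psi>] by (simp add: AE_ball_countable)
  \<comment> \<open>Padding with zero functions turns the family over \<open>I\<close> into a
    sequence, to which the Gram-Schmidt construction for fibers applies, and leaves the closed spans
    unchanged.\<close>
  define \<Phi> where "\<Phi> i = (if i \<in> I then \<psi> i else 0)" for i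
  have \<Phi>L: "\<Phi> i \<in> L2 lebesgue" for i using \<psi> by (simp add: \<Phi>_def)
  obtain u where u: "\<And>j k. (\<lambda>x. u x j k) \<in> borel_measurable (lebesgue_on torus)" "\<And>x. orthonormal_or_zero (u x)"
    and ae: "AE x in lebesgue_on torus. ell2_span (range (u x))
      = ell2_span (range (\<lambda>j. lattice_fiber (\<Phi> j) x))"
    by (rule gram_schmidt_fibers[of \<Phi>], rule \<Phi>L, rule that)
  let ?K = "\<lambda>x. ell2_span (range (u x))"
  have K: "measurable_range_function ?K" by (rule orthonormal_or_zero_range_functionI[OF u])
  have KI: "AE x in lebesgue_on torus. ?K x = ell2_span ((\<lambda>i. lattice_fiber (\<psi> i) x) ` I)"
    using ae fL
  proof eventually_elim
    case (elim x)
    have z: "lattice_fiber 0 x = 0" by (simp add: lattice_fiber_def fun_eq_iff)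
    have \<Phi>x: "lattice_fiber (\<Phi> j) x = (if j \<in> I then lattice_fiber (\<psi> j) x else 0)" for j
      using z by (auto simp: \<Phi>_def)
    show ?case unfolding elim(1)
    proof (rule closed_span_insert_zeros)
      show "(\<lambda>i. lattice_fiber (\<psi> i) x) ` I \<subseteq> ell2" using elim(2) by blast
      show "range (\<lambda>j. lattice_fiber (\<Phi> j) x) \<subseteq> ell2" unfolding \<Phi>x using elim(2) by auto
      show "(\<lambda>i. lattice_fiber (\<psi> i) x) ` I \<subseteq> range (\<lambda>j. lattice_fiber (\<Phi> j) x)"
      proof
        fix a assume "a \<in> (\<lambda>i. lattice_fiber (\<psi> i) x) ` I"
        then obtain i where "i \<in> I" "a = lattice_fiber (\<psi> i) x" by blast
        then have "a = lattice_fiber (\<Phi> i) x" by (simp add: \<Phi>x)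
        then show "a \<in> range (\<lambda>j. lattice_fiber (\<Phi> j) x)" by blast
      qed
      show "range (\<lambda>j. lattice_fiber (\<Phi> j) x) \<subseteq> insert 0 ((\<lambda>i. lattice_fiber (\<psi> i) x) ` I)"
        unfolding \<Phi>x by auto
    qed
  qed
  have "?W = fiber_space ?K"
  proof (rule modulation_generated_eq_fiber_space[OF cW _ mem _ compl _ KI])
    show "modulate k f \<in> ?W" if "f \<in> ?W" for f k by (rule fourier_image_modulate[OF V that])
    show "countable I" by simp
    show "ell2_closed (?K x)" if "x \<in> torus" for x
      using K that by (simp add: measurable_range_function_def range_function_def)
  qed
  moreover obtain e where e: "\<And>j k. (\<lambda>x. e x j k) \<in> borel_measurable (lebesgue_on torus)" "\<And>x. orthonormal_or_zero (e x)"
    and W: "?W = fiber_space (\<lambda>x. ell2_span (range (e x)))"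
    and R: "AE x in lebesgue_on torus. range_function_of V x = ell2_span (range (e x))"
    by (rule shift_invariant_range_function[OF V], rule that)
  ultimately have "AE x in lebesgue_on torus. ell2_span (range (e x)) = ?K x"
    by (intro range_function_unique[OF orthonormal_or_zero_range_functionI[OF e] K]) simp
  with R KI fL orth show ?thesis
  proof eventually_elim
    case (elim x)
    have "dim_fun V x = cdim (ell2_span ((\<lambda>i. lattice_fiber (\<psi> i) x) ` I))"
      unfolding dim_fun_def using elim(1,2,5) by simp
    also have "\<dots> = set_enat I" by (rule cdim_orthonormal_family) (use elim(3,4) in blast)+
    finally show ?case .
  qed
qed

text \<open>The \<open>i\<close>-th nonzero member of the measurable family \<open>e x\<close> is
  measurable in \<open>x\<close> and has norm at most 1, so these fields glue to functions
  \<open>\<psi> i\<close> in \<open>L2\<close>. Orthonormality and totality are then read off fiber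
  by fiber.\<close>

lemma basis_of_constant_dimension:
  fixes V :: "(real ^ 'n \<Rightarrow> complex) set"
  assumes V: "shift_invariant V" and dim: "AE x in lebesgue_on torus. dim_fun V x = N"
  shows "\<exists>\<psi>. (\<forall>i. \<psi> i \<in> L2 lebesgue) \<and>
    orthonormal_basis lebesgue (index_set N \<times> UNIV) (\<lambda>(i, k). modulate k (\<psi> i)) (fourier_image V)"
proof -
  let ?W = "fourier_image V"
  have cV: "closed_subspace lebesgue V" using V by (simp add: shift_invariant_def)
  have cW: "closed_subspace lebesgue ?W"
    unfolding fourier_image_def by (rule closed_subspace_fourier_image[OF cV])
  obtain e where e: "\<And>j k. (\<lambda>x. e x j k) \<in> borel_measurable (lebesgue_on torus)" "\<And>x. orthonormal_or_zero (e x)"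
    and W: "?W = fiber_space (\<lambda>x. ell2_span (range (e x)))"
    and R: "AE x in lebesgue_on torus. range_function_of V x = ell2_span (range (e x))"
    by (rule shift_invariant_range_function[OF V], rule that)
  let ?J = "\<lambda>x. ell2_span (range (e x))"
  have eL: "e x j \<in> ell2" for x j by (rule orthonormal_or_zeroD(1)[OF e(2)])
  define E where "E i x = nth_nonzero (e x) i" for i x
  have Ecases: "E i x = 0 \<or> (\<exists>j. e x j \<noteq> 0 \<and> E i x = e x j)" for i x unfolding E_def by (rule nth_nonzero_cases)
  have EL: "E i x \<in> ell2" for i x using Ecases[of i x] eL by auto
  have En: "ell2_norm (E i x) \<le> 1" for i x
    using Ecases[of i x]
  proof
    assume "\<exists>j. e x j \<noteq> 0 \<and> E i x = e x j"
    then obtain j where "e x j \<noteq> 0" "E i x = e x j" by blast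
    then have "ell2_inner (E i x) (E i x) = 1" using orthonormal_or_zeroD(2)[OF e(2), of x j j] by simp
    then have "(ell2_norm (E i x))\<^sup>2 = 1" unfolding L2_inner_self using of_real_eq_1_iff by blast
    then show ?thesis unfolding power2_eq_1_iff by linarith
  qed simp
  define \<psi> where "\<psi> i = glue_fibers (E i)" for i
  have \<psi>L: "\<psi> i \<in> L2 lebesgue" for i
    unfolding \<psi>_def
  proof (rule glue_fibers_L2[of _ 1])
    show "(\<lambda>x. E i x k) \<in> borel_measurable (lebesgue_on torus)" for k
      unfolding E_def by (rule borel_measurable_nth_nonzero[OF e])
  qed (use EL En in auto)
  have fib: "lattice_fiber (\<psi> i) x = E i x" if "x \<in> torus" for i x
    unfolding \<psi>_def by (rule lattice_fiber_glue[OF that])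
  have xT: "AE x in lebesgue_on (torus :: (real ^ 'n) set). x \<in> torus" by (rule AE_torusI)
  \<comment> \<open>Here the constancy of the dimension enters: almost everywhere the nonzero
    members are numbered by exactly \<open>index_set N\<close>.\<close>
  have D: "AE x in lebesgue_on torus. set_enat {j. e x j \<noteq> 0} = N"
    using R dim by eventually_elim (simp add: dim_fun_def cdim_orthonormal_or_zero[OF e(2)])
  have "\<psi> i \<in> fiber_space ?J" for i
  proof -
    have "AE x in lebesgue_on torus. lattice_fiber (\<psi> i) x \<in> ?J x"
    proof (rule AE_torusI)
      fix x :: "real ^ 'n" assume x: "x \<in> torus"
      have J: "ell2_closed (?J x)" using eL by (intro closed_subspace_closed_span) auto
      have "range (e x) \<subseteq> ?J x" by (rule closed_span_base) (use eL in auto)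
      then show "lattice_fiber (\<psi> i) x \<in> ?J x"
        unfolding fib[OF x] using Ecases[of i x] cfun.subspace_0[OF closed_subspaceD(2)[OF J]] by auto
    qed
    then show ?thesis using \<psi>L by (simp add: fiber_space_def)
  qed
  then have \<psi>W: "modulate k (\<psi> i) \<in> ?W" for i k using fourier_image_modulate[OF V] W by blast
  have "L2_inner lebesgue (\<psi> i) (modulate k (\<psi> i')) = (if k = 0 then if i = i' then 1 else 0 else 0)"
    if i: "i \<in> index_set N" "i' \<in> index_set N" for i i' k
  proof -
    have "AE x in lebesgue_on torus. ell2_inner (lattice_fiber (\<psi> i) x) (lattice_fiber (\<psi> i') x) = (if i = i' then 1 else 0)"
      using xT D
    proof eventually_elim
      case (elim x)
      show ?case
        unfolding fib[OF elim(1)] E_def by (rule nth_nonzero_orthonormal[OF e(2)]) (use i elim(2) in auto)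
    qed
    then show ?thesis using lattice_fiber_inner_const_iff[OF \<psi>L \<psi>L] by blast
  qed
  then have inner: "L2_inner lebesgue (modulate k (\<psi> i)) (modulate k' (\<psi> i')) = (if (i, k) = (i', k') then 1 else 0)"
    if "i \<in> index_set N" "i' \<in> index_set N" for i i' k k'
    using that by (simp add: L2_inner_modulate)
  have compl: "AE x in lebesgue. f x = 0"
    if f: "f \<in> ?W" "\<And>i k. i \<in> index_set N \<Longrightarrow> L2_inner lebesgue f (modulate k (\<psi> i)) = 0" for f
  proof (rule fiber_space_orthogonal_zero[of "index_set N" \<psi> ?J f])
    show "AE x in lebesgue_on torus. ?J x \<subseteq> ell2_span ((\<lambda>i. lattice_fiber (\<psi> i) x) ` index_set N)"
      using xT D
    proof eventually_elim
      case (elim x)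
      have "(\<lambda>i. lattice_fiber (\<psi> i) x) ` index_set N = e x ` {j. e x j \<noteq> 0}"
        unfolding fib[OF elim(1)] E_def using nth_nonzero_image[of "e x"] elim(2) by simp
      moreover have "?J x = ell2_span (e x ` {j. e x j \<noteq> 0})"
        by (rule closed_span_insert_zeros) (use eL in auto)
      ultimately show ?case by simp
    qed
  qed (use \<psi>L f W in auto)
  have "orthonormal_basis lebesgue (index_set N \<times> UNIV) (\<lambda>(i, k). modulate k (\<psi> i)) ?W"
    unfolding orthonormal_basis_iff[OF cW]
  proof (intro conjI ballI impI)
    fix f assume f: "f \<in> ?W" "\<forall>p\<in>index_set N \<times> UNIV. L2_inner lebesgue f (case p of (i, k) \<Rightarrow> modulate k (\<psi> i)) = 0"
    show "AE x in lebesgue. f x = 0"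
    proof (rule compl[OF f(1)])
      show "L2_inner lebesgue f (modulate k (\<psi> i)) = 0" if "i \<in> index_set N" for i k
        using f(2)[rule_format, of "(i, k)"] that by simp
    qed
  next
    fix p p' :: "nat \<times> (int ^ 'n)" assume p: "p \<in> index_set N \<times> UNIV" "p' \<in> index_set N \<times> UNIV"
    show "L2_inner lebesgue (case p of (i, k) \<Rightarrow> modulate k (\<psi> i)) (case p' of (i, k) \<Rightarrow> modulate k (\<psi> i)) = (if p = p' then 1 else 0)"
      using inner[of "fst p" "fst p'" "snd p" "snd p'"] p by (cases p; cases p') simp
  qed (use \<psi>W in auto)
  then show ?thesis using \<psi>L by blast
qed

theorem theorem8:
  fixes V :: "(real ^ 'n \<Rightarrow> complex) set" and N :: enat
  assumes "shift_invariant V" and "1 \<le> N"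
  shows "(\<exists>\<phi> :: nat \<Rightarrow> real ^ 'n \<Rightarrow> complex.
            (\<forall>i\<in>index_set N. \<phi> i \<in> L2 lebesgue) \<and>
            orthonormal_basis lebesgue (index_set N \<times> (UNIV :: (int ^ 'n) set))
              (\<lambda>(i, k) x. \<phi> i (x + lattice_vec k)) V)
         \<longleftrightarrow> (AE x in lebesgue_on torus. dim_fun V x = N)"
proof -
  have cV: "closed_subspace lebesgue V" using assms(1) by (simp add: shift_invariant_def)
  \<comment> \<open>Stated for any transforms \<open>\<psi> i\<close> of the
    \<open>\<phi> i\<close>, so that it applies both to the transforms selected by
    \<open>fourier\<close> and to functions constructed first on the transform side.\<close>
  have transport: "orthonormal_basis lebesgue (index_set N \<times> UNIV) (\<lambda>(i, k) x. \<phi> i (x + lattice_vec k)) V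
    \<longleftrightarrow> orthonormal_basis lebesgue (index_set N \<times> UNIV) (\<lambda>(i, k). modulate k (\<psi> i)) (fourier_image V)"
    if "\<And>i. i \<in> index_set N \<Longrightarrow> \<phi> i \<in> L2 lebesgue" "\<And>i. i \<in> index_set N \<Longrightarrow> is_fourier_transform (\<phi> i) (\<psi> i)"
    for \<phi> \<psi> :: "nat \<Rightarrow> real ^ 'n \<Rightarrow> complex"
  proof (rule orthonormal_basis_fourier_image[OF cV])
    fix p :: "nat \<times> (int ^ 'n)" assume "p \<in> index_set N \<times> UNIV"
    then obtain i k where p: "p = (i, k)" "i \<in> index_set N" by blast
    show "(case p of (i, k) \<Rightarrow> \<lambda>x. \<phi> i (x + lattice_vec k)) \<in> L2 lebesgue"
      unfolding p(1) prod.case by (rule L2_translate(1)[OF that(1)[OF p(2)]])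
    show "is_fourier_transform (case p of (i, k) \<Rightarrow> \<lambda>x. \<phi> i (x + lattice_vec k)) (case p of (i, k) \<Rightarrow> modulate k (\<psi> i))"
      unfolding p(1) prod.case by (rule is_fourier_transform_shift[OF that(1)[OF p(2)] that(2)[OF p(2)]])
  qed
  show ?thesis
  proof
    assume "\<exists>\<phi>. (\<forall>i\<in>index_set N. \<phi> i \<in> L2 lebesgue) \<and>
      orthonormal_basis lebesgue (index_set N \<times> UNIV) (\<lambda>(i, k) x. \<phi> i (x + lattice_vec k)) V"
    then obtain \<phi> where \<phi>: "\<And>i. i \<in> index_set N \<Longrightarrow> \<phi> i \<in> L2 lebesgue"
      and onb: "orthonormal_basis lebesgue (index_set N \<times> UNIV) (\<lambda>(i, k) x. \<phi> i (x + lattice_vec k)) V" by blast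
    have "orthonormal_basis lebesgue (index_set N \<times> UNIV) (\<lambda>(i, k). modulate k (fourier (\<phi> i))) (fourier_image V)"
      using transport[OF \<phi> fourier_is_fourier_transform[OF \<phi>]] onb by simp
    from cdim_range_function_of_basis[OF assms(1) fourier_L2[OF \<phi>] this]
    show "AE x in lebesgue_on torus. dim_fun V x = N" by (simp add: set_enat_index_set)
  next
    assume "AE x in lebesgue_on torus. dim_fun V x = N"
    from basis_of_constant_dimension[OF assms(1) this] obtain \<psi> where \<psi>: "\<And>i. \<psi> i \<in> L2 lebesgue"
      and onb: "orthonormal_basis lebesgue (index_set N \<times> UNIV) (\<lambda>(i, k). modulate k (\<psi> i)) (fourier_image V)" by blast
    have "\<forall>i. \<exists>f. f \<in> L2 lebesgue \<and> is_fourier_transform f (\<psi> i)"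
      using is_fourier_transform_surj[OF \<psi>] by blast
    then obtain \<phi> where \<phi>: "\<And>i. \<phi> i \<in> L2 lebesgue" "\<And>i. is_fourier_transform (\<phi> i) (\<psi> i)" by metis
    then show "\<exists>\<phi>. (\<forall>i\<in>index_set N. \<phi> i \<in> L2 lebesgue) \<and>
      orthonormal_basis lebesgue (index_set N \<times> UNIV) (\<lambda>(i, k) x. \<phi> i (x + lattice_vec k)) V"
      using transport[of \<phi> \<psi>] onb by blast
  qed
qed

end
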